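(* Let $U\subseteq\mathbb{R}^n$ be open and connected, let $X=(X_1,\dots,X_m)$, $m\le n$, be vector fields on $U$ with $X_i\in C^2(U,\mathbb{R}^n)$ for every $i=1,\dots,m$, and assume that the Carnot-Carathéodory distance $d_X$ is a (finite) distance on $U$ which is continuous with respect to the Euclidean topology. Let $f\in C^2(U\times\mathbb{R}\times\mathbb{R}^m,[0,\infty))$ be such that $p\mapsto f(x,s,p)$ is quasiconvex for every $x\in U$ and every $s\in\mathbb{R}$. Then every absolute minimizer $u\in W^{1,\infty}_X(U)$ of the supremal functional $F(u,V)=\|f(x,u,Xu)\|_{L^\infty(V)}$ is a viscosity solution on $U$ of the Aronsson equation $$A_f[\phi](x)=-\sum_{i=1}^m X_i\big(f(x,\phi(x),X\phi(x))\big)\,\frac{\partial f}{\partial p_i}(x,\phi(x),X\phi(x))=0 .$$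
   Context: Vector fields. Write $X_j=\sum_{i=1}^n c_{j,i}\,\partial/\partial x_i$ and let $C(x)=[c_{j,i}(x)]$ be the $m\times n$ matrix whose $j$-th row contains the coefficients of $X_j$. An absolutely continuous curve $\gamma:[0,\delta]\to U$ is horizontal if there are measurable functions $a_1,\dots,a_m$ with $\dot\gamma(t)=\sum_j a_j(t)X_j(\gamma(t))$ for a.e. $t$; it is subunit if moreover $\sum_j a_j(t)^2\le1$ for a.e. $t$. The Carnot-Carathéodory distance is $d_X(x,y)=\inf\{\delta\ge 0:\ \text{there is a subunit curve }\gamma:[0,\delta]\to U\text{ with }\gamma(0)=x,\ \gamma(\delta)=y\}$. Horizontal gradient and Sobolev spaces. For $u\in L^1_{loc}(U)$ the distributional horizontal gradient $Xu$ is defined by $\langle Xu,\varphi\rangle=-\int_U u\,\mathrm{div}(\varphi\cdot C(x))\,dx$ for $\varphi\in C_c^\infty(U,\mathbb{R}^m)$ (row vectors). For open $V\subseteq U$, $W^{1,\infty}_X(V)=\{u\in L^\infty(V): Xu\in L^\infty(V,\mathbb{R}^m)\}$. Under the stated assumption on $d_X$ such functions have continuous representatives, with which they are identified. A function $g:\mathbb{R}^m\to\mathbb{R}$ is quasiconvex if $g(tp_1+(1-t)p_2)\le\max\{g(p_1),g(p_2)\}$ for all $p_1,p_2\in\mathbb{R}^m$, $t\in(0,1)$. Supremal functional and absolute minimizers. For $V\subseteq U$ open and $v\in W^{1,\infty}_X(V)$, $F(v,V):=\|f(x,v,Xv)\|_{L^\infty(V)}$. A function $u\in W^{1,\infty}_X(U)$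 is an absolute minimizer of $F$ if $F(u,V)\le F(v,V)$ for every open $V\Subset U$ (meaning $\overline V\subseteq U$) and every $v\in W^{1,\infty}_X(V)$ with $v|_{\partial V}=u|_{\partial V}$ (that is, $v$ extends continuously to $\partial V$ with values $u$). Aronsson operator. For $\phi\in C^2(U)$, $A_f[\phi](x):=-X(f(x,\phi,X\phi))\cdot D_pf(x,\phi,X\phi)^T$, where $X(f(x,\phi,X\phi))$ is the horizontal gradient of the function $x\mapsto f(x,\phi(x),X\phi(x))$ and $D_pf=(\partial f/\partial p_1,\dots,\partial f/\partial p_m)$. Viscosity solutions. $u\in C(U)$ is a viscosity subsolution of the Aronsson equation if $A_f[\phi](x_0)\le0$ for all $x_0\in U$ and all $\phi\in C^2(U)$ such that $0=\phi(x_0)-u(x_0)\le\phi(x)-u(x)$ for all $x$ in a neighbourhood of $x_0$. It is a viscosity supersolution if $A_f[\phi](x_0)\ge0$ for all $x_0\in U$ and all $\phi\in C^2(U)$ such that $0=\phi(x_0)-u(x_0)\ge\phi(x)-u(x)$ for all $x$ in a neighbourhood of $x_0$. It is a viscosity solution if it is both. *)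

theory Defs
  imports "HOL-Analysis.Analysis" "HOL-Probability.Essential_Supremum"
begin

text \<open>A family of vector fields \<open>X\<^sub>1, \<dots>, X\<^sub>m\<close> is a function \<open>X :: 'm \<Rightarrow> real^'n \<Rightarrow> real^'n\<close>; the
  coefficient \<open>c\<^sub>j\<^sub>,\<^sub>i(x)\<close> is \<open>X j x $ i\<close>. Functions on an open set are total functions of which only
  the values on that set matter.\<close>

subsection \<open>Regularity classes\<close>

text \<open>Meant for open \<open>S\<close>: the derivatives are taken in the full space.\<close>

primrec Ck_on :: "nat \<Rightarrow> 'a::euclidean_space set \<Rightarrow> ('a \<Rightarrow> 'b::real_normed_vector) \<Rightarrow> bool" where
  "Ck_on 0 S g \<longleftrightarrow> continuous_on S g"
| "Ck_on (Suc k) S g \<longleftrightarrow> (\<forall>x\<in>S. g differentiable at x) \<and>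
     (\<forall>b\<in>Basis. Ck_on k S (\<lambda>x. frechet_derivative g (at x) b))"

definition test_function :: "'a::euclidean_space set \<Rightarrow> ('a \<Rightarrow> 'b::real_normed_vector) \<Rightarrow> bool" where
  "test_function V \<phi> \<longleftrightarrow> (\<forall>k. Ck_on k UNIV \<phi>) \<and>
     compact (closure {x. \<phi> x \<noteq> 0}) \<and> closure {x. \<phi> x \<noteq> 0} \<subseteq> V"

definition L1_loc :: "'a::euclidean_space set \<Rightarrow> ('a \<Rightarrow> 'b::euclidean_space) set" where
  "L1_loc V = {g. \<forall>K. compact K \<and> K \<subseteq> V \<longrightarrow> g absolutely_integrable_on K}"

definition Linf_norm :: "'a::euclidean_space set \<Rightarrow> ('a \<Rightarrow> 'b::euclidean_space) \<Rightarrow> ennreal" where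
  "Linf_norm V g = esssup (lebesgue_on V) (\<lambda>x. ennreal (norm (g x)))"

definition Linf :: "'a::euclidean_space set \<Rightarrow> ('a \<Rightarrow> 'b::euclidean_space) set" where
  "Linf V = {g. g \<in> borel_measurable (lebesgue_on V) \<and> Linf_norm V g < \<infinity>}"

definition quasiconvex :: "('a::real_vector \<Rightarrow> real) \<Rightarrow> bool" where
  "quasiconvex g \<longleftrightarrow> (\<forall>p q t. 0 < t \<and> t < 1 \<longrightarrow> g (t *\<^sub>R p + (1 - t) *\<^sub>R q) \<le> max (g p) (g q))"

subsection \<open>Carnot-Caratheodory distance\<close>

definition abs_continuous_on_interval :: "real \<Rightarrow> real \<Rightarrow> (real \<Rightarrow> 'a::real_normed_vector) \<Rightarrow> bool" where
  "abs_continuous_on_interval a b \<gamma> \<longleftrightarrow>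
     (\<forall>\<epsilon>>0. \<exists>\<eta>>0. \<forall>(N::nat) s t.
        (\<forall>k<N. a \<le> s k \<and> s k \<le> t k \<and> t k \<le> b) \<and>
        (\<forall>k<N. \<forall>l<N. k \<noteq> l \<longrightarrow> {s k<..<t k} \<inter> {s l<..<t l} = {}) \<and>
        (\<Sum>k<N. t k - s k) < \<eta>
        \<longrightarrow> (\<Sum>k<N. norm (\<gamma> (t k) - \<gamma> (s k))) < \<epsilon>)"

definition subunit_curve ::
  "(real^'n) set \<Rightarrow> ('m::finite \<Rightarrow> real^'n \<Rightarrow> real^'n) \<Rightarrow> real \<Rightarrow> (real \<Rightarrow> real^'n) \<Rightarrow> bool" where
  "subunit_curve U X \<delta> \<gamma> \<longleftrightarrow>
     \<gamma> ` {0..\<delta>} \<subseteq> U \<and> abs_continuous_on_interval 0 \<delta> \<gamma> \<and>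
     (\<exists>a :: 'm \<Rightarrow> real \<Rightarrow> real.
        (\<forall>j. a j \<in> borel_measurable (lebesgue_on {0..\<delta>})) \<and>
        (AE t in lebesgue_on {0..\<delta>}.
           (\<gamma> has_vector_derivative (\<Sum>j\<in>UNIV. a j t *\<^sub>R X j (\<gamma> t))) (at t within {0..\<delta>})) \<and>
        (AE t in lebesgue_on {0..\<delta>}. (\<Sum>j\<in>UNIV. (a j t)\<^sup>2) \<le> 1))"

text \<open>The infimum over the empty set is \<open>\<infinity>\<close>.\<close>

definition cc_dist ::
  "(real^'n) set \<Rightarrow> ('m::finite \<Rightarrow> real^'n \<Rightarrow> real^'n) \<Rightarrow> real^'n \<Rightarrow> real^'n \<Rightarrow> ennreal" where
  "cc_dist U X x y =
     Inf {ennreal \<delta> |\<delta>. \<delta> \<ge> 0 \<and> (\<exists>\<gamma>. subunit_curve U X \<delta> \<gamma> \<and> \<gamma> 0 = x \<and> \<gamma> \<delta> = y)}"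

definition cc_continuous_distance ::
  "(real^'n) set \<Rightarrow> ('m::finite \<Rightarrow> real^'n \<Rightarrow> real^'n) \<Rightarrow> bool" where
  "cc_continuous_distance U X \<longleftrightarrow>
     (\<forall>x\<in>U. \<forall>y\<in>U. cc_dist U X x y < \<infinity>) \<and>
     Metric_space U (\<lambda>x y. enn2real (cc_dist U X x y)) \<and>
     continuous_on (U \<times> U) (\<lambda>(x, y). enn2real (cc_dist U X x y))"

subsection \<open>Horizontal gradients and Sobolev spaces\<close>

definition partial_deriv :: "'i::finite \<Rightarrow> (real^'i \<Rightarrow> real) \<Rightarrow> real^'i \<Rightarrow> real" where
  "partial_deriv i g x = frechet_derivative g (at x) (axis i 1)"

text \<open>The classical horizontal gradient, for differentiable functions.\<close>

definition horizontal_grad ::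
  "('m::finite \<Rightarrow> real^'n \<Rightarrow> real^'n) \<Rightarrow> (real^'n \<Rightarrow> real) \<Rightarrow> real^'n \<Rightarrow> real^'m" where
  "horizontal_grad X \<phi> x = (\<chi> j. \<Sum>i\<in>UNIV. X j x $ i * partial_deriv i \<phi> x)"

definition divergence :: "(real^'n::finite \<Rightarrow> real^'n) \<Rightarrow> real^'n \<Rightarrow> real" where
  "divergence G x = (\<Sum>i\<in>UNIV. partial_deriv i (\<lambda>y. G y $ i) x)"

definition coeff_matrix :: "('m::finite \<Rightarrow> real^'n \<Rightarrow> real^'n) \<Rightarrow> real^'n \<Rightarrow> real^'n^'m" where
  "coeff_matrix X x = (\<chi> j i. X j x $ i)"

definition is_weak_horizontal_grad ::
  "('m::finite \<Rightarrow> real^'n \<Rightarrow> real^'n) \<Rightarrow> (real^'n) set \<Rightarrow> (real^'n \<Rightarrow> real) \<Rightarrow> (real^'n \<Rightarrow> real^'m) \<Rightarrow> bool"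
  where
  "is_weak_horizontal_grad X V u w \<longleftrightarrow> u \<in> L1_loc V \<and> w \<in> L1_loc V \<and>
     (\<forall>\<phi> :: real^'n \<Rightarrow> real^'m. test_function V \<phi> \<longrightarrow>
        (LINT x|lebesgue_on V. w x \<bullet> \<phi> x) =
        - (LINT x|lebesgue_on V. u x * divergence (\<lambda>y. \<phi> y v* coeff_matrix X y) x))"

text \<open>A representative of the distributional gradient; it is determined up to null sets.\<close>

definition weak_horizontal_grad ::
  "('m::finite \<Rightarrow> real^'n \<Rightarrow> real^'n) \<Rightarrow> (real^'n) set \<Rightarrow> (real^'n \<Rightarrow> real) \<Rightarrow> real^'n \<Rightarrow> real^'m" where
  "weak_horizontal_grad X V u = (SOME w. is_weak_horizontal_grad X V u w)"

definition W1inf ::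
  "('m::finite \<Rightarrow> real^'n \<Rightarrow> real^'n) \<Rightarrow> (real^'n) set \<Rightarrow> (real^'n \<Rightarrow> real) set" where
  "W1inf X V = {u \<in> Linf V. \<exists>w \<in> Linf V. is_weak_horizontal_grad X V u w}"

text \<open>The continuous representatives, with which the Sobolev functions are identified.\<close>

definition W1inf_cont ::
  "('m::finite \<Rightarrow> real^'n \<Rightarrow> real^'n) \<Rightarrow> (real^'n) set \<Rightarrow> (real^'n \<Rightarrow> real) set" where
  "W1inf_cont X V = {u \<in> W1inf X V. continuous_on V u}"

subsection \<open>Absolute minimizers of the supremal functional\<close>

definition supremal_functional ::
  "('m::finite \<Rightarrow> real^'n \<Rightarrow> real^'n) \<Rightarrow> (real^'n \<Rightarrow> real \<Rightarrow> real^'m \<Rightarrow> real) \<Rightarrow>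
     (real^'n \<Rightarrow> real) \<Rightarrow> (real^'n) set \<Rightarrow> ennreal" where
  "supremal_functional X f v V = Linf_norm V (\<lambda>x. f x (v x) (weak_horizontal_grad X V v x))"

text \<open>The boundary condition says that \<open>v\<close> on \<open>V\<close>, extended by \<open>u\<close> on the boundary of the
  open set \<open>V\<close>, is continuous up to the boundary.\<close>

definition absolute_minimizer ::
  "(real^'n) set \<Rightarrow> ('m::finite \<Rightarrow> real^'n \<Rightarrow> real^'n) \<Rightarrow> (real^'n \<Rightarrow> real \<Rightarrow> real^'m \<Rightarrow> real) \<Rightarrow>
     (real^'n \<Rightarrow> real) \<Rightarrow> bool" where
  "absolute_minimizer U X f u \<longleftrightarrow> u \<in> W1inf_cont X U \<and>
     (\<forall>V v. open V \<and> closure V \<subseteq> U \<and> v \<in> W1inf_cont X V \<and>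
        continuous_on (closure V) (\<lambda>x. if x \<in> V then v x else u x)
        \<longrightarrow> supremal_functional X f u V \<le> supremal_functional X f v V)"

subsection \<open>The Aronsson equation\<close>

definition aronsson_op ::
  "('m::finite \<Rightarrow> real^'n \<Rightarrow> real^'n) \<Rightarrow> (real^'n \<Rightarrow> real \<Rightarrow> real^'m \<Rightarrow> real) \<Rightarrow>
     (real^'n \<Rightarrow> real) \<Rightarrow> real^'n \<Rightarrow> real" where
  "aronsson_op X f \<phi> x =
     - (\<Sum>i\<in>UNIV. horizontal_grad X (\<lambda>y. f y (\<phi> y) (horizontal_grad X \<phi> y)) x $ i *
                  partial_deriv i (\<lambda>p. f x (\<phi> x) p) (horizontal_grad X \<phi> x))"

definition viscosity_subsolution ::
  "(real^'n) set \<Rightarrow> ('m::finite \<Rightarrow> real^'n \<Rightarrow> real^'n) \<Rightarrow> (real^'n \<Rightarrow> real \<Rightarrow> real^'m \<Rightarrow> real) \<Rightarrow>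
     (real^'n \<Rightarrow> real) \<Rightarrow> bool" where
  "viscosity_subsolution U X f u \<longleftrightarrow> continuous_on U u \<and>
     (\<forall>x0\<in>U. \<forall>\<phi>. Ck_on 2 U \<phi> \<and> \<phi> x0 - u x0 = 0 \<and> (\<forall>\<^sub>F x in nhds x0. 0 \<le> \<phi> x - u x)
        \<longrightarrow> aronsson_op X f \<phi> x0 \<le> 0)"

definition viscosity_supersolution ::
  "(real^'n) set \<Rightarrow> ('m::finite \<Rightarrow> real^'n \<Rightarrow> real^'n) \<Rightarrow> (real^'n \<Rightarrow> real \<Rightarrow> real^'m \<Rightarrow> real) \<Rightarrow>
     (real^'n \<Rightarrow> real) \<Rightarrow> bool" where
  "viscosity_supersolution U X f u \<longleftrightarrow> continuous_on U u \<and>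
     (\<forall>x0\<in>U. \<forall>\<phi>. Ck_on 2 U \<phi> \<and> \<phi> x0 - u x0 = 0 \<and> (\<forall>\<^sub>F x in nhds x0. \<phi> x - u x \<le> 0)
        \<longrightarrow> aronsson_op X f \<phi> x0 \<ge> 0)"

definition viscosity_solution ::
  "(real^'n) set \<Rightarrow> ('m::finite \<Rightarrow> real^'n \<Rightarrow> real^'n) \<Rightarrow> (real^'n \<Rightarrow> real \<Rightarrow> real^'m \<Rightarrow> real) \<Rightarrow>
     (real^'n \<Rightarrow> real) \<Rightarrow> bool" where
  "viscosity_solution U X f u \<longleftrightarrow> viscosity_subsolution U X f u \<and> viscosity_supersolution U X f u"

end

theory Submission
  imports Defs "HOL-Computational_Algebra.Polynomial"
begin

text \<open>
  Both halves of the statement have the same proof; a sign \<open>\<sigma> = 1\<close> (subsolution) or \<open>\<sigma> = -1\<close>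
  (supersolution) distinguishes them. Suppose that \<open>\<phi>\<close> touches \<open>u\<close> at \<open>x0\<close> with
  \<open>\<sigma> (\<phi> - u) \<ge> 0\<close> near \<open>x0\<close>, while \<open>\<sigma> A\<^sub>f[\<phi>](x0) > 0\<close>. Write \<open>h(x) = f(x, \<phi>, X\<phi>)\<close>,
  let \<open>q0 = D\<^sub>p f\<close> at \<open>x0\<close>, and let \<open>z = \<Sum> q0\<^sub>j X\<^sub>j(x0)\<close> be the characteristic direction. The
  hypothesis says that \<open>\<sigma> (\<nabla>h(x0) \<bullet> z) < 0\<close>.

  This is exactly the solvability condition for a positive definite matrix \<open>M\<close> with
  \<open>M z = -\<sigma> \<nabla>h(x0)\<close>. Replacing \<open>\<phi>\<close> by \<open>\<psi> = \<phi> + \<sigma>/2 (x - x0) \<bullet> M (x - x0)\<close> makes the gradient of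
  \<open>f(x, \<psi>, X\<psi>)\<close> vanish at \<open>x0\<close> and makes the contact strict to second order:
  \<open>\<sigma> (u - \<psi>) \<le> -c |x - x0|\<^sup>2\<close> (lemma \<open>exists_corrected_test_function\<close>). With this quadratic
  correction no Hamilton-Jacobi equation has to be solved.

  Fix a small \<open>\<eta>\<close> and let \<open>r\<close> be small. The set \<open>V = {\<sigma> (u - \<psi>) > -c r\<^sup>2}\<close> near \<open>x0\<close> lies in the ball
  of radius \<open>r\<close>, and on its boundary \<open>u\<close> equals the competitor \<open>\<psi> - \<sigma> c r\<^sup>2\<close>, for which \<open>f\<close> differs from
  its value \<open>h0\<close> at \<open>x0\<close> by at most \<open>\<eta> r\<close>. Minimality gives \<open>f(x, u, Xu) \<le> h0 + \<eta> r\<close> almost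
  everywhere in \<open>V\<close> (\<open>absolute_minimizer_AE_le\<close>), whereas \<open>f(x, u, X\<psi>) \<ge> h0 - \<eta> r\<close>. Quasiconvexity
  turns this into \<open>Q \<bullet> (Xu - X\<psi>) \<le> 6 \<eta> r\<close>, where \<open>Q\<close> is \<open>D\<^sub>p f\<close> at a momentum near \<open>X\<psi>\<close>
  (\<open>quasiconvex_drift_estimate\<close>). Adding to \<open>\<psi>\<close> a linear function of slope proportional to \<open>\<eta> r\<close> in
  direction \<open>z\<close> makes the right-hand side \<open>-\<eta> r < 0\<close>; on \<open>V\<close> this function is small compared with
  \<open>c r\<^sup>2\<close>, so that \<open>\<sigma> (u - \<psi>')\<close> still has an interior maximum.

  A continuous function whose weak derivative along a continuous combination of the fields is
  bounded above by a negative constant has no interior maximum (\<open>strict_weak_inequality_imp_no_interior_max\<close>). At a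
  maximum \<open>x\<close> of the mollified function the derivative vanishes; testing the weak gradient with the
  mollifier centred at \<open>x\<close> times the constant vector \<open>Q(x)\<close> then leaves only a commutator, which
  tends to zero with the oscillation of the function.
\<close>

section \<open>Functions of class \<open>C\<^sup>k\<close>\<close>

lemma eventually_nhds_imp_at: "eventually P (nhds x) \<Longrightarrow> eventually P (at x)"
  by (auto simp: eventually_at_filter elim: eventually_mono)

lemma frechet_derivative_transform_eventually:
  assumes "\<forall>\<^sub>F y in nhds x. f y = g y"
  shows "f differentiable at x \<longleftrightarrow> g differentiable at x"
    and "frechet_derivative f (at x) = frechet_derivative g (at x)"
proof -
  have eq: "(f has_derivative D) (at x) \<longleftrightarrow> (g has_derivative D) (at x)" for D
    using assms has_derivative_transform_eventually[of f D x UNIV g]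
      has_derivative_transform_eventually[of g D x UNIV f]
    by (auto dest: eventually_nhds_x_imp_x eventually_nhds_imp_at simp: eq_commute)
  show "f differentiable at x \<longleftrightarrow> g differentiable at x"
    unfolding differentiable_def using eq by blast
  show "frechet_derivative f (at x) = frechet_derivative g (at x)"
    unfolding frechet_derivative_def using eq by simp
qed

lemma Ck_on_cong:
  assumes "open S" "\<And>x. x \<in> S \<Longrightarrow> f x = g x"
  shows "Ck_on k S f \<longleftrightarrow> Ck_on k S g"
  using assms(2)
proof (induction k arbitrary: f g)
  case 0
  then show ?case by (simp cong: continuous_on_cong)
next
  case (Suc k)
  have ev: "\<forall>\<^sub>F y in nhds x. f y = g y" if "x \<in> S" for x
    using assms(1) that Suc.prems by (auto simp: eventually_nhds)
  note fd = frechet_derivative_transform_eventually[OF ev]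
  have "Ck_on k S (\<lambda>x. frechet_derivative f (at x) b) \<longleftrightarrow>
        Ck_on k S (\<lambda>x. frechet_derivative g (at x) b)" for b
    by (rule Suc.IH) (simp add: fd(2))
  then show ?case by (simp add: fd(1))
qed

lemma Ck_on_SucI:
  assumes "open S" "\<And>x. x \<in> S \<Longrightarrow> (f has_derivative D x) (at x)"
    and "\<And>b. b \<in> Basis \<Longrightarrow> Ck_on k S (\<lambda>x. D x b)"
  shows "Ck_on (Suc k) S f"
proof -
  have "frechet_derivative f (at x) = D x" if "x \<in> S" for x
    using assms(2)[OF that] by (metis frechet_derivative_at)
  then have "Ck_on k S (\<lambda>x. frechet_derivative f (at x) b) \<longleftrightarrow> Ck_on k S (\<lambda>x. D x b)" for b
    by (intro Ck_on_cong assms(1)) simp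
  then show ?thesis
    using assms(2,3) by (auto simp: differentiable_def)
qed

lemma Ck_on_continuous: "Ck_on k S f \<Longrightarrow> continuous_on S f"
  by (cases k) (auto intro!: continuous_at_imp_continuous_on differentiable_imp_continuous_within)

lemma Ck_on_lower: "Ck_on (Suc k) S f \<Longrightarrow> Ck_on k S f"
proof (induction k arbitrary: f)
  case 0
  then show ?case using Ck_on_continuous by (metis Ck_on.simps(1))
next
  case (Suc k)
  from Suc.prems have "\<forall>x\<in>S. f differentiable at x"
    and *: "\<And>b. b \<in> Basis \<Longrightarrow> Ck_on (Suc k) S (\<lambda>x. frechet_derivative f (at x) b)"
    unfolding Ck_on.simps(2)[of "Suc k"] by blast+
  with Suc.IH[OF *] show ?case unfolding Ck_on.simps(2)[of k] by blast
qed

lemma Ck_on_mono: "Ck_on k S f \<Longrightarrow> j \<le> k \<Longrightarrow> Ck_on j S f"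
  by (induction k) (use Ck_on_lower le_Suc_eq in blast)+

lemma Ck_on_subset: "Ck_on k S f \<Longrightarrow> T \<subseteq> S \<Longrightarrow> Ck_on k T f"
  by (induction k arbitrary: f) (auto intro: continuous_on_subset)

lemma Ck_on_has_derivative:
  assumes "Ck_on k S f" "0 < k" "x \<in> S"
  shows "(f has_derivative frechet_derivative f (at x)) (at x)"
  using assms by (cases k) (auto simp: frechet_derivative_works)

lemma Ck_on_const: "open S \<Longrightarrow> Ck_on k S (\<lambda>x. c)"
  by (induction k arbitrary: c) (auto simp: frechet_derivative_const)

lemma Ck_on_compose_linear:
  assumes "open S" "bounded_linear L"
  shows "Ck_on k S f \<Longrightarrow> Ck_on k S (\<lambda>x. L (f x))"
proof (induction k arbitrary: f)
  case 0
  then show ?case using assms(2) by (auto intro: bounded_linear.continuous_on)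
next
  case (Suc k)
  show ?case
    by (rule Ck_on_SucI[OF assms(1), where D = "\<lambda>x b. L (frechet_derivative f (at x) b)"])
       (use Suc Ck_on_has_derivative[OF Suc.prems] in
         \<open>auto intro: bounded_linear.has_derivative[OF assms(2)]\<close>)
qed

lemma Ck_on_linear:
  assumes "open S" "bounded_linear L"
  shows "Ck_on k S L"
proof (cases k)
  case 0
  then show ?thesis using assms(2) by (simp add: linear_continuous_on)
next
  case (Suc j)
  show ?thesis unfolding Suc
    by (rule Ck_on_SucI[where D = "\<lambda>x. L"])
       (use assms in \<open>auto intro: bounded_linear_imp_has_derivative Ck_on_const\<close>)
qed

lemma Ck_on_add:
  assumes "open S"
  shows "Ck_on k S f \<Longrightarrow> Ck_on k S g \<Longrightarrow> Ck_on k S (\<lambda>x. f x + g x)"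
proof (induction k arbitrary: f g)
  case 0
  then show ?case by (auto intro: continuous_on_add)
next
  case (Suc k)
  show ?case
    by (rule Ck_on_SucI[OF assms,
          where D = "\<lambda>x b. frechet_derivative f (at x) b + frechet_derivative g (at x) b"])
       (use Suc Ck_on_has_derivative[OF Suc.prems(1)] Ck_on_has_derivative[OF Suc.prems(2)]
         in \<open>auto intro: has_derivative_add\<close>)
qed

lemma Ck_on_sum:
  assumes "open S" "\<And>i. i \<in> I \<Longrightarrow> Ck_on k S (f i)"
  shows "Ck_on k S (\<lambda>x. \<Sum>i\<in>I. f i x)"
  using assms(2)
  by (induction I rule: infinite_finite_induct) (auto intro: Ck_on_const Ck_on_add assms(1))

lemma Ck_on_scaleR:
  fixes f :: "'a::euclidean_space \<Rightarrow> real" and g :: "'a \<Rightarrow> 'b::real_normed_vector"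
  assumes "open S"
  shows "Ck_on k S f \<Longrightarrow> Ck_on k S g \<Longrightarrow> Ck_on k S (\<lambda>x. f x *\<^sub>R g x)"
proof (induction k arbitrary: f g)
  case 0
  then show ?case by (auto intro: continuous_on_scaleR)
next
  case (Suc k)
  show ?case
  proof (rule Ck_on_SucI[OF assms, where
        D = "\<lambda>x b. f x *\<^sub>R frechet_derivative g (at x) b + frechet_derivative f (at x) b *\<^sub>R g x"])
    fix x assume "x \<in> S"
    then show "((\<lambda>x. f x *\<^sub>R g x) has_derivative
        (\<lambda>b. f x *\<^sub>R frechet_derivative g (at x) b + frechet_derivative f (at x) b *\<^sub>R g x)) (at x)"
      using Ck_on_has_derivative[OF Suc.prems(1)] Ck_on_has_derivative[OF Suc.prems(2)]
      by (intro has_derivative_scaleR) auto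
  next
    fix b :: 'a assume "b \<in> Basis"
    then have "Ck_on k S (\<lambda>x. frechet_derivative f (at x) b)"
      "Ck_on k S (\<lambda>x. frechet_derivative g (at x) b)"
      using Suc.prems by auto
    then show "Ck_on k S (\<lambda>x. f x *\<^sub>R frechet_derivative g (at x) b +
        frechet_derivative f (at x) b *\<^sub>R g x)"
      by (intro Ck_on_add assms Suc.IH Ck_on_lower[OF Suc.prems(1)] Ck_on_lower[OF Suc.prems(2)])
  qed
qed

lemma Ck_on_mult:
  fixes f g :: "'a::euclidean_space \<Rightarrow> real"
  shows "open S \<Longrightarrow> Ck_on k S f \<Longrightarrow> Ck_on k S g \<Longrightarrow> Ck_on k S (\<lambda>x. f x * g x)"
  using Ck_on_scaleR[of S k f g] by simp

lemma Ck_on_cmult: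
  fixes f :: "'a::euclidean_space \<Rightarrow> real"
  shows "open S \<Longrightarrow> Ck_on k S f \<Longrightarrow> Ck_on k S (\<lambda>x. c * f x)"
  by (intro Ck_on_mult Ck_on_const)

lemma Ck_on_minus:
  fixes f g :: "'a::euclidean_space \<Rightarrow> 'b::real_normed_vector"
  shows "open S \<Longrightarrow> Ck_on k S f \<Longrightarrow> Ck_on k S g \<Longrightarrow> Ck_on k S (\<lambda>x. f x - g x)"
  using Ck_on_add[of S k f "\<lambda>x. - g x"]
    Ck_on_compose_linear[OF _ bounded_linear_minus[OF bounded_linear_ident], of S k g]
  by simp

lemma Ck_on_prod:
  fixes f :: "'i \<Rightarrow> 'a::euclidean_space \<Rightarrow> real"
  assumes "open S" "\<And>i. i \<in> I \<Longrightarrow> Ck_on k S (f i)"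
  shows "Ck_on k S (\<lambda>x. \<Prod>i\<in>I. f i x)"
  using assms(2)
  by (induction I rule: infinite_finite_induct) (auto intro: Ck_on_const Ck_on_mult assms(1))

lemma Ck_on_inner_left: "open S \<Longrightarrow> Ck_on k S f \<Longrightarrow> Ck_on k S (\<lambda>x. f x \<bullet> a)"
  by (rule Ck_on_compose_linear[OF _ bounded_linear_inner_left])

lemma Ck_on_nth:
  fixes f :: "'a::euclidean_space \<Rightarrow> real^'n"
  shows "open S \<Longrightarrow> Ck_on k S f \<Longrightarrow> Ck_on k S (\<lambda>x. f x $ i)"
  by (rule Ck_on_compose_linear[OF _ bounded_linear_vec_nth])

lemma Ck_on_ident: "open S \<Longrightarrow> Ck_on k S (\<lambda>x. x)"
  by (rule Ck_on_linear[OF _ bounded_linear_ident])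

lemma Ck_on_inner_self:
  "open S \<Longrightarrow> Ck_on k S (\<lambda>x::'a::euclidean_space. (x - c) \<bullet> (x - c))"
  by (subst euclidean_inner, intro Ck_on_sum Ck_on_mult Ck_on_inner_left Ck_on_minus Ck_on_ident Ck_on_const) auto

lemma Ck_on_Un:
  assumes "open S" "open T"
  shows "Ck_on k S f \<Longrightarrow> Ck_on k T f \<Longrightarrow> Ck_on k (S \<union> T) f"
  by (induction k arbitrary: f) (auto intro: continuous_on_open_Un assms)

lemma Ck_on_extend_zero:
  assumes "open U" "closed K" "K \<subseteq> U" "Ck_on k U f" "\<And>x. x \<notin> K \<Longrightarrow> f x = 0"
  shows "Ck_on k UNIV f"
proof -
  have "Ck_on k (- K) f"
    using Ck_on_cong[of "- K" f "\<lambda>x. 0" k] assms(2,5) by (auto intro: Ck_on_const)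
  then have "Ck_on k (U \<union> - K) f"
    using assms by (intro Ck_on_Un) auto
  moreover have "U \<union> - K = UNIV" using assms(3) by auto
  ultimately show ?thesis by simp
qed

lemma Ck_on_Suc_continuous_derivative:
  assumes "Ck_on (Suc k) S f"
  shows "continuous_on S (\<lambda>x. frechet_derivative f (at x) b)"
proof -
  have "frechet_derivative f (at x) b = (\<Sum>i\<in>Basis. (b \<bullet> i) *\<^sub>R frechet_derivative f (at x) i)"
    if "x \<in> S" for x
  proof -
    have L: "linear (frechet_derivative f (at x))"
      using assms that by (intro linear_frechet_derivative) auto
    have "frechet_derivative f (at x) b = frechet_derivative f (at x) (\<Sum>i\<in>Basis. (b \<bullet> i) *\<^sub>R i)"
      by (simp add: euclidean_representation)
    also have "\<dots> = (\<Sum>i\<in>Basis. (b \<bullet> i) *\<^sub>R frechet_derivative f (at x) i)"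
      using L by (simp add: linear_sum linear_scale)
    finally show ?thesis .
  qed
  moreover have "continuous_on S (\<lambda>x. \<Sum>i\<in>Basis. (b \<bullet> i) *\<^sub>R frechet_derivative f (at x) i)"
    by (intro continuous_intros Ck_on_continuous[of k]) (use assms in auto)
  ultimately show ?thesis by (simp cong: continuous_on_cong)
qed

section \<open>A smooth cutoff function\<close>

text \<open>The functions \<open>p(1/t) exp(-1/t)\<close>, extended by zero to \<open>t \<le> 0\<close>. For polynomials \<open>p\<close> this family
  is closed under differentiation, which gives smoothness of every member.\<close>

definition exp_cutoff :: "real poly \<Rightarrow> real \<Rightarrow> real" where
  "exp_cutoff p t = (if t \<le> 0 then 0 else poly p (inverse t) * exp (- inverse t))"

lemma poly_times_exp_minus_tendsto_0:
  "((\<lambda>x. poly p x * exp (- x)) \<longlongrightarrow> (0::real)) at_top"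
proof (induction p)
  case 0
  then show ?case by simp
next
  case (pCons a p)
  have *: "((\<lambda>x. x ^ k * exp (- x)) \<longlongrightarrow> (0::real)) at_top" for k
    using tendsto_power_div_exp_0[of k] by (simp add: exp_minus field_simps)
  have "((\<lambda>x. x * poly p x * exp (- x)) \<longlongrightarrow> (0::real)) at_top"
  proof -
    have "((\<lambda>x. \<Sum>i\<le>degree p. coeff p i * (x ^ Suc i * exp (- x))) \<longlongrightarrow> (\<Sum>i\<le>degree p. coeff p i * 0)) at_top"
      by (intro tendsto_intros *)
    moreover have "(\<lambda>x. x * poly p x * exp (- x)) = (\<lambda>x. \<Sum>i\<le>degree p. coeff p i * (x ^ Suc i * exp (- x)))"
      by (simp add: poly_altdef sum_distrib_left sum_distrib_right mult_ac)
    ultimately show ?thesis by simp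
  qed
  then have "((\<lambda>x. a * (x ^ 0 * exp (- x)) + x * poly p x * exp (- x)) \<longlongrightarrow> a * 0 + (0::real)) at_top"
    by (intro tendsto_intros *)
  then show ?case by (simp add: algebra_simps)
qed

lemma exp_cutoff_has_derivative:
  "(exp_cutoff p has_real_derivative exp_cutoff ([:0,0,1:] * (p - pderiv p)) t) (at t)"
proof -
  consider "t < 0" | "t > 0" | "t = 0" by linarith
  then show ?thesis
  proof cases
    case 1
    have "(exp_cutoff p has_real_derivative 0) (at t) \<longleftrightarrow> ((\<lambda>t. 0) has_real_derivative (0::real)) (at t)"
      using eventually_nhds_in_open[of "{..<0::real}" t] 1
      by (intro DERIV_cong_ev refl) (auto elim!: eventually_mono simp: exp_cutoff_def)
    then show ?thesis using 1 by (simp add: exp_cutoff_def)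
  next
    case 2
    have ev: "\<forall>\<^sub>F x in nhds t. exp_cutoff p x = poly p (inverse x) * exp (- inverse x)"
      using eventually_nhds_in_open[of "{0<..}" t] 2
      by (auto elim!: eventually_mono simp: exp_cutoff_def)
    have "((\<lambda>x. poly p (inverse x) * exp (- inverse x)) has_real_derivative
       exp_cutoff ([:0,0,1:] * (p - pderiv p)) t) (at t)"
      using 2 by (auto intro!: derivative_eq_intros simp: exp_cutoff_def field_simps power2_eq_square)
    then show ?thesis using DERIV_cong_ev[OF refl ev refl] by simp
  next
    case 3
    have "((\<lambda>x. (exp_cutoff p x - exp_cutoff p 0) / (x - 0)) \<longlongrightarrow> 0) (at_right 0)"
    proof -
      have "((\<lambda>x. poly ([:0,1:] * p) (inverse x) * exp (- inverse x)) \<longlongrightarrow> (0::real)) (at_right 0)"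
        using filterlim_compose[OF poly_times_exp_minus_tendsto_0 filterlim_inverse_at_top_right] .
      moreover have "\<forall>\<^sub>F x in at_right 0. poly ([:0,1:] * p) (inverse x) * exp (- inverse x) =
          (exp_cutoff p x - exp_cutoff p 0) / (x - 0)"
        unfolding eventually_at_filter by (rule always_eventually) (auto simp: exp_cutoff_def field_simps)
      ultimately show ?thesis by (rule Lim_transform_eventually)
    qed
    moreover have "((\<lambda>x. (exp_cutoff p x - exp_cutoff p 0) / (x - 0)) \<longlongrightarrow> 0) (at_left 0)"
    proof -
      have "\<forall>\<^sub>F x in at_left 0. 0 = (exp_cutoff p x - exp_cutoff p 0) / (x - 0)"
        unfolding eventually_at_filter by (rule always_eventually) (auto simp: exp_cutoff_def)
      then show ?thesis by (rule Lim_transform_eventually[OF tendsto_const])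
    qed
    ultimately have "((\<lambda>x. (exp_cutoff p x - exp_cutoff p 0) / (x - 0)) \<longlongrightarrow> 0) (at 0)"
      using filterlim_split_at by blast
    then show ?thesis using 3 by (simp add: has_field_derivative_iff exp_cutoff_def)
  qed
qed

lemma Ck_on_exp_cutoff:
  fixes q :: "'a::euclidean_space \<Rightarrow> real"
  assumes "open S" "\<And>k. Ck_on k S q"
  shows "Ck_on k S (\<lambda>x. exp_cutoff p (q x))"
proof (induction k arbitrary: p)
  case 0
  have "continuous_on UNIV (exp_cutoff p)"
    using exp_cutoff_has_derivative by (meson DERIV_continuous_on has_field_derivative_at_within)
  then show ?case
    using Ck_on_continuous[OF assms(2)] by (auto intro: continuous_on_compose2)
next
  case (Suc k)
  let ?p = "[:0,0,1:] * (p - pderiv p)"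
  show ?case
  proof (rule Ck_on_SucI[OF assms(1),
        where D = "\<lambda>x b. exp_cutoff ?p (q x) * frechet_derivative q (at x) b"])
    fix x assume "x \<in> S"
    then have "(q has_derivative frechet_derivative q (at x)) (at x)"
      using Ck_on_has_derivative[OF assms(2)[of 1]] by simp
    from has_derivative_compose[OF this
        exp_cutoff_has_derivative[of p "q x", unfolded has_field_derivative_def]]
    show "((\<lambda>x. exp_cutoff p (q x)) has_derivative
        (\<lambda>b. exp_cutoff ?p (q x) * frechet_derivative q (at x) b)) (at x)"
      by simp
  next
    fix b :: 'a assume "b \<in> Basis"
    then have "Ck_on k S (\<lambda>x. frechet_derivative q (at x) b)"
      using assms(2)[of "Suc k"] by simp
    then show "Ck_on k S (\<lambda>x. exp_cutoff ?p (q x) * frechet_derivative q (at x) b)"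
      by (intro Ck_on_mult assms(1) Suc.IH)
  qed
qed

section \<open>Integrals of derivatives of compactly supported functions\<close>

lemma frechet_derivative_eq_0_outside_closed:
  assumes "closed K" "\<And>x. x \<notin> K \<Longrightarrow> f x = 0" "x \<notin> K"
  shows "frechet_derivative f (at x) = (\<lambda>_. 0)"
proof -
  have "\<forall>\<^sub>F y in nhds x. f y = (\<lambda>_. 0) y"
    using assms by (auto simp: eventually_nhds intro!: exI[of _ "- K"])
  from frechet_derivative_transform_eventually(2)[OF this] show ?thesis
    by (simp add: frechet_derivative_const)
qed

lemma continuous_compact_support_integrable:
  fixes f :: "'a::euclidean_space \<Rightarrow> 'b::{banach, second_countable_topology}"
  assumes "compact K" "continuous_on K f" "\<And>x. x \<notin> K \<Longrightarrow> f x = 0"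
  shows "integrable lborel f"
proof -
  have "(\<lambda>x. indicator K x *\<^sub>R f x) = f"
    using assms(3) by (auto simp: indicator_def)
  then show ?thesis using borel_integrable_compact[OF assms(1,2)] by simp
qed

lemma has_real_derivative_along_line:
  assumes "(f has_derivative D) (at (y + s *\<^sub>R b))"
  shows "((\<lambda>s. f (y + s *\<^sub>R b)) has_real_derivative D b) (at s)"
proof -
  have "((\<lambda>s. f (y + s *\<^sub>R b)) has_derivative (\<lambda>h. D (h *\<^sub>R b))) (at s)"
    by (rule has_derivative_compose[where f = "\<lambda>s. y + s *\<^sub>R b" and g = f and g' = D])
      (auto intro!: derivative_eq_intros assms)
  moreover have "D (h *\<^sub>R b) = h * D b" for h
    using has_derivative_linear[OF assms] by (simp add: linear_scale)
  ultimately show ?thesis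
    by (simp add: has_field_derivative_def mult.commute[of "D b"] fun_eq_iff mult_commute_abs)
qed

lemma C1_compact_support_derivative_bounded:
  assumes "Ck_on 1 UNIV G" "compact K" "\<And>x. x \<notin> K \<Longrightarrow> G x = (0::real)"
  obtains C where "0 \<le> C" "\<And>y. \<bar>frechet_derivative G (at y) b\<bar> \<le> C"
proof -
  have "continuous_on K (\<lambda>y. frechet_derivative G (at y) b)"
    using Ck_on_Suc_continuous_derivative[of 0 UNIV G b] assms(1)
    by (auto intro: continuous_on_subset)
  then have "bounded ((\<lambda>y. frechet_derivative G (at y) b) ` K)"
    using assms(2) by (intro compact_imp_bounded compact_continuous_image)
  then obtain C where C: "\<forall>y\<in>K. \<bar>frechet_derivative G (at y) b\<bar> \<le> C"
    by (auto simp: bounded_iff)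
  have "\<bar>frechet_derivative G (at y) b\<bar> \<le> max C 0" for y
  proof (cases "y \<in> K")
    case False
    then show ?thesis
      using frechet_derivative_eq_0_outside_closed[OF compact_imp_closed[OF assms(2)] assms(3)] by simp
  qed (use C in auto)
  then show ?thesis using that[of "max C 0"] by simp
qed

lemma integral_difference_quotient_tendsto:
  fixes G v :: "'a::euclidean_space \<Rightarrow> real"
  assumes G: "Ck_on 1 UNIV G" and K: "compact K" "\<And>x. x \<notin> K \<Longrightarrow> G x = 0"
    and v: "integrable lborel v"
  shows "((\<lambda>t. (LINT y|lborel. v y * (G (y + t *\<^sub>R b) - G y)) / t) \<longlongrightarrow>
      (LINT y|lborel. v y * frechet_derivative G (at y) b)) (at 0)"
proof -
  obtain C where C: "0 \<le> C" "\<And>y. \<bar>frechet_derivative G (at y) b\<bar> \<le> C"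
    using C1_compact_support_derivative_bounded[OF G K] by metis
  have line: "((\<lambda>s. G (y + s *\<^sub>R b)) has_real_derivative frechet_derivative G (at (y + s *\<^sub>R b)) b) (at s)"
    for y s
    by (rule has_real_derivative_along_line) (rule Ck_on_has_derivative[OF G], auto)
  have lip: "\<bar>G (y + t *\<^sub>R b) - G y\<bar> \<le> C * \<bar>t\<bar>" for y t
    using field_differentiable_bound[OF convex_UNIV line, where B = C and x = t and y = 0] C(2)
    by simp
  have [measurable]: "G \<in> borel_measurable borel" "v \<in> borel_measurable borel"
    "(\<lambda>y. frechet_derivative G (at y) b) \<in> borel_measurable borel"
    using Ck_on_continuous[OF G] Ck_on_Suc_continuous_derivative[of 0 UNIV G b] G v
    by (auto intro!: borel_measurable_continuous_onI)
  show ?thesis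
    unfolding tendsto_at_iff_sequentially
  proof safe
    fix X :: "nat \<Rightarrow> real" assume X: "\<forall>i. X i \<in> UNIV - {0}" "X \<longlonglongrightarrow> 0"
    have "(\<lambda>i. LINT y|lborel. v y * ((G (y + X i *\<^sub>R b) - G y) / X i)) \<longlonglongrightarrow>
      (LINT y|lborel. v y * frechet_derivative G (at y) b)"
    proof (rule integral_dominated_convergence[where w = "\<lambda>y. C * \<bar>v y\<bar>"])
      show "AE y in lborel. (\<lambda>i. v y * ((G (y + X i *\<^sub>R b) - G y) / X i)) \<longlonglongrightarrow>
          v y * frechet_derivative G (at y) b"
      proof (rule AE_I2, rule tendsto_mult[OF tendsto_const])
        fix y
        have "((\<lambda>h. (G (y + (0 + h) *\<^sub>R b) - G (y + 0 *\<^sub>R b)) / h) \<longlongrightarrow> frechet_derivative G (at y) b) (at 0)"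
          using line[of y 0] by (simp add: DERIV_def)
        then show "(\<lambda>i. (G (y + X i *\<^sub>R b) - G y) / X i) \<longlonglongrightarrow> frechet_derivative G (at y) b"
          using X unfolding tendsto_at_iff_sequentially by (auto simp: comp_def)
      qed
      show "AE y in lborel. norm (v y * ((G (y + X i *\<^sub>R b) - G y) / X i)) \<le> C * \<bar>v y\<bar>" for i
      proof (rule AE_I2)
        fix y
        have "\<bar>(G (y + X i *\<^sub>R b) - G y) / X i\<bar> \<le> C"
          using lip[of y "X i"] X(1) by (auto simp: divide_le_eq)
        then show "norm (v y * ((G (y + X i *\<^sub>R b) - G y) / X i)) \<le> C * \<bar>v y\<bar>"
          unfolding real_norm_def abs_mult[of "v y"]
          by (subst mult.commute) (rule mult_right_mono, auto)
      qed
      show "integrable lborel (\<lambda>y. C * \<bar>v y\<bar>)" using v by auto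
    qed measurable
    moreover have "(LINT y|lborel. v y * ((G (y + X i *\<^sub>R b) - G y) / X i)) =
        (LINT y|lborel. v y * (G (y + X i *\<^sub>R b) - G y)) / X i" for i
      by simp
    ultimately show "((\<lambda>t. (LINT y|lborel. v y * (G (y + t *\<^sub>R b) - G y)) / t) \<circ> X) \<longlonglongrightarrow>
        (LINT y|lborel. v y * frechet_derivative G (at y) b)"
      by (simp add: comp_def)
  qed
qed

lemma lborel_integral_translation:
  fixes f :: "'a::euclidean_space \<Rightarrow> real"
  assumes "f \<in> borel_measurable borel"
  shows "(LINT y|lborel. f (y + c)) = (LINT y|lborel. f y)"
proof -
  have "(LINT y|lborel. f y) = (LINT y|distr lborel borel ((+) c). f y)"
    by (simp add: lborel_distr_plus)
  also have "\<dots> = (LINT y|lborel. f (c + y))"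
    using assms by (intro integral_distr) auto
  finally show ?thesis by (simp add: add.commute)
qed

text \<open>The integrals of the difference quotients vanish by translation invariance, and they converge
  to the integral of the derivative.\<close>

lemma integral_derivative_compact_support_eq_0:
  fixes G :: "'a::euclidean_space \<Rightarrow> real"
  assumes G: "Ck_on 1 UNIV G" and K: "compact K" "\<And>x. x \<notin> K \<Longrightarrow> G x = 0"
  shows "(LINT y|lborel. frechet_derivative G (at y) b) = 0"
proof -
  obtain B where B: "\<And>x. x \<in> K \<Longrightarrow> norm x \<le> B"
    using compact_imp_bounded[OF K(1)] by (auto simp: bounded_iff)
  define R where "R = B + norm b"
  have inR: "y \<in> cball 0 R" if "G (y + t *\<^sub>R b) \<noteq> 0" "\<bar>t\<bar> \<le> 1" for y t
  proof -
    have "norm (y + t *\<^sub>R b) \<le> B" using that K(2) B by blast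
    moreover have "norm (t *\<^sub>R b) \<le> norm b" using that by (simp add: mult_left_le_one_le)
    moreover have "norm y \<le> norm (y + t *\<^sub>R b) + norm (t *\<^sub>R b)"
      by (metis add_diff_cancel norm_triangle_ineq4)
    ultimately show ?thesis by (simp add: R_def)
  qed
  have Gm: "G \<in> borel_measurable borel"
    using Ck_on_continuous[OF G] by (auto intro!: borel_measurable_continuous_onI)
  have Gi: "integrable lborel G"
    by (rule continuous_compact_support_integrable[OF K(1) _ K(2)])
      (auto intro: continuous_on_subset Ck_on_continuous[OF G])
  let ?v = "indicator (cball 0 R) :: 'a \<Rightarrow> real"
  have "integrable lborel ?v"
    by (intro integrable_real_indicator emeasure_compact_finite) auto
  note lim = integral_difference_quotient_tendsto[OF G K this, of b]
  have zero: "(LINT y|lborel. ?v y * (G (y + t *\<^sub>R b) - G y)) = 0" if t: "\<bar>t\<bar> \<le> 1" for t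
  proof -
    have "?v y * (G (y + t *\<^sub>R b) - G y) = G (y + t *\<^sub>R b) - G y" for y
    proof (cases "y \<in> cball 0 R")
      case False
      then have "G (y + t *\<^sub>R b) = 0" "G (y + 0 *\<^sub>R b) = 0" using inR[of y t] inR[of y 0] t by auto
      then show ?thesis by simp
    qed simp
    then have "(LINT y|lborel. ?v y * (G (y + t *\<^sub>R b) - G y)) =
        (LINT y|lborel. G (y + t *\<^sub>R b) - G y)"
      by (intro Bochner_Integration.integral_cong refl)
    also have "\<dots> = (LINT y|lborel. G (y + t *\<^sub>R b)) - (LINT y|lborel. G y)"
    proof (rule Bochner_Integration.integral_diff[OF _ Gi])
      have "integrable (distr lborel borel ((+) (t *\<^sub>R b))) G"
        using Gi by (simp add: lborel_distr_plus)
      then show "integrable lborel (\<lambda>y. G (y + t *\<^sub>R b))"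
        by (subst (asm) integrable_distr_eq) (use Gm in \<open>auto simp: add.commute\<close>)
    qed
    also have "\<dots> = 0" using lborel_integral_translation[OF Gm] by simp
    finally show ?thesis .
  qed
  have "\<forall>\<^sub>F t in at 0. (LINT y|lborel. ?v y * (G (y + t *\<^sub>R b) - G y)) / t = 0"
    using zero unfolding eventually_at by (intro exI[of _ 1]) (auto simp: dist_real_def)
  then have "((\<lambda>t. (LINT y|lborel. ?v y * (G (y + t *\<^sub>R b) - G y)) / t) \<longlongrightarrow> 0) (at 0)"
    by (rule tendsto_eventually)
  with lim have "(LINT y|lborel. ?v y * frechet_derivative G (at y) b) = 0"
    using tendsto_unique[OF _ lim] by auto
  moreover have "?v y * frechet_derivative G (at y) b = frechet_derivative G (at y) b" for y
  proof (cases "y \<in> cball 0 R")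
    case False
    then have "y \<notin> K" using B[of y] by (auto simp: R_def) (smt (verit) norm_ge_zero)
    then show ?thesis
      using frechet_derivative_eq_0_outside_closed[OF compact_imp_closed[OF K(1)] K(2)] by simp
  qed simp
  ultimately show ?thesis by simp
qed

section \<open>Bump functions\<close>

lemma exp_cutoff_1_bounds: "0 \<le> exp_cutoff 1 t" "exp_cutoff 1 t \<le> 1"
  by (auto simp: exp_cutoff_def)

text \<open>A smooth bump on the closed ball of radius \<open>\<delta>\<close> about \<open>x\<close>. It is not normalised to have
  integral one: only ratios of integrals are compared later.\<close>

definition bump :: "real \<Rightarrow> 'a::euclidean_space \<Rightarrow> 'a \<Rightarrow> real" where
  "bump \<delta> x y = exp_cutoff 1 (1 - ((y - x) \<bullet> (y - x)) / \<delta>\<^sup>2)"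

lemma Ck_on_bump: "Ck_on k UNIV (bump \<delta> x)"
proof -
  have "Ck_on j UNIV (\<lambda>y. 1 - ((y - x) \<bullet> (y - x)) / \<delta>\<^sup>2)" for j
    using Ck_on_cmult[OF open_UNIV Ck_on_inner_self, of j "inverse (\<delta>\<^sup>2)" x]
    by (intro Ck_on_minus Ck_on_const) (auto simp: field_simps)
  then show ?thesis unfolding bump_def by (intro Ck_on_exp_cutoff) auto
qed

lemma bump_nonneg: "0 \<le> bump \<delta> x y"
  by (simp add: bump_def exp_cutoff_def)

lemma bump_le_1: "bump \<delta> x y \<le> 1"
  by (simp add: bump_def exp_cutoff_def)

lemma bump_translate: "bump \<delta> (x + b) y = bump \<delta> x (y - b)"
  by (simp add: bump_def algebra_simps)

lemma bump_eq_0: "0 < \<delta> \<Longrightarrow> y \<notin> cball x \<delta> \<Longrightarrow> bump \<delta> x y = 0"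
proof -
  assume "0 < \<delta>" "y \<notin> cball x \<delta>"
  then have "\<delta>\<^sup>2 \<le> (norm (y - x))\<^sup>2" by (intro power_mono) (auto simp: dist_norm norm_minus_commute)
  then show ?thesis using \<open>0 < \<delta>\<close>
    by (simp add: bump_def exp_cutoff_def power2_norm_eq_inner[symmetric])
qed

lemma bump_lower_bound:
  assumes "0 < \<delta>" "y \<in> cball x (\<delta> / 2)"
  shows "exp (- 4 / 3) \<le> bump \<delta> x y"
proof -
  let ?t = "1 - ((y - x) \<bullet> (y - x)) / \<delta>\<^sup>2"
  have "(norm (y - x))\<^sup>2 \<le> (\<delta> / 2)\<^sup>2"
    using assms by (intro power_mono) (auto simp: dist_norm norm_minus_commute)
  then have t: "3 / 4 \<le> ?t"
    using assms(1) by (simp add: power2_norm_eq_inner[symmetric] field_simps power2_eq_square)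
  then have "inverse ?t \<le> 4 / 3" using le_imp_inverse_le[OF t] by simp
  moreover have "\<not> ?t \<le> 0" using t by linarith
  ultimately show ?thesis unfolding bump_def exp_cutoff_def by simp
qed

lemma bump_derivative_bound:
  obtains C where "0 \<le> C" "\<And>\<delta> x y (b::'a::euclidean_space). 0 < \<delta> \<Longrightarrow>
      \<bar>frechet_derivative (bump \<delta> x) (at y) b\<bar> \<le> C / \<delta> * norm b"
proof -
  let ?p = "[:0,0,1:] :: real poly"
  have "continuous_on {0..1} (exp_cutoff ?p)"
    using exp_cutoff_has_derivative by (meson DERIV_continuous_on has_field_derivative_at_within)
  then have "bounded (exp_cutoff ?p ` {0..1})"
    by (intro compact_imp_bounded compact_continuous_image) auto
  then obtain C0 where C0: "\<And>t. t \<in> {0..1} \<Longrightarrow> \<bar>exp_cutoff ?p t\<bar> \<le> C0"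
    unfolding bounded_iff real_norm_def by blast
  show ?thesis
  proof (rule that[of "2 * max C0 0"])
    fix \<delta> :: real and x y b :: 'a assume \<delta>: "0 < \<delta>"
    show "\<bar>frechet_derivative (bump \<delta> x) (at y) b\<bar> \<le> 2 * max C0 0 / \<delta> * norm b"
    proof (cases "y \<in> cball x \<delta>")
      case False
      then show ?thesis
        using frechet_derivative_eq_0_outside_closed[OF closed_cball, of x \<delta> "bump \<delta> x" y]
          bump_eq_0[OF \<delta>, of _ x] \<delta> by simp
    next
      case True
      let ?t = "1 - ((y - x) \<bullet> (y - x)) / \<delta>\<^sup>2"
      have nrm: "norm (y - x) \<le> \<delta>" using True by (simp add: dist_norm norm_minus_commute)
      then have "(norm (y - x))\<^sup>2 \<le> \<delta>\<^sup>2" by (intro power_mono) auto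
      then have t: "?t \<in> {0..1}" using \<delta> by (simp add: power2_norm_eq_inner)
      have "((\<lambda>y. 1 - inverse (\<delta>\<^sup>2) * ((y - x) \<bullet> (y - x))) has_derivative
          (\<lambda>b. - (inverse (\<delta>\<^sup>2) * (2 * ((y - x) \<bullet> b))))) (at y)"
        by (auto intro!: derivative_eq_intros simp: inner_commute fun_eq_iff)
      then have "((\<lambda>y. 1 - ((y - x) \<bullet> (y - x)) / \<delta>\<^sup>2) has_derivative
          (\<lambda>b. - 2 * ((y - x) \<bullet> b) / \<delta>\<^sup>2)) (at y)"
        by (simp add: divide_inverse mult_ac)
      from has_derivative_compose[OF this exp_cutoff_has_derivative[of 1, unfolded has_field_derivative_def]]
      have "(bump \<delta> x has_derivative (\<lambda>b. exp_cutoff ?p ?t * (- 2 * ((y - x) \<bullet> b) / \<delta>\<^sup>2))) (at y)"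
        by (simp add: bump_def[abs_def] pderiv_1)
      then have "\<bar>frechet_derivative (bump \<delta> x) (at y) b\<bar> = \<bar>exp_cutoff ?p ?t\<bar> * (2 * \<bar>(y - x) \<bullet> b\<bar> / \<delta>\<^sup>2)"
        by (simp add: frechet_derivative_at[symmetric] abs_mult)
      also have "\<dots> \<le> max C0 0 * (2 * (\<delta> * norm b) / \<delta>\<^sup>2)"
      proof (intro mult_mono divide_right_mono)
        show "\<bar>exp_cutoff ?p ?t\<bar> \<le> max C0 0" using C0[OF t] by simp
        have "\<bar>(y - x) \<bullet> b\<bar> \<le> norm (y - x) * norm b" by (rule Cauchy_Schwarz_ineq2)
        then show "\<bar>(y - x) \<bullet> b\<bar> \<le> \<delta> * norm b" using nrm by (meson mult_right_mono norm_ge_zero order_trans)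
      qed auto
      also have "\<dots> = 2 * max C0 0 / \<delta> * norm b" using \<delta> by (simp add: power2_eq_square field_simps)
      finally show ?thesis .
    qed
  qed auto
qed

lemma test_functionI:
  fixes G :: "'a::euclidean_space \<Rightarrow> 'b::real_normed_vector"
  assumes "\<And>k. Ck_on k UNIV G" "compact K" "K \<subseteq> V" "\<And>y. y \<notin> K \<Longrightarrow> G y = 0"
  shows "test_function V G"
proof -
  have "closure {x. G x \<noteq> 0} \<subseteq> K"
    using assms(4) compact_imp_closed[OF assms(2)] by (intro closure_minimal) auto
  moreover have "compact (closure {x. G x \<noteq> 0})"
    using closed_Int_compact[OF closed_closure assms(2), of "{x. G x \<noteq> 0}"] calculation
    by (simp add: Int_absorb2)
  ultimately show ?thesis using assms unfolding test_function_def by blast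
qed

lemma Ck_on_scaleR_const:
  fixes f :: "'a::euclidean_space \<Rightarrow> real"
  shows "open S \<Longrightarrow> Ck_on k S f \<Longrightarrow> Ck_on k S (\<lambda>x. f x *\<^sub>R c)"
  by (intro Ck_on_scaleR Ck_on_const)

text \<open>For a nonempty box, smooth functions that vanish outside the box and, inside it, tend to one as \<open>k\<close> grows, because
  \<open>exp (-1/(k t)) \<longlonglongrightarrow> 1\<close> for every \<open>t > 0\<close>.\<close>

definition box_bump :: "nat \<Rightarrow> 'a::euclidean_space \<Rightarrow> 'a \<Rightarrow> 'a \<Rightarrow> real" where
  "box_bump k a b x = (\<Prod>i\<in>Basis. exp_cutoff 1 (real k * (((x - a) \<bullet> i) * ((b - x) \<bullet> i))))"

lemma Ck_on_box_bump: "Ck_on j UNIV (box_bump k a b)"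
  unfolding box_bump_def[abs_def]
  by (intro Ck_on_prod Ck_on_exp_cutoff Ck_on_cmult Ck_on_mult Ck_on_inner_left Ck_on_minus
      Ck_on_ident Ck_on_const) auto

lemma box_bump_bounds: "0 \<le> box_bump k a b x" "box_bump k a b x \<le> 1"
  unfolding box_bump_def by (intro prod_nonneg prod_le_1 conjI ballI exp_cutoff_1_bounds)+

lemma box_bump_eq_0:
  assumes "box a b \<noteq> {}" "x \<notin> box a b"
  shows "box_bump k a b x = 0"
proof -
  have ab: "\<And>i. i \<in> Basis \<Longrightarrow> a \<bullet> i < b \<bullet> i" using assms(1) by (simp add: box_ne_empty)
  obtain i where i: "i \<in> Basis" "x \<bullet> i \<le> a \<bullet> i \<or> b \<bullet> i \<le> x \<bullet> i"
    using assms(2) by (auto simp: mem_box not_less)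
  then have "((x - a) \<bullet> i) * ((b - x) \<bullet> i) \<le> 0"
    using ab[OF i(1)] by (auto simp: mult_le_0_iff inner_diff_left)
  then have "exp_cutoff 1 (real k * (((x - a) \<bullet> i) * ((b - x) \<bullet> i))) = 0"
    by (simp add: exp_cutoff_def mult_nonneg_nonpos)
  then show ?thesis unfolding box_bump_def using i(1) by (intro prod_zero) auto
qed

lemma box_bump_tendsto:
  assumes "box a b \<noteq> {}"
  shows "(\<lambda>k. box_bump k a b x) \<longlonglongrightarrow> indicator (box a b) x"
proof (cases "x \<in> box a b")
  case False
  then show ?thesis by (simp add: box_bump_eq_0[OF assms])
next
  case True
  have lim: "(\<lambda>k. exp_cutoff 1 (real k * t)) \<longlonglongrightarrow> 1" if "0 < t" for t
  proof -
    have "(\<lambda>k. exp (- inverse (real k * t))) \<longlonglongrightarrow> exp (- 0)"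
    proof (intro tendsto_intros)
      have "(\<lambda>k. inverse (real k) * inverse t) \<longlonglongrightarrow> 0 * inverse t"
        by (intro tendsto_intros lim_inverse_n)
      then show "(\<lambda>k. inverse (real k * t)) \<longlonglongrightarrow> 0" by simp
    qed
    moreover have "\<forall>\<^sub>F k in sequentially. exp (- inverse (real k * t)) = exp_cutoff 1 (real k * t)"
      using eventually_gt_at_top[of 0]
      by (rule eventually_mono) (use that in \<open>auto simp: exp_cutoff_def mult_le_0_iff\<close>)
    ultimately show ?thesis using Lim_transform_eventually by fastforce
  qed
  have "(\<lambda>k. box_bump k a b x) \<longlonglongrightarrow> (\<Prod>i\<in>(Basis::'a set). 1)"
    unfolding box_bump_def using True
    by (intro tendsto_prod lim) (auto simp: mem_box inner_diff_left)
  then show ?thesis using True by simp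
qed

section \<open>Weak horizontal gradients\<close>

lemma LINT_lebesgue_on_eq:
  fixes g :: "'a::euclidean_space \<Rightarrow> 'b::{banach, second_countable_topology}"
  assumes "V \<in> sets lebesgue" "\<And>x. x \<notin> V \<Longrightarrow> g x = 0"
  shows "(LINT x|lebesgue_on V. g x) = (LINT x|lebesgue. g x)"
proof -
  have "indicator V x *\<^sub>R g x = g x" for x using assms(2) by (auto simp: indicator_def)
  then show ?thesis using integral_restrict_space[of V lebesgue g] assms(1) by simp
qed

lemma test_function_support:
  assumes "test_function V \<phi>"
  obtains K where "compact K" "K \<subseteq> V" "\<And>x. x \<notin> K \<Longrightarrow> \<phi> x = 0"
proof (rule that[of "closure {x. \<phi> x \<noteq> 0}"])
  show "\<phi> x = 0" if "x \<notin> closure {x. \<phi> x \<noteq> 0}" for x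
    using that closure_subset[of "{x. \<phi> x \<noteq> 0}"] by blast
qed (use assms in \<open>auto simp: test_function_def\<close>)

lemma test_function_mono: "test_function V \<phi> \<Longrightarrow> V \<subseteq> W \<Longrightarrow> test_function W \<phi>"
  unfolding test_function_def by blast

lemma partial_deriv_eq_0_outside_closed:
  assumes "closed K" "\<And>x. x \<notin> K \<Longrightarrow> g x = 0" "x \<notin> K"
  shows "partial_deriv i g x = 0"
  unfolding partial_deriv_def using frechet_derivative_eq_0_outside_closed[OF assms] by simp

lemma divergence_eq_0_outside_closed:
  assumes "closed K" "\<And>x. x \<notin> K \<Longrightarrow> g x = 0" "x \<notin> K"
  shows "divergence g x = 0"
  unfolding divergence_def
  using partial_deriv_eq_0_outside_closed[of K "\<lambda>y. g y $ i" x i for i] assms by simp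

lemma is_weak_horizontal_grad_restrict:
  fixes X :: "'m::finite \<Rightarrow> real^'n \<Rightarrow> real^'n"
  assumes w: "is_weak_horizontal_grad X U u w" and V: "open V" "V \<subseteq> U" and U: "open U"
  shows "is_weak_horizontal_grad X V u w"
  unfolding is_weak_horizontal_grad_def
proof (intro conjI allI impI)
  show "u \<in> L1_loc V" "w \<in> L1_loc V"
    using w V(2) by (auto simp: is_weak_horizontal_grad_def L1_loc_def)
  fix \<phi> :: "real^'n \<Rightarrow> real^'m" assume \<phi>: "test_function V \<phi>"
  obtain K where K: "compact K" "K \<subseteq> V" "\<And>x. x \<notin> K \<Longrightarrow> \<phi> x = 0"
    using test_function_support[OF \<phi>] by metis
  have div0: "divergence (\<lambda>y. \<phi> y v* coeff_matrix X y) x = 0" if "x \<notin> K" for x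
    using that K by (intro divergence_eq_0_outside_closed[of K]) (auto intro: compact_imp_closed)
  have notK: "x \<notin> V \<Longrightarrow> x \<notin> K" "x \<notin> U \<Longrightarrow> x \<notin> K" for x using K V by auto
  have "(LINT x|lebesgue_on U. w x \<bullet> \<phi> x) =
        - (LINT x|lebesgue_on U. u x * divergence (\<lambda>y. \<phi> y v* coeff_matrix X y) x)"
    using w test_function_mono[OF \<phi> V(2)] unfolding is_weak_horizontal_grad_def by blast
  then show "(LINT x|lebesgue_on V. w x \<bullet> \<phi> x) =
        - (LINT x|lebesgue_on V. u x * divergence (\<lambda>y. \<phi> y v* coeff_matrix X y) x)"
    using LINT_lebesgue_on_eq[of V "\<lambda>x. w x \<bullet> \<phi> x"] LINT_lebesgue_on_eq[of U "\<lambda>x. w x \<bullet> \<phi> x"]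
      LINT_lebesgue_on_eq[of V "\<lambda>x. u x * divergence (\<lambda>y. \<phi> y v* coeff_matrix X y) x"]
      LINT_lebesgue_on_eq[of U "\<lambda>x. u x * divergence (\<lambda>y. \<phi> y v* coeff_matrix X y) x"]
      V U K(3) div0 notK by (simp add: lebesgue_openin)
qed

lemma L1_loc_integrable_inner:
  fixes w \<phi> :: "'a::euclidean_space \<Rightarrow> 'b::euclidean_space"
  assumes w: "w \<in> L1_loc V" and K: "compact K" "K \<subseteq> V" "\<And>x. x \<notin> K \<Longrightarrow> \<phi> x = 0"
    and \<phi>: "continuous_on UNIV \<phi>"
  shows "integrable lebesgue (\<lambda>x. w x \<bullet> \<phi> x)"
proof -
  have wK: "integrable lebesgue (\<lambda>x. indicator K x *\<^sub>R w x)"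
    using w K(1,2) by (auto simp: L1_loc_def set_integrable_def)
  have "bounded (\<phi> ` K)"
    using K(1) \<phi> by (intro compact_imp_bounded compact_continuous_image) (auto intro: continuous_on_subset)
  then obtain M where M: "\<And>x. x \<in> K \<Longrightarrow> norm (\<phi> x) \<le> M" by (auto simp: bounded_iff)
  have [measurable]: "\<phi> \<in> borel_measurable lebesgue"
    using \<phi> by (intro measurable_completion) (auto intro: borel_measurable_continuous_onI)
  have eq: "(indicator K x *\<^sub>R w x) \<bullet> \<phi> x = w x \<bullet> \<phi> x" for x
    using K(3) by (auto simp: indicator_def)
  have "integrable lebesgue (\<lambda>x. (indicator K x *\<^sub>R w x) \<bullet> \<phi> x)"
  proof (rule Bochner_Integration.integrable_bound)
    show "integrable lebesgue (\<lambda>x. M * norm (indicator K x *\<^sub>R w x))"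
      using wK by (intro integrable_mult_right integrable_norm)
    show "(\<lambda>x. (indicator K x *\<^sub>R w x) \<bullet> \<phi> x) \<in> borel_measurable lebesgue"
      using borel_measurable_integrable[OF wK] by (intro borel_measurable_inner) auto
    show "AE x in lebesgue. norm ((indicator K x *\<^sub>R w x) \<bullet> \<phi> x) \<le> norm (M * norm (indicator K x *\<^sub>R w x))"
    proof (rule AE_I2)
      fix x
      show "norm ((indicator K x *\<^sub>R w x) \<bullet> \<phi> x) \<le> norm (M * norm (indicator K x *\<^sub>R w x))"
      proof (cases "x \<in> K")
        case True
        have "\<bar>w x \<bullet> \<phi> x\<bar> \<le> norm (w x) * norm (\<phi> x)" by (rule Cauchy_Schwarz_ineq2)
        also have "\<dots> \<le> norm (w x) * \<bar>M\<bar>" using M[OF True] by (intro mult_left_mono) auto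
        finally show ?thesis using True by (simp add: abs_mult mult.commute)
      qed simp
    qed
  qed
  then show ?thesis unfolding eq .
qed

lemma continuous_imp_L1_loc:
  fixes g :: "'a::euclidean_space \<Rightarrow> 'b::euclidean_space"
  assumes "continuous_on V g"
  shows "g \<in> L1_loc V"
  unfolding L1_loc_def set_integrable_def
proof safe
  fix K assume K: "compact K" "K \<subseteq> V"
  then have "integrable lborel (\<lambda>x. indicator K x *\<^sub>R g x)"
    using assms by (intro borel_integrable_compact) (auto intro: continuous_on_subset)
  then show "integrable lebesgue (\<lambda>x. indicator K x *\<^sub>R g x)"
    by (simp add: integrable_completion)
qed

lemma Ck_on_partial_deriv: "Ck_on (Suc k) U g \<Longrightarrow> Ck_on k U (partial_deriv i g)"
  unfolding partial_deriv_def[abs_def] by (simp add: axis_in_Basis_iff)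

lemma Ck_on_horizontal_grad_nth:
  assumes "open U" "Ck_on (Suc k) U g" "Ck_on k U (X j)"
  shows "Ck_on k U (\<lambda>x. horizontal_grad X g x $ j)"
  unfolding horizontal_grad_def
  using assms by (simp, intro Ck_on_sum Ck_on_mult Ck_on_nth Ck_on_partial_deriv)

lemma continuous_on_horizontal_grad:
  fixes X :: "'m::finite \<Rightarrow> real^'n \<Rightarrow> real^'n"
  assumes "open U" "Ck_on 1 U g" "\<And>j. continuous_on U (X j)"
  shows "continuous_on U (horizontal_grad X g)"
proof -
  have "continuous_on U (\<lambda>x. \<chi> j. horizontal_grad X g x $ j)"
    using Ck_on_horizontal_grad_nth[of U 0 g X] assms by (intro continuous_on_vec_lambda) auto
  then show ?thesis by simp
qed

lemma L1_loc_diff: "f \<in> L1_loc V \<Longrightarrow> g \<in> L1_loc V \<Longrightarrow> (\<lambda>x. f x - g x) \<in> L1_loc V"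
  unfolding L1_loc_def by (auto intro: set_integral_diff)

lemma Ck_on_vector_matrix_nth:
  assumes "open U" "Ck_on k U \<phi>" "\<And>j. Ck_on k U (X j)"
  shows "Ck_on k U (\<lambda>y. (\<phi> y v* coeff_matrix X y) $ i)"
  unfolding vector_matrix_mult_def coeff_matrix_def
  using assms by (simp, intro Ck_on_sum Ck_on_mult Ck_on_nth)

lemma partial_deriv_mult:
  assumes "Ck_on 1 U f" "Ck_on 1 U g" "x \<in> U"
  shows "partial_deriv i (\<lambda>y. f y * g y) x = f x * partial_deriv i g x + partial_deriv i f x * g x"
proof -
  have "((\<lambda>y. f y * g y) has_derivative
      (\<lambda>b. f x * frechet_derivative g (at x) b + frechet_derivative f (at x) b * g x)) (at x)"
    using Ck_on_has_derivative[OF assms(1)] Ck_on_has_derivative[OF assms(2)] assms(3)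
    by (intro has_derivative_mult) auto
  from frechet_derivative_at[OF this, symmetric] show ?thesis
    unfolding partial_deriv_def by (simp only:)
qed

lemma integral_partial_deriv_compact_support_eq_0:
  fixes G :: "real^'n \<Rightarrow> real"
  assumes "Ck_on 1 UNIV G" "compact K" "\<And>x. x \<notin> K \<Longrightarrow> G x = 0"
  shows "integrable lborel (partial_deriv i G)" "(LINT y|lborel. partial_deriv i G y) = 0"
proof -
  show "integrable lborel (partial_deriv i G)"
    using assms Ck_on_continuous[OF Ck_on_partial_deriv[of 0 UNIV G i]]
      partial_deriv_eq_0_outside_closed[OF compact_imp_closed[OF assms(2)] assms(3)]
    by (intro continuous_compact_support_integrable[OF assms(2)]) (auto intro: continuous_on_subset)
  show "(LINT y|lborel. partial_deriv i G y) = 0"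
    unfolding partial_deriv_def by (rule integral_derivative_compact_support_eq_0[OF assms])
qed

text \<open>Integration by parts: the classical horizontal gradient of a \<open>C\<^sup>1\<close> function is also its weak
  gradient.\<close>

lemma is_weak_horizontal_grad_classical:
  fixes X :: "'m::finite \<Rightarrow> real^'n \<Rightarrow> real^'n"
  assumes V: "open V" and g: "Ck_on 1 V g" and X: "\<And>j. Ck_on 1 V (X j)"
  shows "is_weak_horizontal_grad X V g (horizontal_grad X g)"
  unfolding is_weak_horizontal_grad_def
proof (intro conjI allI impI)
  have hc: "continuous_on V (horizontal_grad X g)"
    using X by (intro continuous_on_horizontal_grad V g Ck_on_continuous)
  show L1: "g \<in> L1_loc V" "horizontal_grad X g \<in> L1_loc V"
    using Ck_on_continuous[OF g] hc by (auto intro: continuous_imp_L1_loc)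
  fix \<phi> :: "real^'n \<Rightarrow> real^'m" assume \<phi>: "test_function V \<phi>"
  obtain K where K: "compact K" "K \<subseteq> V" "\<And>x. x \<notin> K \<Longrightarrow> \<phi> x = 0"
    using test_function_support[OF \<phi>] by metis
  note Kc = compact_imp_closed[OF K(1)]
  have \<phi>1: "Ck_on 1 UNIV \<phi>" using \<phi> by (auto simp: test_function_def)
  define F where "F y = \<phi> y v* coeff_matrix X y" for y
  have F0: "F y = 0" if "y \<notin> K" for y using K(3)[OF that] by (simp add: F_def)
  have F1: "Ck_on 1 V (\<lambda>y. F y $ i)" for i
    unfolding F_def using Ck_on_subset[OF \<phi>1] X V by (intro Ck_on_vector_matrix_nth) auto
  have gF1: "Ck_on 1 UNIV (\<lambda>y. g y * F y $ i)" for i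
    using F0 by (intro Ck_on_extend_zero[OF V Kc K(2)] Ck_on_mult V g F1) auto
  note int0 = integral_partial_deriv_compact_support_eq_0[OF gF1 K(1)]
  have pointwise: "(\<Sum>i\<in>UNIV. partial_deriv i (\<lambda>y. g y * F y $ i) x) =
      horizontal_grad X g x \<bullet> \<phi> x + g x * divergence F x" for x
  proof (cases "x \<in> V")
    case False
    then have "x \<notin> K" using K by auto
    then show ?thesis
      using partial_deriv_eq_0_outside_closed[OF Kc, of "\<lambda>y. g y * F y $ i" x i for i]
        divergence_eq_0_outside_closed[OF Kc, of F] F0 K(3) by simp
  next
    case True
    have "(\<Sum>i\<in>UNIV. partial_deriv i (\<lambda>y. g y * F y $ i) x) =
        g x * divergence F x + (\<Sum>i\<in>UNIV. partial_deriv i g x * F x $ i)"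
      using partial_deriv_mult[OF g F1 True]
      by (simp add: divergence_def sum.distrib sum_distrib_left)
    also have "(\<Sum>i\<in>UNIV. partial_deriv i g x * F x $ i) =
        (\<Sum>i\<in>UNIV. \<Sum>j\<in>UNIV. partial_deriv i g x * (\<phi> x $ j * X j x $ i))"
      by (simp add: F_def vector_matrix_mult_def coeff_matrix_def sum_distrib_left)
    also have "\<dots> = (\<Sum>j\<in>UNIV. \<Sum>i\<in>UNIV. partial_deriv i g x * (\<phi> x $ j * X j x $ i))"
      by (rule sum.swap)
    also have "\<dots> = horizontal_grad X g x \<bullet> \<phi> x"
      by (simp add: inner_vec_def horizontal_grad_def sum_distrib_left sum_distrib_right mult_ac)
    finally show ?thesis by simp
  qed
  have i1: "integrable lebesgue (\<lambda>x. horizontal_grad X g x \<bullet> \<phi> x)"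
    using L1_loc_integrable_inner[OF L1(2) K] Ck_on_continuous[OF \<phi>1] by simp
  have iP: "integrable lborel (\<lambda>x. \<Sum>i\<in>UNIV. partial_deriv i (\<lambda>y. g y * F y $ i) x)"
    using F0 by (intro Bochner_Integration.integrable_sum int0) auto
  then have i2: "integrable lebesgue (\<lambda>x. horizontal_grad X g x \<bullet> \<phi> x + g x * divergence F x)"
    unfolding pointwise by (simp add: integrable_completion)
  have i3: "integrable lebesgue (\<lambda>x. g x * divergence F x)"
    using Bochner_Integration.integrable_diff[OF i2 i1] by simp
  have "(LINT x|lborel. (\<Sum>i\<in>UNIV. partial_deriv i (\<lambda>y. g y * F y $ i) x)) = 0"
    using int0 F0 by (subst Bochner_Integration.integral_sum) auto
  then have "(LINT x|lebesgue. horizontal_grad X g x \<bullet> \<phi> x + g x * divergence F x) = 0"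
    using iP unfolding pointwise
    by (subst integral_completion) (simp_all add: borel_measurable_integrable)
  then have "(LINT x|lebesgue. horizontal_grad X g x \<bullet> \<phi> x) = - (LINT x|lebesgue. g x * divergence F x)"
    using Bochner_Integration.integral_add[OF i1 i3] by simp
  moreover have "x \<notin> V \<Longrightarrow> divergence F x = 0" for x
    using K(2) by (intro divergence_eq_0_outside_closed[OF Kc F0]) auto
  moreover have "x \<notin> V \<Longrightarrow> \<phi> x = 0" for x using K by auto
  ultimately show "(LINT x|lebesgue_on V. horizontal_grad X g x \<bullet> \<phi> x) =
        - (LINT x|lebesgue_on V. g x * divergence (\<lambda>y. \<phi> y v* coeff_matrix X y) x)"
    using V by (subst (1 2) LINT_lebesgue_on_eq) (auto simp: F_def[abs_def])
qed

lemma continuous_on_divergence: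
  fixes F :: "real^'n \<Rightarrow> real^'n"
  assumes "\<And>i. Ck_on 1 U (\<lambda>y. F y $ i)"
  shows "continuous_on U (divergence F)"
  unfolding divergence_def
  using Ck_on_continuous[OF Ck_on_partial_deriv[of 0 U "\<lambda>y. F y $ i" i for i]] assms
  by (intro continuous_on_sum) auto

lemma is_weak_horizontal_grad_scale:
  fixes X :: "'m::finite \<Rightarrow> real^'n \<Rightarrow> real^'n"
  assumes "is_weak_horizontal_grad X V u w"
  shows "is_weak_horizontal_grad X V (\<lambda>x. c * u x) (\<lambda>x. c *\<^sub>R w x)"
  unfolding is_weak_horizontal_grad_def
proof (intro conjI allI impI)
  show "(\<lambda>x. c * u x) \<in> L1_loc V" "(\<lambda>x. c *\<^sub>R w x) \<in> L1_loc V"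
    using assms by (auto simp: is_weak_horizontal_grad_def L1_loc_def intro: set_integrable_mult_right
        set_integrable_scaleR_right)
  fix \<phi> :: "real^'n \<Rightarrow> real^'m" assume "test_function V \<phi>"
  then have "(LINT x|lebesgue_on V. w x \<bullet> \<phi> x) =
        - (LINT x|lebesgue_on V. u x * divergence (\<lambda>y. \<phi> y v* coeff_matrix X y) x)"
    using assms unfolding is_weak_horizontal_grad_def by blast
  then show "(LINT x|lebesgue_on V. (c *\<^sub>R w x) \<bullet> \<phi> x) =
        - (LINT x|lebesgue_on V. c * u x * divergence (\<lambda>y. \<phi> y v* coeff_matrix X y) x)"
    by (simp add: mult.assoc)
qed

lemma is_weak_horizontal_grad_diff:
  fixes X :: "'m::finite \<Rightarrow> real^'n \<Rightarrow> real^'n"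
  assumes V: "open V" and X: "\<And>j. Ck_on 1 V (X j)"
    and w1: "is_weak_horizontal_grad X V u1 w1" and w2: "is_weak_horizontal_grad X V u2 w2"
  shows "is_weak_horizontal_grad X V (\<lambda>x. u1 x - u2 x) (\<lambda>x. w1 x - w2 x)"
  unfolding is_weak_horizontal_grad_def
proof (intro conjI allI impI)
  have L: "u1 \<in> L1_loc V" "u2 \<in> L1_loc V" "w1 \<in> L1_loc V" "w2 \<in> L1_loc V"
    using w1 w2 by (auto simp: is_weak_horizontal_grad_def)
  then show "(\<lambda>x. u1 x - u2 x) \<in> L1_loc V" "(\<lambda>x. w1 x - w2 x) \<in> L1_loc V"
    by (auto intro: L1_loc_diff)
  fix \<phi> :: "real^'n \<Rightarrow> real^'m" assume \<phi>: "test_function V \<phi>"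
  obtain K where K: "compact K" "K \<subseteq> V" "\<And>x. x \<notin> K \<Longrightarrow> \<phi> x = 0"
    using test_function_support[OF \<phi>] by metis
  have \<phi>1: "Ck_on 1 UNIV \<phi>" using \<phi> unfolding test_function_def by blast
  define F where "F = (\<lambda>y. \<phi> y v* coeff_matrix X y)"
  have F0: "F y = 0" if "y \<notin> K" for y using K(3)[OF that] by (simp add: F_def)
  have "Ck_on 1 V (\<lambda>y. F y $ i)" for i
    unfolding F_def using Ck_on_subset[OF \<phi>1] X V by (intro Ck_on_vector_matrix_nth) auto
  then have "Ck_on 1 UNIV (\<lambda>y. F y $ i)" for i
    using F0 by (intro Ck_on_extend_zero[OF V compact_imp_closed[OF K(1)] K(2)]) auto
  then have cdiv: "continuous_on UNIV (divergence F)" by (rule continuous_on_divergence)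
  have div0: "divergence F y = 0" if "y \<notin> K" for y
    by (rule divergence_eq_0_outside_closed[OF compact_imp_closed[OF K(1)] F0 that])
  have c\<phi>: "continuous_on UNIV \<phi>" by (rule Ck_on_continuous[OF \<phi>1])
  note iw = L1_loc_integrable_inner[OF L(3) K c\<phi>] L1_loc_integrable_inner[OF L(4) K c\<phi>]
  note iu = L1_loc_integrable_inner[OF L(1) K(1,2) div0 cdiv, unfolded inner_real_def]
    L1_loc_integrable_inner[OF L(2) K(1,2) div0 cdiv, unfolded inner_real_def]
  have V': "y \<notin> V \<Longrightarrow> \<phi> y = 0" "y \<notin> V \<Longrightarrow> divergence F y = 0" for y
    using K(2,3) div0 by auto
  have on: "(LINT x|lebesgue_on V. w x \<bullet> \<phi> x) = (LINT x|lebesgue. w x \<bullet> \<phi> x)"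
    "(LINT x|lebesgue_on V. u x * divergence F x) = (LINT x|lebesgue. u x * divergence F x)"
    for w :: "real^'n \<Rightarrow> real^'m" and u :: "real^'n \<Rightarrow> real"
    using V V' by (auto intro!: LINT_lebesgue_on_eq)
  have "(LINT x|lebesgue_on V. w1 x \<bullet> \<phi> x) = - (LINT x|lebesgue_on V. u1 x * divergence F x)"
    "(LINT x|lebesgue_on V. w2 x \<bullet> \<phi> x) = - (LINT x|lebesgue_on V. u2 x * divergence F x)"
    using w1 w2 \<phi> unfolding is_weak_horizontal_grad_def F_def by blast+
  then have "(LINT x|lebesgue. (w1 x - w2 x) \<bullet> \<phi> x) =
      - (LINT x|lebesgue. (u1 x - u2 x) * divergence F x)"
    unfolding on inner_diff_left left_diff_distrib
    by (simp add: Bochner_Integration.integral_diff[OF iw] Bochner_Integration.integral_diff[OF iu])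
  then have "(LINT x|lebesgue_on V. (w1 x - w2 x) \<bullet> \<phi> x) =
      - (LINT x|lebesgue_on V. (u1 x - u2 x) * divergence F x)"
    using on(1)[of "\<lambda>x. w1 x - w2 x"] on(2)[of "\<lambda>x. u1 x - u2 x"] by simp
  then show "(LINT x|lebesgue_on V. (w1 x - w2 x) \<bullet> \<phi> x) =
      - (LINT x|lebesgue_on V. (u1 x - u2 x) * divergence (\<lambda>y. \<phi> y v* coeff_matrix X y) x)"
    by (simp add: F_def)
qed

section \<open>Uniqueness of weak horizontal gradients\<close>

lemma set_integral_eq_0_imp_AE_eq_0:
  fixes g :: "'a \<Rightarrow> real"
  assumes g: "integrable M g" and A: "\<And>A. A \<in> sets M \<Longrightarrow> (LINT x|M. indicator A x * g x) = 0"
  shows "AE x in M. g x = 0"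
proof -
  note [measurable] = borel_measurable_integrable[OF g]
  have *: "AE x in M. \<not> 0 < h x"
    if h: "integrable M h" "\<And>A. A \<in> sets M \<Longrightarrow> (LINT x|M. indicator A x * h x) = 0" for h :: "'a \<Rightarrow> real"
  proof -
    note [measurable] = borel_measurable_integrable[OF h(1)]
    let ?A = "{x \<in> space M. 0 < h x}"
    have "?A \<in> sets M" by measurable
    then have "AE x in M. indicator ?A x * h x = 0"
      using h(2)[of ?A] integrable_mult_indicator[OF \<open>?A \<in> sets M\<close> h(1)]
      by (subst (asm) integral_nonneg_eq_0_iff_AE) (auto simp: indicator_def)
    then show ?thesis by (rule AE_mp) (auto intro!: AE_I2 simp: indicator_def)
  qed
  have "AE x in M. \<not> 0 < g x" using * g A by blast
  moreover have "AE x in M. \<not> 0 < - g x"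
    using g A by (intro *) auto
  ultimately show ?thesis by eventually_elim auto
qed

text \<open>Boxes form an intersection-stable generator of the Borel sets, so vanishing integrals over boxes
  propagate to all Borel sets and then, up to null sets, to all Lebesgue sets.\<close>

lemma box_integral_eq_0_imp_AE_eq_0:
  fixes g :: "'a::euclidean_space \<Rightarrow> real"
  assumes g: "integrable lebesgue g"
    and box: "\<And>a b. (LINT x|lebesgue. indicator (box a b) x * g x) = 0"
    and UNIV: "(LINT x|lebesgue. g x) = 0"
  shows "AE x in lebesgue. g x = 0"
proof (rule set_integral_eq_0_imp_AE_eq_0[OF g])
  have ig: "integrable lebesgue (\<lambda>x. indicator A x * g x)" if "A \<in> sets lebesgue" for A
    using integrable_mult_indicator[OF that g] by simp
  have borel: "(LINT x|lebesgue. indicator A x * g x) = 0" if A: "A \<in> sets borel" for A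
  proof -
    have "Int_stable (range (\<lambda>(a, b). box a b :: 'a set))"
      by (auto simp: Int_stable_def box_Int_box)
    moreover have "(range (\<lambda>(a, b). box a b)) \<subseteq> Pow (UNIV :: 'a set)" by auto
    moreover have "A \<in> sigma_sets UNIV (range (\<lambda>(a, b). box a b))"
      using A unfolding borel_eq_box by simp
    ultimately show ?thesis
    proof (induction rule: sigma_sets_induct_disjoint)
      case (basic A)
      then show ?case using box by auto
    next
      case empty
      then show ?case by simp
    next
      case (compl A)
      then have "A \<in> sets borel" by (simp add: borel_eq_box)
      then have "A \<in> sets lebesgue" by simp
      have "indicator (UNIV - A) x * g x = g x - indicator A x * g x" for x
        by (auto simp: indicator_def)
      then have "(LINT x|lebesgue. indicator (UNIV - A) x * g x) =
          (LINT x|lebesgue. g x) - (LINT x|lebesgue. indicator A x * g x)"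
        using ig[OF \<open>A \<in> sets lebesgue\<close>] g by (simp add: Bochner_Integration.integral_diff)
      then show ?case using compl UNIV by simp
    next
      case (union A)
      then have "\<And>i. A i \<in> sets borel" by (simp add: borel_eq_box image_subset_iff)
      then have m: "\<And>i. A i \<in> sets lebesgue" by simp
      have "(LINT x:(\<Union>i. A i)|lebesgue. g x) = (\<Sum>i. (LINT x:(A i)|lebesgue. g x))"
        using m union(1) ig[of "\<Union>i. A i"]
        by (intro lebesgue_integral_countable_add)
          (auto simp: disjoint_family_on_def set_integrable_def)
      then show ?case using union by (simp add: set_lebesgue_integral_def)
    qed
  qed
  fix A :: "'a set" assume "A \<in> sets lebesgue"
  then obtain S N N' where SN: "A = S \<union> N" "N \<subseteq> N'" "N' \<in> null_sets lborel" "S \<in> sets lborel"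
    by (rule sets_completionE)
  have "N' \<in> null_sets lebesgue" using SN(3) by (rule null_sets_completionI)
  then have "AE x in lebesgue. x \<notin> N'" by (rule AE_not_in)
  then have "AE x in lebesgue. indicator A x * g x = indicator S x * g x"
    by eventually_elim (use SN in \<open>auto simp: indicator_def\<close>)
  then have "(LINT x|lebesgue. indicator A x * g x) = (LINT x|lebesgue. indicator S x * g x)"
    using ig[OF \<open>A \<in> sets lebesgue\<close>] ig[of S] SN(4) by (intro integral_cong_AE) auto
  then show "(LINT x|lebesgue. indicator A x * g x) = 0"
    using borel SN(4) by simp
qed

text \<open>The fundamental lemma of the calculus of variations.\<close>

lemma L1_loc_orthogonal_test_functions_imp_AE_0:
  fixes d :: "real^'n \<Rightarrow> real^'m"
  assumes V: "open V" and d: "d \<in> L1_loc V"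
    and orth: "\<And>\<phi>. test_function V \<phi> \<Longrightarrow> (LINT x|lebesgue. d x \<bullet> \<phi> x) = 0"
  shows "AE x in lebesgue_on V. d x = 0"
proof -
  have cI: "integrable lebesgue (\<lambda>x. indicator (cbox a b) x * d x $ j)" if "cbox a b \<subseteq> V" for a b j
  proof -
    have "integrable lebesgue (\<lambda>x. indicator (cbox a b) x *\<^sub>R d x)"
      using d that by (auto simp: L1_loc_def set_integrable_def)
    from integrable_inner_left[OF this, of "axis j 1"] show ?thesis by (simp add: inner_axis)
  qed
  have bI: "integrable lebesgue (\<lambda>x. indicator (box a b) x * d x $ j)" if "cbox a b \<subseteq> V" for a b j
  proof -
    have "integrable lebesgue (\<lambda>x. indicator (box a b) x *\<^sub>R (indicator (cbox a b) x * d x $ j))"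
      by (rule integrable_mult_indicator[OF _ cI[OF that]]) auto
    moreover have "indicator (box a b) x *\<^sub>R (indicator (cbox a b) x * d x $ j) = indicator (box a b) x * d x $ j" for x
      using box_subset_cbox[of a b] by (auto simp: indicator_def)
    ultimately show ?thesis by (simp only:)
  qed
  have box0: "(LINT x|lebesgue. indicator (box a b) x * d x $ j) = 0" if ab: "cbox a b \<subseteq> V" for a b j
  proof (cases "box a b = {}")
    case False
    have "(\<lambda>k. LINT x|lebesgue. box_bump k a b x * d x $ j) \<longlonglongrightarrow>
        (LINT x|lebesgue. indicator (box a b) x * d x $ j)"
    proof (rule integral_dominated_convergence[where w = "\<lambda>x. \<bar>indicator (box a b) x * d x $ j\<bar>"])
      show "(\<lambda>x. indicator (box a b) x * d x $ j) \<in> borel_measurable lebesgue"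
        using bI[OF ab] by auto
      show "integrable lebesgue (\<lambda>x. \<bar>indicator (box a b) x * d x $ j\<bar>)"
        using bI[OF ab] by auto
      show "AE x in lebesgue. (\<lambda>k. box_bump k a b x * d x $ j) \<longlonglongrightarrow> indicator (box a b) x * d x $ j"
        by (intro AE_I2 tendsto_intros box_bump_tendsto False)
      show "AE x in lebesgue. norm (box_bump k a b x * d x $ j) \<le> \<bar>indicator (box a b) x * d x $ j\<bar>" for k
        using box_bump_bounds[of k a b] box_bump_eq_0[OF False]
        by (intro AE_I2) (auto simp: abs_mult indicator_def mult_left_le_one_le)
      have eq: "box_bump k a b x * d x $ j = box_bump k a b x * (indicator (box a b) x * d x $ j)" for x k
        using box_bump_eq_0[OF False] by (auto simp: indicator_def)
      have "box_bump k a b \<in> borel_measurable lebesgue" for k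
        using Ck_on_continuous[OF Ck_on_box_bump]
        by (intro measurable_completion) (auto intro: borel_measurable_continuous_onI)
      then show "(\<lambda>x. box_bump k a b x * d x $ j) \<in> borel_measurable lebesgue" for k
        unfolding eq using borel_measurable_integrable[OF bI[OF ab, of j]]
        by (rule borel_measurable_times)
    qed
    moreover have "(LINT x|lebesgue. box_bump k a b x * d x $ j) = 0" for k
    proof -
      have "test_function V (\<lambda>x. box_bump k a b x *\<^sub>R axis j 1)"
        using box_bump_eq_0[OF False] box_subset_cbox[of a b] ab
        by (intro test_functionI[of _ "cbox a b"] Ck_on_scaleR_const Ck_on_box_bump) auto
      from orth[OF this] show ?thesis
        by (simp add: inner_axis mult.commute)
    qed
    ultimately show ?thesis using LIMSEQ_unique[OF _ tendsto_const] by auto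
  qed simp
  have boxAE: "AE x in lebesgue. x \<in> box a b \<longrightarrow> d x $ j = 0" if ab: "cbox a b \<subseteq> V" for a b j
  proof -
    have "AE x in lebesgue. indicator (box a b) x * d x $ j = 0"
    proof (rule box_integral_eq_0_imp_AE_eq_0[OF bI[OF ab] _ box0[OF ab]])
      fix a' b'
      obtain a2 b2 where ab2: "box a' b' \<inter> box a b = box a2 b2" using box_Int_box by blast
      have "indicator (box a' b') x * (indicator (box a b) x * d x $ j) = indicator (box a2 b2) x * d x $ j" for x
        unfolding ab2[symmetric] by (auto simp: indicator_def)
      moreover have "(LINT x|lebesgue. indicator (box a2 b2) x * d x $ j) = 0"
      proof (cases "box a2 b2 = {}")
        case False
        then have "cbox a2 b2 = closure (box a2 b2)" by simp
        also have "\<dots> \<subseteq> cbox a b"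
          using ab2 box_subset_cbox[of a b] by (intro closure_minimal) auto
        finally show ?thesis using ab by (intro box0) auto
      qed simp
      ultimately show "(LINT x|lebesgue. indicator (box a' b') x * (indicator (box a b) x * d x $ j)) = 0"
        by (simp only:)
    qed
    then show ?thesis by (rule AE_mp) (auto intro!: AE_I2 simp: indicator_def)
  qed
  obtain \<D> where D: "countable \<D>" "\<D> \<subseteq> Pow V" "\<And>X. X \<in> \<D> \<Longrightarrow> \<exists>a b. X = cbox a b" "\<Union>\<D> = V"
    using open_countable_Union_open_cbox[OF V] by metis
  have "AE x in lebesgue. x \<in> C \<longrightarrow> d x = 0" if C: "C \<in> \<D>" for C
  proof -
    obtain a b where ab: "C = cbox a b" using D(3)[OF C] by blast
    have "cbox a b \<subseteq> V" using ab C D(2) by auto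
    then have "AE x in lebesgue. \<forall>j\<in>UNIV. x \<in> box a b \<longrightarrow> d x $ j = 0"
      using boxAE by (intro AE_finite_allI) auto
    moreover have "AE x in lebesgue. x \<notin> cbox a b - box a b"
      using negligible_frontier_interval[of a b] by (intro AE_not_in) (simp add: negligible_iff_null_sets)
    ultimately show ?thesis by eventually_elim (auto simp: ab vec_eq_iff)
  qed
  then have "AE x in lebesgue. \<forall>C\<in>\<D>. x \<in> C \<longrightarrow> d x = 0"
    by (subst AE_ball_countable[OF D(1)]) blast
  then have "AE x in lebesgue. x \<in> V \<longrightarrow> d x = 0"
    by eventually_elim (use D(4) in auto)
  then show ?thesis using V by (subst AE_restrict_space_iff) auto
qed

lemma is_weak_horizontal_grad_unique:
  fixes X :: "'m::finite \<Rightarrow> real^'n \<Rightarrow> real^'n"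
  assumes V: "open V" and w: "is_weak_horizontal_grad X V u w1" "is_weak_horizontal_grad X V u w2"
  shows "AE x in lebesgue_on V. w1 x = w2 x"
proof -
  have L1: "w1 \<in> L1_loc V" "w2 \<in> L1_loc V" using w by (auto simp: is_weak_horizontal_grad_def)
  have "AE x in lebesgue_on V. w1 x - w2 x = 0"
  proof (rule L1_loc_orthogonal_test_functions_imp_AE_0[OF V L1_loc_diff[OF L1]])
    fix \<phi> :: "real^'n \<Rightarrow> real^'m" assume \<phi>: "test_function V \<phi>"
    obtain K where K: "compact K" "K \<subseteq> V" "\<And>x. x \<notin> K \<Longrightarrow> \<phi> x = 0"
      using test_function_support[OF \<phi>] by metis
    have c: "continuous_on UNIV \<phi>"
      using \<phi> Ck_on_continuous[of 0 UNIV \<phi>] unfolding test_function_def by blast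
    have "(LINT x|lebesgue_on V. w1 x \<bullet> \<phi> x) = (LINT x|lebesgue_on V. w2 x \<bullet> \<phi> x)"
      using w \<phi> unfolding is_weak_horizontal_grad_def by auto
    moreover have "\<phi> x = 0" if "x \<notin> V" for x using that K by auto
    ultimately have "(LINT x|lebesgue. w1 x \<bullet> \<phi> x) = (LINT x|lebesgue. w2 x \<bullet> \<phi> x)"
      using V by (subst (asm) (1 2) LINT_lebesgue_on_eq) auto
    then show "(LINT x|lebesgue. (w1 x - w2 x) \<bullet> \<phi> x) = 0"
      using L1_loc_integrable_inner[OF L1(1) K c] L1_loc_integrable_inner[OF L1(2) K c]
      by (simp add: inner_diff_left Bochner_Integration.integral_diff)
  qed
  then show ?thesis by simp
qed

section \<open>Mollification and the commutator estimate\<close>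

lemma C1_bounded_derivative_on_compact:
  fixes f :: "'a::euclidean_space \<Rightarrow> real"
  assumes "Ck_on 1 V f" "compact K" "K \<subseteq> V"
  obtains L where "0 \<le> L" "\<And>y b. y \<in> K \<Longrightarrow> \<bar>frechet_derivative f (at y) b\<bar> \<le> L * norm b"
proof -
  have "\<exists>C. \<forall>y\<in>K. \<bar>frechet_derivative f (at y) b\<bar> \<le> C" for b
  proof -
    have "bounded ((\<lambda>y. frechet_derivative f (at y) b) ` K)"
      using assms Ck_on_Suc_continuous_derivative[of 0 V f b]
      by (intro compact_imp_bounded compact_continuous_image) (auto intro: continuous_on_subset)
    then show ?thesis by (auto simp: bounded_iff)
  qed
  then obtain C where C: "\<And>b y. y \<in> K \<Longrightarrow> \<bar>frechet_derivative f (at y) b\<bar> \<le> C b" by metis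
  define L where "L = (\<Sum>i\<in>Basis. \<bar>C i\<bar>)"
  show ?thesis
  proof (rule that[of L])
    show "0 \<le> L" by (simp add: L_def sum_nonneg)
    fix y b assume y: "y \<in> K"
    have lin: "linear (frechet_derivative f (at y))"
      using assms y by (intro linear_frechet_derivative) auto
    have "frechet_derivative f (at y) b = frechet_derivative f (at y) (\<Sum>i\<in>Basis. (b \<bullet> i) *\<^sub>R i)"
      by (simp add: euclidean_representation)
    also have "\<dots> = (\<Sum>i\<in>Basis. (b \<bullet> i) * frechet_derivative f (at y) i)"
      using lin by (simp add: linear_sum linear_scale)
    also have "\<bar>\<dots>\<bar> \<le> (\<Sum>i\<in>Basis. \<bar>(b \<bullet> i) * frechet_derivative f (at y) i\<bar>)"
      by (rule sum_abs)
    also have "\<dots> \<le> (\<Sum>i\<in>Basis. \<bar>C i\<bar> * norm b)"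
    proof (rule sum_mono)
      fix i :: 'a assume "i \<in> Basis"
      then have "\<bar>b \<bullet> i\<bar> \<le> norm b" by (rule Basis_le_norm)
      moreover have "\<bar>frechet_derivative f (at y) i\<bar> \<le> \<bar>C i\<bar>" using C[OF y, of i] by simp
      ultimately show "\<bar>(b \<bullet> i) * frechet_derivative f (at y) i\<bar> \<le> \<bar>C i\<bar> * norm b"
        by (subst mult.commute) (simp add: abs_mult mult_mono)
    qed
    finally show "\<bar>frechet_derivative f (at y) b\<bar> \<le> L * norm b"
      by (simp add: L_def sum_distrib_right)
  qed
qed

lemma C1_Lipschitz_on_convex_subsets:
  fixes f :: "'a::euclidean_space \<Rightarrow> real"
  assumes "Ck_on 1 V f" "compact K" "K \<subseteq> V"
  obtains L where "0 \<le> L"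
    "\<And>S x y. convex S \<Longrightarrow> S \<subseteq> K \<Longrightarrow> x \<in> S \<Longrightarrow> y \<in> S \<Longrightarrow> \<bar>f x - f y\<bar> \<le> L * norm (x - y)"
proof -
  obtain L where L: "0 \<le> L" "\<And>y b. y \<in> K \<Longrightarrow> \<bar>frechet_derivative f (at y) b\<bar> \<le> L * norm b"
    using C1_bounded_derivative_on_compact[OF assms] by metis
  have "\<bar>f x - f y\<bar> \<le> L * norm (x - y)" if S: "convex S" "S \<subseteq> K" "x \<in> S" "y \<in> S" for S x y
  proof -
    have "norm (f x - f y) \<le> L * norm (x - y)"
    proof (rule differentiable_bound[OF S(1) _ _ S(3,4)])
      fix z assume "z \<in> S"
      then have "z \<in> K" "z \<in> V" using S(2) assms(3) by auto
      then show "(f has_derivative frechet_derivative f (at z)) (at z within S)"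
        using Ck_on_has_derivative[OF assms(1)] by (auto intro: has_derivative_at_withinI)
      show "onorm (frechet_derivative f (at z)) \<le> L"
        using L(2)[OF \<open>z \<in> K\<close>] by (intro onorm_le) auto
    qed
    then show ?thesis by simp
  qed
  then show ?thesis using that L(1) by blast
qed

lemma partial_deriv_bound:
  fixes f :: "real^'n \<Rightarrow> real"
  assumes "\<And>b. \<bar>frechet_derivative f (at y) b\<bar> \<le> L * norm b"
  shows "\<bar>partial_deriv i f y\<bar> \<le> L"
  using assms[of "axis i 1"] by (simp add: partial_deriv_def norm_axis_1)

lemma compact_UN_cball:
  fixes K :: "'a::euclidean_space set"
  assumes "compact K"
  shows "compact (\<Union>x\<in>K. cball x \<delta>)"
proof -
  have "(\<Union>x\<in>K. cball x \<delta>) = {x + y | x y. x \<in> K \<and> y \<in> cball 0 \<delta>}" (is "?L = ?R")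
  proof
    show "?L \<subseteq> ?R"
    proof
      fix z assume "z \<in> ?L"
      then obtain x where "x \<in> K" "z \<in> cball x \<delta>" by blast
      then have "z = x + (z - x)" "z - x \<in> cball 0 \<delta>" by (auto simp: dist_norm norm_minus_commute)
      with \<open>x \<in> K\<close> show "z \<in> ?R" by blast
    qed
    show "?R \<subseteq> ?L" by (auto simp: dist_norm)
  qed
  then show ?thesis using compact_sums[OF assms compact_cball[of 0 \<delta>]] by simp
qed

text \<open>The derivative of the bump is of size \<open>1/\<delta>\<close>, but it is multiplied by the variation of a
  Lipschitz field over a ball of radius \<open>\<delta>\<close>. The bound is therefore uniform in \<open>\<delta>\<close>, in the centre
  \<open>x\<close> and in the bounded vector \<open>q\<close>.\<close>

lemma commutator_bound:
  fixes X :: "'m::finite \<Rightarrow> real^'n \<Rightarrow> real^'n"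
  assumes V: "open V" and X: "\<And>j. Ck_on 1 V (X j)"
    and K: "compact K" and \<delta>0: "0 < \<delta>0" "(\<Union>x\<in>K. cball x \<delta>0) \<subseteq> V" and B: "0 \<le> B"
  obtains C where "0 \<le> C"
    "\<And>x q \<delta> y. x \<in> K \<Longrightarrow> (\<And>j. \<bar>q $ j\<bar> \<le> B) \<Longrightarrow> 0 < \<delta> \<Longrightarrow> \<delta> \<le> \<delta>0 \<Longrightarrow>
      \<bar>divergence (\<lambda>y. bump \<delta> x y *\<^sub>R (q v* coeff_matrix X y - q v* coeff_matrix X x)) y\<bar> \<le> C"
proof -
  define K' where "K' = (\<Union>x\<in>K. cball x \<delta>0)"
  have K'c: "compact K'" unfolding K'_def by (rule compact_UN_cball[OF K])
  have cb: "cball x \<delta>0 \<subseteq> K'" if "x \<in> K" for x using that by (auto simp: K'_def)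
  have K'V: "K' \<subseteq> V" using \<delta>0(2) by (simp add: K'_def)
  have Xc: "Ck_on 1 V (\<lambda>y. X j y $ i)" for j i by (intro Ck_on_nth V X)
  have "\<exists>L. 0 \<le> L \<and> (\<forall>y\<in>K'. \<forall>b. \<bar>frechet_derivative (\<lambda>y. X j y $ i) (at y) b\<bar> \<le> L * norm b)" for j i
    using C1_bounded_derivative_on_compact[OF Xc K'c K'V, of j i] by metis
  then obtain D where D: "\<And>j i. 0 \<le> D j i"
    "\<And>j i y b. y \<in> K' \<Longrightarrow> \<bar>frechet_derivative (\<lambda>y. X j y $ i) (at y) b\<bar> \<le> D j i * norm b" by metis
  have "\<exists>L. 0 \<le> L \<and> (\<forall>S x y. convex S \<longrightarrow> S \<subseteq> K' \<longrightarrow> x \<in> S \<longrightarrow> y \<in> S \<longrightarrow>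
      \<bar>X j x $ i - X j y $ i\<bar> \<le> L * norm (x - y))" for j i
    using C1_Lipschitz_on_convex_subsets[OF Xc K'c K'V, of j i] by metis
  then obtain L where L: "\<And>j i. 0 \<le> L j i" "\<And>j i S x y. convex S \<Longrightarrow> S \<subseteq> K' \<Longrightarrow> x \<in> S \<Longrightarrow> y \<in> S \<Longrightarrow>
      \<bar>X j x $ i - X j y $ i\<bar> \<le> L j i * norm (x - y)" by metis
  obtain C1 where C1: "0 \<le> C1" "\<And>\<delta> x y (b::real^'n). 0 < \<delta> \<Longrightarrow>
      \<bar>frechet_derivative (bump \<delta> x) (at y) b\<bar> \<le> C1 / \<delta> * norm b"
    using bump_derivative_bound by metis
  define C where "C = (\<Sum>i\<in>UNIV. (\<Sum>j\<in>UNIV. B * D j i) + C1 * (\<Sum>j\<in>UNIV. B * L j i))"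
  show ?thesis
  proof (rule that[of C])
    show C0: "0 \<le> C" unfolding C_def using B D(1) L(1) C1(1)
      by (intro sum_nonneg add_nonneg_nonneg mult_nonneg_nonneg) auto
    fix x y :: "real^'n" and q :: "real^'m" and \<delta> :: real
    assume x: "x \<in> K" and q: "\<And>j. \<bar>q $ j\<bar> \<le> B" and \<delta>: "0 < \<delta>" "\<delta> \<le> \<delta>0"
    let ?Z = "\<lambda>y. q v* coeff_matrix X y"
    let ?F = "\<lambda>y. bump \<delta> x y *\<^sub>R (?Z y - ?Z x)"
    show "\<bar>divergence ?F y\<bar> \<le> C"
    proof (cases "y \<in> cball x \<delta>")
      case False
      then show ?thesis
        using divergence_eq_0_outside_closed[of "cball x \<delta>" ?F y] bump_eq_0[OF \<delta>(1), of _ x] C0 by simp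
    next
      case True
      then have nrm: "norm (y - x) \<le> \<delta>" by (simp add: dist_norm norm_minus_commute)
      have yK': "y \<in> K'" using True cb[OF x] \<delta>(2) by auto
      have Zn: "?Z y $ i = (\<Sum>j\<in>UNIV. q $ j * X j y $ i)" for y i
        by (simp add: vector_matrix_mult_def coeff_matrix_def)
      have "partial_deriv i (\<lambda>y. ?F y $ i) y =
          bump \<delta> x y * (\<Sum>j\<in>UNIV. q $ j * partial_deriv i (\<lambda>y. X j y $ i) y)
          + partial_deriv i (bump \<delta> x) y * (?Z y $ i - ?Z x $ i)" for i
      proof -
        have ZC: "Ck_on 1 V (\<lambda>y. ?Z y $ i - ?Z x $ i)"
          using X V by (intro Ck_on_minus Ck_on_vector_matrix_nth Ck_on_const)
        have "((\<lambda>y. ?Z y $ i - ?Z x $ i) has_derivative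
            (\<lambda>b. (\<Sum>j\<in>UNIV. q $ j * frechet_derivative (\<lambda>y. X j y $ i) (at y) b) - 0)) (at y)"
          unfolding Zn using yK' K'V
          by (intro has_derivative_diff has_derivative_sum has_derivative_const
              has_derivative_mult_right Ck_on_has_derivative[OF Xc]) auto
        from frechet_derivative_at[OF this, symmetric]
        have "partial_deriv i (\<lambda>y. ?Z y $ i - ?Z x $ i) y =
            (\<Sum>j\<in>UNIV. q $ j * partial_deriv i (\<lambda>y. X j y $ i) y)"
          by (simp add: partial_deriv_def)
        moreover have "partial_deriv i (\<lambda>y. bump \<delta> x y * (?Z y $ i - ?Z x $ i)) y =
            bump \<delta> x y * partial_deriv i (\<lambda>y. ?Z y $ i - ?Z x $ i) y +
            partial_deriv i (bump \<delta> x) y * (?Z y $ i - ?Z x $ i)"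
          using partial_deriv_mult[OF Ck_on_subset[OF Ck_on_bump] ZC] yK' K'V by auto
        ultimately show ?thesis by simp
      qed
      then have "\<bar>divergence ?F y\<bar> \<le> (\<Sum>i\<in>UNIV.
          \<bar>bump \<delta> x y * (\<Sum>j\<in>UNIV. q $ j * partial_deriv i (\<lambda>y. X j y $ i) y)
          + partial_deriv i (bump \<delta> x) y * (?Z y $ i - ?Z x $ i)\<bar>)"
        unfolding divergence_def by (simp only: sum_abs)
      also have "\<dots> \<le> C" unfolding C_def
      proof (rule sum_mono)
        fix i
        have "\<bar>\<Sum>j\<in>UNIV. q $ j * partial_deriv i (\<lambda>y. X j y $ i) y\<bar> \<le> (\<Sum>j\<in>UNIV. B * D j i)"
          by (rule order_trans[OF sum_abs], rule sum_mono)
            (use partial_deriv_bound[OF D(2)[OF yK']] q B in \<open>auto simp: abs_mult intro!: mult_mono\<close>)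
        then have 1: "\<bar>bump \<delta> x y * (\<Sum>j\<in>UNIV. q $ j * partial_deriv i (\<lambda>y. X j y $ i) y)\<bar> \<le> (\<Sum>j\<in>UNIV. B * D j i)"
          using bump_nonneg[of \<delta> x y] bump_le_1[of \<delta> x y]
          by (auto simp: abs_mult intro!: order_trans[OF mult_left_le_one_le])
        have "\<bar>?Z y $ i - ?Z x $ i\<bar> = \<bar>\<Sum>j\<in>UNIV. q $ j * (X j y $ i - X j x $ i)\<bar>"
          by (simp add: Zn sum_subtractf right_diff_distrib)
        also have "\<dots> \<le> (\<Sum>j\<in>UNIV. B * (L j i * \<delta>))"
        proof (rule order_trans[OF sum_abs], rule sum_mono)
          fix j
          have "\<bar>X j y $ i - X j x $ i\<bar> \<le> L j i * norm (y - x)"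
            by (rule L(2)[OF convex_cball cb[OF x]]) (use True \<delta> in auto)
          also have "\<dots> \<le> L j i * \<delta>" using nrm L(1) by (rule mult_left_mono)
          finally show "\<bar>q $ j * (X j y $ i - X j x $ i)\<bar> \<le> B * (L j i * \<delta>)"
            using q[of j] B by (simp add: abs_mult mult_mono)
        qed
        also have "\<dots> = (\<Sum>j\<in>UNIV. B * L j i) * \<delta>" by (simp add: sum_distrib_right mult.assoc)
        finally have Zb: "\<bar>?Z y $ i - ?Z x $ i\<bar> \<le> (\<Sum>j\<in>UNIV. B * L j i) * \<delta>" .
        have "\<bar>partial_deriv i (bump \<delta> x) y * (?Z y $ i - ?Z x $ i)\<bar> \<le>
            C1 / \<delta> * ((\<Sum>j\<in>UNIV. B * L j i) * \<delta>)"
          unfolding abs_mult using C1(1) \<delta>(1)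
          by (intro mult_mono Zb partial_deriv_bound C1(2)) auto
        also have "\<dots> = C1 * (\<Sum>j\<in>UNIV. B * L j i)" using \<delta>(1) by simp
        finally show "\<bar>bump \<delta> x y * (\<Sum>j\<in>UNIV. q $ j * partial_deriv i (\<lambda>y. X j y $ i) y)
          + partial_deriv i (bump \<delta> x) y * (?Z y $ i - ?Z x $ i)\<bar>
          \<le> (\<Sum>j\<in>UNIV. B * D j i) + C1 * (\<Sum>j\<in>UNIV. B * L j i)"
          using 1 by linarith
      qed
      finally show ?thesis .
    qed
  qed
qed

text \<open>The unnormalised mollification at scale \<open>\<delta>\<close>.\<close>

definition mollify :: "real \<Rightarrow> ('a::euclidean_space \<Rightarrow> real) \<Rightarrow> 'a \<Rightarrow> real" where
  "mollify \<delta> v x = (LINT y|lborel. v y * bump \<delta> x y)"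

lemma bump_commute: "bump \<delta> x y = bump \<delta> y x"
  by (simp add: bump_def inner_diff_left inner_diff_right inner_commute algebra_simps)

lemma borel_measurable_bump [measurable]: "bump \<delta> x \<in> borel_measurable borel"
  using Ck_on_continuous[OF Ck_on_bump] by (auto intro: borel_measurable_continuous_onI)

lemma continuous_on_mollify:
  fixes v :: "'a::euclidean_space \<Rightarrow> real"
  assumes "integrable lborel v"
  shows "continuous_on UNIV (mollify \<delta> v)"
  unfolding continuous_on_sequentially
proof safe
  fix s :: "nat \<Rightarrow> 'a" and a assume s: "s \<longlonglongrightarrow> a"
  have "(\<lambda>k. LINT y|lborel. v y * bump \<delta> (s k) y) \<longlonglongrightarrow> (LINT y|lborel. v y * bump \<delta> a y)"
  proof (rule integral_dominated_convergence[where w = "\<lambda>y. \<bar>v y\<bar>"])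
    show "AE y in lborel. (\<lambda>k. v y * bump \<delta> (s k) y) \<longlonglongrightarrow> v y * bump \<delta> a y"
    proof (rule AE_I2, rule tendsto_mult[OF tendsto_const])
      fix y :: 'a
      have "continuous_on UNIV (bump \<delta> y)" using Ck_on_continuous[OF Ck_on_bump] .
      then show "(\<lambda>k. bump \<delta> (s k) y) \<longlonglongrightarrow> bump \<delta> a y"
        using s unfolding continuous_on_sequentially bump_commute[of \<delta> _ y] by (auto simp: comp_def)
    qed
    show "AE y in lborel. norm (v y * bump \<delta> (s k) y) \<le> \<bar>v y\<bar>" for k
      using bump_nonneg[of \<delta> "s k"] bump_le_1[of \<delta> "s k"]
      by (intro AE_I2) (simp add: abs_mult mult_right_le_one_le)
  qed (use assms in auto)
  then show "(mollify \<delta> v \<circ> s) \<longlonglongrightarrow> mollify \<delta> v a"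
    by (simp add: comp_def mollify_def)
qed

lemma integrable_bump: "0 < \<delta> \<Longrightarrow> integrable lborel (bump \<delta> x)"
  using Ck_on_continuous[OF Ck_on_bump, of \<delta> x] bump_eq_0[of \<delta> _ x]
  by (intro continuous_compact_support_integrable[of "cball x \<delta>"]) (auto intro: continuous_on_subset)

lemma integral_bump_lower_bound:
  fixes x :: "'a::euclidean_space"
  assumes "0 < \<delta>"
  shows "exp (- 4 / 3) * measure lborel (cball x (\<delta> / 2)) \<le> (LINT y|lborel. bump \<delta> x y)"
proof -
  have i: "integrable lborel (indicat_real (cball x (\<delta> / 2)))"
    by (intro integrable_real_indicator emeasure_compact_finite) auto
  have "exp (- 4 / 3) * measure lborel (cball x (\<delta> / 2)) =
      (LINT y|lborel. exp (- 4 / 3) * indicator (cball x (\<delta> / 2)) y)"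
    by simp
  also have "\<dots> \<le> (LINT y|lborel. bump \<delta> x y)"
  proof (intro integral_mono integrable_bump assms integrable_mult_right i)
    show "exp (- 4 / 3) * indicator (cball x (\<delta> / 2)) y \<le> bump \<delta> x y" for y
      using bump_lower_bound[OF assms, of y x] bump_nonneg[of \<delta> x y]
      by (cases "y \<in> cball x (\<delta> / 2)") auto
  qed
  finally show ?thesis .
qed

lemma integral_bump_translate:
  "(LINT y|lborel. bump \<delta> (x::'a::euclidean_space) y) = (LINT y|lborel. bump \<delta> (0::'a) y)"
proof -
  have "bump \<delta> x y = bump \<delta> 0 (y + - x)" for y using bump_translate[of \<delta> 0 x y] by simp
  then have "(LINT y|lborel. bump \<delta> x y) = (LINT y|lborel. bump \<delta> 0 (y + - x))"
    by (simp only:)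
  also have "\<dots> = (LINT y|lborel. bump \<delta> (0::'a) y)"
    by (rule lborel_integral_translation[where f = "bump \<delta> 0" and c = "- x", OF borel_measurable_bump])
  finally show ?thesis .
qed

lemma mollify_near:
  fixes v :: "'a::euclidean_space \<Rightarrow> real"
  assumes v: "integrable lborel v" and \<delta>: "0 < \<delta>"
    and near: "\<And>y. y \<in> cball x \<delta> \<Longrightarrow> \<bar>v y - c\<bar> \<le> \<omega>"
  shows "\<bar>mollify \<delta> v x - c * (LINT y|lborel. bump \<delta> x y)\<bar> \<le> \<omega> * (LINT y|lborel. bump \<delta> x y)"
proof -
  have i: "integrable lborel (\<lambda>y. v y * bump \<delta> x y)"
    using v bump_nonneg[of \<delta> x] bump_le_1[of \<delta> x]
    by (intro Bochner_Integration.integrable_bound[OF v])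
      (auto simp: abs_mult mult_right_le_one_le)
  note ib = integrable_bump[OF \<delta>, of x]
  have "mollify \<delta> v x - c * (LINT y|lborel. bump \<delta> x y) = (LINT y|lborel. (v y - c) * bump \<delta> x y)"
    using i ib by (simp add: mollify_def left_diff_distrib Bochner_Integration.integral_diff)
  also have "\<bar>\<dots>\<bar> \<le> (LINT y|lborel. \<bar>(v y - c) * bump \<delta> x y\<bar>)"
    by (rule integral_abs_bound)
  also have "\<dots> \<le> (LINT y|lborel. \<omega> * bump \<delta> x y)"
  proof (rule integral_mono)
    show "\<bar>(v y - c) * bump \<delta> x y\<bar> \<le> \<omega> * bump \<delta> x y" for y
      using near[of y] bump_nonneg[of \<delta> x y] bump_eq_0[OF \<delta>, of y x]
      by (cases "y \<in> cball x \<delta>") (auto simp: abs_mult mult_right_mono)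
    have "integrable lborel (\<lambda>y. (v y - c) * bump \<delta> x y)"
      using i ib by (simp add: left_diff_distrib)
    then show "integrable lborel (\<lambda>y. \<bar>(v y - c) * bump \<delta> x y\<bar>)" by auto
  qed (use ib in auto)
  finally show ?thesis by simp
qed

lemma mollify_local_max_imp_derivative_eq_0:
  fixes v :: "'a::euclidean_space \<Rightarrow> real"
  assumes v: "integrable lborel v" and \<delta>: "0 < \<delta>"
    and max: "\<forall>\<^sub>F z in nhds x. mollify \<delta> v z \<le> mollify \<delta> v x"
  shows "(LINT y|lborel. v y * frechet_derivative (bump \<delta> x) (at y) b) = 0"
proof -
  have i: "integrable lborel (\<lambda>y. v y * bump \<delta> x y)" for x
    using v bump_nonneg[of \<delta> x] bump_le_1[of \<delta> x]
    by (intro Bochner_Integration.integrable_bound[OF v])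
      (auto simp: abs_mult mult_right_le_one_le)
  let ?l = "LINT y|lborel. v y * frechet_derivative (bump \<delta> x) (at y) b"
  have "(LINT y|lborel. v y * (bump \<delta> x (y + t *\<^sub>R b) - bump \<delta> x y)) =
      mollify \<delta> v (x - t *\<^sub>R b) - mollify \<delta> v x" for t
    using Bochner_Integration.integral_diff[OF i[of "x - t *\<^sub>R b"] i[of x]]
      bump_translate[of \<delta> x "- t *\<^sub>R b"]
    by (simp add: mollify_def right_diff_distrib)
  then have lim: "((\<lambda>t. (mollify \<delta> v (x - t *\<^sub>R b) - mollify \<delta> v x) / t) \<longlongrightarrow> ?l) (at 0)"
    using integral_difference_quotient_tendsto[OF Ck_on_bump[of 1 \<delta> x] compact_cball[of x \<delta>]
        bump_eq_0[OF \<delta>, of _ x] v, of b]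
    by simp
  have "filterlim (\<lambda>t. x - t *\<^sub>R b) (nhds (x - 0 *\<^sub>R b)) (at (0::real))"
    by (intro tendsto_intros)
  then have ev: "\<forall>\<^sub>F t in at 0. mollify \<delta> v (x - t *\<^sub>R b) - mollify \<delta> v x \<le> 0"
    using max by (auto simp: filterlim_iff)
  have "?l \<le> 0"
  proof (rule tendsto_upperbound)
    show "((\<lambda>t. (mollify \<delta> v (x - t *\<^sub>R b) - mollify \<delta> v x) / t) \<longlongrightarrow> ?l) (at_right 0)"
      by (rule filterlim_mono[OF lim]) (auto intro: at_le)
    have "\<forall>\<^sub>F t in at_right 0. mollify \<delta> v (x - t *\<^sub>R b) - mollify \<delta> v x \<le> 0"
      using ev by (rule filter_leD[OF at_le, rotated]) auto
    with eventually_at_right_less[of 0]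
    show "\<forall>\<^sub>F t in at_right 0. (mollify \<delta> v (x - t *\<^sub>R b) - mollify \<delta> v x) / t \<le> 0"
      by eventually_elim (simp add: divide_le_0_iff)
  qed auto
  moreover have "0 \<le> ?l"
  proof (rule tendsto_lowerbound)
    show "((\<lambda>t. (mollify \<delta> v (x - t *\<^sub>R b) - mollify \<delta> v x) / t) \<longlongrightarrow> ?l) (at_left 0)"
      by (rule filterlim_mono[OF lim]) (auto intro: at_le)
    have "\<forall>\<^sub>F t in at_left 0. mollify \<delta> v (x - t *\<^sub>R b) - mollify \<delta> v x \<le> 0"
      using ev by (rule filter_leD[OF at_le, rotated]) auto
    moreover have "\<forall>\<^sub>F t in at_left 0. t < (0::real)" by (simp add: eventually_at_filter)
    ultimately show "\<forall>\<^sub>F t in at_left 0. 0 \<le> (mollify \<delta> v (x - t *\<^sub>R b) - mollify \<delta> v x) / t"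
      by eventually_elim (simp add: zero_le_divide_iff)
  qed auto
  ultimately show ?thesis by simp
qed

lemma integral_divergence_compact_support_eq_0:
  fixes F :: "real^'n \<Rightarrow> real^'n"
  assumes "\<And>i. Ck_on 1 UNIV (\<lambda>y. F y $ i)" "compact K" "\<And>x. x \<notin> K \<Longrightarrow> F x = 0"
  shows "(LINT y|lborel. divergence F y) = 0"
proof -
  have "integrable lborel (partial_deriv i (\<lambda>y. F y $ i))"
    "(LINT y|lborel. partial_deriv i (\<lambda>y. F y $ i) y) = 0" for i
    by (rule integral_partial_deriv_compact_support_eq_0[OF assms(1,2)]; simp add: assms(3))+
  then show ?thesis unfolding divergence_def by (subst Bochner_Integration.integral_sum) auto
qed

section \<open>The maximum principle for weak horizontal derivatives\<close>

text \<open>A Friedrichs commutator estimate at a critical point \<open>x\<close> of the mollification of \<open>v\<close>: the field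
  \<open>Z = q v* coeff_matrix X\<close> is split into its value at \<open>x\<close>, whose contribution vanishes by
  criticality, and the difference \<open>Z - Z(x)\<close>. The divergence of the bump times \<open>Z - Z(x)\<close> has
  integral zero, so \<open>v\<close> may be replaced by \<open>v - v(x)\<close>, which is at most \<open>\<omega>\<close>
  in absolute value on the ball.\<close>

lemma weak_gradient_mollified_max_estimate:
  fixes X :: "'m::finite \<Rightarrow> real^'n \<Rightarrow> real^'n"
  assumes V: "open V" and X: "\<And>j. Ck_on 1 V (X j)"
    and weak: "is_weak_horizontal_grad X V v w"
    and cb: "cball x \<delta> \<subseteq> V" and \<delta>: "0 < \<delta>" and vc: "continuous_on V v"
    and osc: "\<And>y. y \<in> cball x \<delta> \<Longrightarrow> \<bar>v y - v x\<bar> \<le> \<omega>"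
    and crit: "\<And>b. (LINT y|lborel. v y * frechet_derivative (bump \<delta> x) (at y) b) = 0"
    and C: "\<And>y. \<bar>divergence (\<lambda>y. bump \<delta> x y *\<^sub>R (q v* coeff_matrix X y - q v* coeff_matrix X x)) y\<bar> \<le> C"
  shows "\<bar>LINT y|lebesgue. (q \<bullet> w y) * bump \<delta> x y\<bar> \<le> \<omega> * C * measure lborel (cball x \<delta>)"
proof -
  define Z where "Z y = q v* coeff_matrix X y" for y
  define G where "G = bump \<delta> x"
  note Gsupp = bump_eq_0[OF \<delta>, of _ x, folded G_def]
  have G1: "Ck_on k UNIV G" for k unfolding G_def by (rule Ck_on_bump)
  let ?K = "cball x \<delta>"
  define F1 where "F1 y = G y *\<^sub>R Z y" for y
  define F2 where "F2 y = G y *\<^sub>R (Z y - Z x)" for y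
  have Zi: "Ck_on 1 V (\<lambda>y. Z y $ i)" for i
    unfolding Z_def using V X by (intro Ck_on_vector_matrix_nth Ck_on_const)
  have F0: "F1 y = 0" "F2 y = 0" if "y \<notin> ?K" for y
    using Gsupp[OF that] by (simp_all add: F1_def F2_def)
  have GV: "Ck_on 1 V G" using Ck_on_subset[OF G1] by blast
  have "Ck_on 1 V (\<lambda>y. F1 y $ i)" "Ck_on 1 V (\<lambda>y. F2 y $ i)" for i
    unfolding F1_def F2_def vector_scaleR_component vector_minus_component
    by (intro Ck_on_scaleR Ck_on_minus Ck_on_const V GV Zi)+
  then have C1: "Ck_on 1 UNIV (\<lambda>y. F1 y $ i)" "Ck_on 1 UNIV (\<lambda>y. F2 y $ i)" for i
    using F0 by (auto intro: Ck_on_extend_zero[OF V closed_cball cb] simp del: One_nat_def)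
  have div0: "divergence F1 y = 0" "divergence F2 y = 0" if "y \<notin> ?K" for y
    using that F0 by (auto intro!: divergence_eq_0_outside_closed[OF closed_cball])
  have D0: "frechet_derivative G (at y) b = 0" if "y \<notin> ?K" for y b
    using frechet_derivative_eq_0_outside_closed[OF closed_cball Gsupp that] by simp
  have vcK: "continuous_on ?K v" using vc cb by (rule continuous_on_subset)
  have int: "integrable lborel h" if "continuous_on ?K h" "\<And>y. y \<notin> ?K \<Longrightarrow> h y = 0" for h :: "real^'n \<Rightarrow> real"
    using continuous_compact_support_integrable[OF compact_cball that] .
  have split: "divergence F1 y = divergence F2 y + frechet_derivative G (at y) (Z x)" for y
  proof -
    have "partial_deriv i (\<lambda>y. F1 y $ i) y = partial_deriv i (\<lambda>y. F2 y $ i) y + Z x $ i * partial_deriv i G y" for i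
    proof -
      have eq: "F1 y $ i = F2 y $ i + G y * Z x $ i" for y
        by (simp add: F1_def F2_def algebra_simps)
      have "((\<lambda>y. F2 y $ i + G y * Z x $ i) has_derivative
          (\<lambda>b. frechet_derivative (\<lambda>y. F2 y $ i) (at y) b + frechet_derivative G (at y) b * Z x $ i)) (at y)"
        using Ck_on_has_derivative[OF C1(2)[of i], of y] Ck_on_has_derivative[OF G1[of 1], of y]
        by (auto intro!: derivative_eq_intros)
      from frechet_derivative_at[OF this, symmetric] show ?thesis
        by (simp add: partial_deriv_def eq)
    qed
    moreover have "frechet_derivative G (at y) (Z x) = (\<Sum>i\<in>UNIV. Z x $ i * partial_deriv i G y)"
    proof -
      have lin: "linear (frechet_derivative G (at y))"
        using G1[of 1] by (intro linear_frechet_derivative) auto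
      have "frechet_derivative G (at y) (Z x) = frechet_derivative G (at y) (\<Sum>i\<in>UNIV. Z x $ i *s axis i 1)"
        by (simp add: basis_expansion)
      also have "\<dots> = (\<Sum>i\<in>UNIV. Z x $ i * partial_deriv i G y)"
        using lin by (simp add: linear_sum linear_scale scalar_mult_eq_scaleR partial_deriv_def)
      finally show ?thesis .
    qed
    ultimately show ?thesis by (simp add: divergence_def sum.distrib)
  qed
  have c1: "continuous_on UNIV (divergence F1)" and c2: "continuous_on UNIV (divergence F2)"
    using C1 by (auto intro: continuous_on_divergence)
  have cD: "continuous_on UNIV (\<lambda>y. frechet_derivative G (at y) b)" for b
    using Ck_on_Suc_continuous_derivative[of 0 UNIV G b] G1[of 1] by simp
  have i1: "integrable lborel (\<lambda>y. v y * divergence F1 y)"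
    and i2: "integrable lborel (\<lambda>y. v y * divergence F2 y)"
    and i2': "integrable lborel (\<lambda>y. v x * divergence F2 y)"
    and i3: "integrable lborel (\<lambda>y. v y * frechet_derivative G (at y) (Z x))"
    using div0 D0 vcK continuous_on_subset[OF c1] continuous_on_subset[OF c2] continuous_on_subset[OF cD]
    by (auto intro!: int continuous_on_mult continuous_on_const)
  have "test_function V (\<lambda>y. G y *\<^sub>R q)"
    using Gsupp by (intro test_functionI[OF _ compact_cball cb] Ck_on_scaleR_const G1) auto
  then have "(LINT y|lebesgue_on V. w y \<bullet> (G y *\<^sub>R q)) =
      - (LINT y|lebesgue_on V. v y * divergence (\<lambda>y. (G y *\<^sub>R q) v* coeff_matrix X y) y)"
    using weak unfolding is_weak_horizontal_grad_def by blast
  moreover have "(\<lambda>y. (G y *\<^sub>R q) v* coeff_matrix X y) = F1"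
    by (auto simp: F1_def Z_def vec_eq_iff vector_matrix_mult_def sum_distrib_left mult.assoc)
  moreover have "y \<notin> V \<Longrightarrow> y \<notin> ?K" for y using cb by auto
  ultimately have "(LINT y|lebesgue. w y \<bullet> (G y *\<^sub>R q)) = - (LINT y|lebesgue. v y * divergence F1 y)"
    using V Gsupp div0 by (subst (asm) (1 2) LINT_lebesgue_on_eq) auto
  then have "(LINT y|lebesgue. (q \<bullet> w y) * G y) = - (LINT y|lebesgue. v y * divergence F1 y)"
    by (simp add: inner_commute mult.commute)
  also have "(LINT y|lebesgue. v y * divergence F1 y) = (LINT y|lborel. v y * divergence F1 y)"
    using borel_measurable_integrable[OF i1] by (rule integral_completion)
  also have "\<dots> = (LINT y|lborel. v y * divergence F2 y)"
    using i2 i3 crit[of "Z x"] unfolding split G_def[symmetric]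
    by (simp add: distrib_left Bochner_Integration.integral_add)
  also have "\<dots> = (LINT y|lborel. (v y - v x) * divergence F2 y)"
    using i2 i2' integral_divergence_compact_support_eq_0[OF C1(2) compact_cball F0(2)]
    by (simp add: left_diff_distrib Bochner_Integration.integral_diff)
  finally have "\<bar>LINT y|lebesgue. (q \<bullet> w y) * G y\<bar> = \<bar>LINT y|lborel. (v y - v x) * divergence F2 y\<bar>"
    by simp
  also have "\<dots> \<le> (LINT y|lborel. \<bar>(v y - v x) * divergence F2 y\<bar>)" by (rule integral_abs_bound)
  also have "\<dots> \<le> (LINT y|lborel. \<omega> * C * indicator ?K y)"
  proof (rule integral_mono)
    have "integrable lborel (\<lambda>y. (v y - v x) * divergence F2 y)"
      using i2 i2' by (simp add: left_diff_distrib)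
    then show "integrable lborel (\<lambda>y. \<bar>(v y - v x) * divergence F2 y\<bar>)" by auto
    have "integrable lborel (indicat_real ?K)"
      by (intro integrable_real_indicator emeasure_compact_finite) auto
    then show "integrable lborel (\<lambda>y. \<omega> * C * indicator ?K y)" by (rule integrable_mult_right)
    fix y
    show "\<bar>(v y - v x) * divergence F2 y\<bar> \<le> \<omega> * C * indicator ?K y"
    proof (cases "y \<in> ?K")
      case True
      have "0 \<le> \<omega>" using osc[of x] \<delta> by auto
      then have "\<bar>v y - v x\<bar> * \<bar>divergence F2 y\<bar> \<le> \<omega> * C"
        using osc[OF True] C[of y] by (intro mult_mono) (auto simp: F2_def[abs_def] G_def Z_def)
      then show ?thesis using True by (simp add: abs_mult)
    qed (simp add: div0)
  qed
  also have "\<dots> = \<omega> * C * measure lborel ?K" by simp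
  finally show ?thesis by (simp add: G_def)
qed

text \<open>A superlevel set of \<open>v\<close> that is nonempty and contained in a compact subset \<open>K\<close> of \<open>V\<close> is the form
  in which an interior maximum enters.\<close>

lemma strict_weak_inequality_imp_no_interior_max:
  fixes X :: "'m::finite \<Rightarrow> real^'n \<Rightarrow> real^'n"
  assumes V: "open V" and X: "\<And>j. Ck_on 1 V (X j)"
    and vc: "continuous_on V v" and weak: "is_weak_horizontal_grad X V v w"
    and wP: "AE y in lebesgue_on V. norm (w y) \<le> P"
    and Qc: "continuous_on V Q" and \<theta>: "0 < \<theta>"
    and Qw: "AE y in lebesgue_on V. Q y \<bullet> w y \<le> - \<theta>"
    and K: "compact K" "K \<subseteq> V" and x0: "x0 \<in> V" "\<beta> < v x0"
    and super: "\<And>y. y \<in> V \<Longrightarrow> \<beta> < v y \<Longrightarrow> y \<in> K"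
  shows False
proof -
  obtain \<delta>0 where \<delta>0: "0 < \<delta>0" "(\<Union>x\<in>K. cball x \<delta>0) \<subseteq> V"
    using compact_subset_open_imp_cball_epsilon_subset[OF K(1) V K(2)] by metis
  define K' where "K' = (\<Union>x\<in>K. cball x \<delta>0)"
  have K'c: "compact K'" unfolding K'_def by (rule compact_UN_cball[OF K(1)])
  have cb: "cball x \<delta>0 \<subseteq> K'" if "x \<in> K" for x using that by (auto simp: K'_def)
  have K'V: "K' \<subseteq> V" using \<delta>0(2) by (simp add: K'_def)
  have x0K: "x0 \<in> K" using super x0 by blast
  have "bounded (Q ` K)"
    using K Qc by (intro compact_imp_bounded compact_continuous_image) (auto intro: continuous_on_subset)
  then obtain B0 where B0: "\<And>x. x \<in> K \<Longrightarrow> norm (Q x) \<le> B0" by (auto simp: bounded_iff)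
  define B where "B = max B0 0"
  have B: "0 \<le> B" "\<And>x j. x \<in> K \<Longrightarrow> \<bar>Q x $ j\<bar> \<le> B"
    using B0 by (auto simp: B_def intro: order_trans[OF component_le_norm_cart] max.coboundedI1)
  obtain C where C: "0 \<le> C"
    "\<And>x q \<delta> y. x \<in> K \<Longrightarrow> (\<And>j. \<bar>q $ j\<bar> \<le> B) \<Longrightarrow> 0 < \<delta> \<Longrightarrow> \<delta> \<le> \<delta>0 \<Longrightarrow>
      \<bar>divergence (\<lambda>y. bump \<delta> x y *\<^sub>R (q v* coeff_matrix X y - q v* coeff_matrix X x)) y\<bar> \<le> C"
    by (rule commutator_bound[where X = X, OF V X K(1) \<delta>0 B(1)], rule that, assumption, blast)
  define e where "e = exp (- 4 / 3 :: real)"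
  have e: "0 < e" by (simp add: e_def)
  \<comment> \<open>\<open>\<omega>\<close> bounds the oscillation of \<open>v\<close> at scale \<open>\<delta>\<close>: the first entry keeps the maximum of the
    mollification inside the superlevel set, the second makes the commutator smaller than the
    contribution of \<open>- \<theta>\<close>.\<close>
  define \<omega> where "\<omega> = min ((v x0 - \<beta>) / 4) (\<theta> * e / (4 * 2 ^ CARD('n) * (C + 1)))"
  have \<omega>: "0 < \<omega>" "2 * \<omega> < v x0 - \<beta>" "\<omega> * C * 2 ^ CARD('n) < \<theta> / 2 * e"
  proof -
    show "0 < \<omega>" using x0(2) \<theta> e C(1) by (simp add: \<omega>_def)
    have "\<omega> \<le> (v x0 - \<beta>) / 4" unfolding \<omega>_def by (rule min.cobounded1)
    then have "4 * \<omega> \<le> v x0 - \<beta>" by (simp add: field_simps)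
    then show "2 * \<omega> < v x0 - \<beta>" using \<open>0 < \<omega>\<close> by linarith
    have "\<omega> \<le> \<theta> * e / (4 * 2 ^ CARD('n) * (C + 1))"
      unfolding \<omega>_def by (rule min.cobounded2)
    then have "\<omega> * (4 * 2 ^ CARD('n) * (C + 1)) \<le> \<theta> * e" using C(1) by (simp add: pos_le_divide_eq)
    moreover have "\<omega> * C * 2 ^ CARD('n) * 4 \<le> \<omega> * (4 * 2 ^ CARD('n) * (C + 1))"
      using \<open>0 < \<omega>\<close> by (simp add: algebra_simps)
    moreover have "0 < \<theta> * e" using \<theta> e by simp
    ultimately show "\<omega> * C * 2 ^ CARD('n) < \<theta> / 2 * e" by (simp add: field_simps)
  qed
  define \<rho> where "\<rho> = \<theta> / (2 * (\<bar>P\<bar> + 1))"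
  have \<rho>: "0 < \<rho>" "\<rho> * \<bar>P\<bar> \<le> \<theta> / 2" using \<theta> by (auto simp: \<rho>_def field_simps)
  have "uniformly_continuous_on K' v" "uniformly_continuous_on K' Q"
    using K'c K'V vc Qc by (auto intro!: compact_uniformly_continuous intro: continuous_on_subset)
  then obtain d1 d2 where d: "0 < d1" "0 < d2"
    "\<And>x y. x \<in> K' \<Longrightarrow> y \<in> K' \<Longrightarrow> dist y x < d1 \<Longrightarrow> dist (v y) (v x) < \<omega>"
    "\<And>x y. x \<in> K' \<Longrightarrow> y \<in> K' \<Longrightarrow> dist y x < d2 \<Longrightarrow> dist (Q y) (Q x) < \<rho>"
    using \<omega>(1) \<rho>(1) unfolding uniformly_continuous_on_def by metis
  define \<delta> where "\<delta> = min \<delta>0 (min (d1 / 2) (d2 / 2))"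
  have \<delta>: "0 < \<delta>" "\<delta> \<le> \<delta>0" "\<delta> < d1" "\<delta> < d2" using d \<delta>0 by (auto simp: \<delta>_def)
  have cb\<delta>: "cball x \<delta> \<subseteq> K'" if "x \<in> K" for x using cb[OF that] \<delta>(2) by auto
  have KK': "x \<in> K'" if "x \<in> K" for x using cb[OF that] \<delta>0(1) by auto
  have oscv: "\<bar>v y - v x\<bar> \<le> \<omega>" if "x \<in> K" "y \<in> cball x \<delta>" for x y
    using d(3)[of x y] cb\<delta>[OF that(1)] that KK' \<delta> by (auto simp: dist_real_def dist_commute)
  have oscQ: "norm (Q x - Q y) \<le> \<rho>" if "x \<in> K" "y \<in> cball x \<delta>" for x y
    using d(4)[of y x] cb\<delta>[OF that(1)] that KK' \<delta> by (auto simp: dist_norm)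
  \<comment> \<open>Cutting off \<open>v\<close> makes it integrable without changing its mollification on \<open>K\<close>.\<close>
  define vh where "vh y = indicator K' y * v y" for y
  have vh: "integrable lborel vh"
    using borel_integrable_compact[OF K'c continuous_on_subset[OF vc K'V]] by (simp add: vh_def[abs_def])
  have vh_eq: "vh y = v y" if "y \<in> K'" for y using that by (simp add: vh_def)
  define I where "I = (LINT y|lborel. bump \<delta> (0::real^'n) y)"
  have I: "(LINT y|lborel. bump \<delta> x y) = I" for x :: "real^'n"
    unfolding I_def by (rule integral_bump_translate)
  have volpos: "0 < measure lborel (cball x (\<delta> / 2))" for x :: "real^'n"
    using \<delta>(1) by (simp add: content_cball_gt_0_iff)
  have Ilow: "e * measure lborel (cball x (\<delta> / 2)) \<le> I" for x :: "real^'n"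
    using integral_bump_lower_bound[OF \<delta>(1), of x] by (simp add: I e_def)
  then have Ipos: "0 < I" using volpos[of 0] e by (smt (verit, best) mult_pos_pos)
  have near: "\<bar>mollify \<delta> vh x - v x * I\<bar> \<le> \<omega> * I" if "x \<in> K" for x
  proof -
    have "\<bar>vh y - v x\<bar> \<le> \<omega>" if "y \<in> cball x \<delta>" for y
      using oscv[OF \<open>x \<in> K\<close> that] cb\<delta>[OF \<open>x \<in> K\<close>] that vh_eq[of y] by auto
    from mollify_near[OF vh \<delta>(1) this] show ?thesis by (simp add: I)
  qed
  obtain x where x: "x \<in> K" "\<And>z. z \<in> K \<Longrightarrow> mollify \<delta> vh z \<le> mollify \<delta> vh x"
    using continuous_attains_sup[OF K(1), of "mollify \<delta> vh"] continuous_on_mollify[OF vh] x0K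
    by (auto intro: continuous_on_subset)
  have "\<beta> < v x"
  proof -
    have "(v x0 - \<omega>) * I \<le> (v x + \<omega>) * I"
      using near[OF x0K] near[OF x(1)] x(2)[OF x0K] by (simp add: algebra_simps abs_le_iff)
    then have "v x0 - \<omega> \<le> v x + \<omega>" using Ipos by simp
    then show ?thesis using \<omega>(2) by linarith
  qed
  have "open {y \<in> V. \<beta> < v y}"
    using continuous_openin_preimage_gen[OF vc open_greaterThan[of \<beta>]] V
    by (auto simp: openin_open_eq vimage_def Int_def)
  then have "\<forall>\<^sub>F z in nhds x. z \<in> {y \<in> V. \<beta> < v y}"
    using \<open>\<beta> < v x\<close> x(1) K(2) by (intro eventually_nhds_in_open) auto
  then have "\<forall>\<^sub>F z in nhds x. mollify \<delta> vh z \<le> mollify \<delta> vh x"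
    by eventually_elim (use super x(2) in auto)
  from mollify_local_max_imp_derivative_eq_0[OF vh \<delta>(1) this]
  have "(LINT y|lborel. vh y * frechet_derivative (bump \<delta> x) (at y) b) = 0" for b .
  moreover have "vh y * frechet_derivative (bump \<delta> x) (at y) b = v y * frechet_derivative (bump \<delta> x) (at y) b" for y b
  proof (cases "y \<in> cball x \<delta>")
    case True
    then show ?thesis using cb\<delta>[OF x(1)] vh_eq by auto
  next
    case False
    then show ?thesis
      using frechet_derivative_eq_0_outside_closed[of "cball x \<delta>" "bump \<delta> x" y]
        bump_eq_0[OF \<delta>(1), of _ x] by simp
  qed
  ultimately have crit: "(LINT y|lborel. v y * frechet_derivative (bump \<delta> x) (at y) b) = 0" for b
    by (simp only:)
  have cbV: "cball x \<delta> \<subseteq> V" using cb\<delta>[OF x(1)] K'V by auto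
  have upper: "\<bar>LINT y|lebesgue. (Q x \<bullet> w y) * bump \<delta> x y\<bar> \<le> \<omega> * C * measure lborel (cball x \<delta>)"
    using C(2)[OF x(1) B(2)[OF x(1)] \<delta>(1,2)] oscv[OF x(1)]
    by (intro weak_gradient_mollified_max_estimate[where X = X, OF V X weak cbV \<delta>(1) vc _ crit]) auto
  have lower: "(LINT y|lebesgue. (Q x \<bullet> w y) * bump \<delta> x y) \<le> - (\<theta> / 2) * I"
  proof -
    have "(LINT y|lebesgue. (Q x \<bullet> w y) * bump \<delta> x y) \<le> (LINT y|lebesgue. - (\<theta> / 2) * bump \<delta> x y)"
    proof (rule integral_mono_AE)
      have "integrable lebesgue (\<lambda>y. w y \<bullet> (bump \<delta> x y *\<^sub>R Q x))"
        using weak bump_eq_0[OF \<delta>(1), of _ x] Ck_on_continuous[OF Ck_on_bump, of \<delta> x]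
        by (intro L1_loc_integrable_inner[OF _ compact_cball cbV] continuous_on_scaleR continuous_on_const)
           (auto simp: is_weak_horizontal_grad_def)
      then show "integrable lebesgue (\<lambda>y. (Q x \<bullet> w y) * bump \<delta> x y)"
        by (simp add: inner_commute mult.commute)
      show "integrable lebesgue (\<lambda>y. - (\<theta> / 2) * bump \<delta> x y)"
        using integrable_bump[OF \<delta>(1), of x] by (intro integrable_mult_right) (simp add: integrable_completion)
      have "AE y in lebesgue. y \<in> V \<longrightarrow> norm (w y) \<le> P" "AE y in lebesgue. y \<in> V \<longrightarrow> Q y \<bullet> w y \<le> - \<theta>"
        using wP Qw V by (auto simp: AE_restrict_space_iff)
      then show "AE y in lebesgue. (Q x \<bullet> w y) * bump \<delta> x y \<le> - (\<theta> / 2) * bump \<delta> x y"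
      proof eventually_elim
        case (elim y)
        show ?case
        proof (cases "y \<in> cball x \<delta>")
          case True
          then have y: "norm (w y) \<le> P" "Q y \<bullet> w y \<le> - \<theta>" using elim cbV by auto
          have "(Q x - Q y) \<bullet> w y \<le> norm (Q x - Q y) * norm (w y)" by (rule norm_cauchy_schwarz)
          also have "\<dots> \<le> \<rho> * \<bar>P\<bar>" using oscQ[OF x(1) True] y(1) \<rho>(1) by (intro mult_mono) auto
          finally have "Q x \<bullet> w y \<le> - (\<theta> / 2)" using y(2) \<rho>(2) by (simp add: inner_diff_left)
          then show ?thesis using bump_nonneg[of \<delta> x y] by (rule mult_right_mono)
        qed (simp add: bump_eq_0[OF \<delta>(1)])
      qed
    qed
    also have "\<dots> = - (\<theta> / 2) * I"
      using I[of x] by (simp add: integral_completion)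
    finally show ?thesis .
  qed
  have "measure lborel (cball x \<delta>) = 2 ^ CARD('n) * measure lborel (cball x (\<delta> / 2))"
    using \<delta>(1) by (simp add: content_cball power_divide)
  then have "\<theta> / 2 * I \<le> \<omega> * C * 2 ^ CARD('n) * measure lborel (cball x (\<delta> / 2))"
    using upper lower by (simp add: abs_le_iff mult.assoc)
  also have "\<dots> < \<theta> / 2 * e * measure lborel (cball x (\<delta> / 2))"
    using \<omega>(3) volpos[of x] by (rule mult_strict_right_mono)
  also have "\<dots> \<le> \<theta> / 2 * I" using Ilow[of x] \<theta> by (simp add: mult.assoc)
  finally show False by simp
qed

section \<open>The corrected test function\<close>

lemma has_derivative_eq_inner_partial_derivs:
  fixes f :: "real^'n \<Rightarrow> real"
  assumes "(f has_derivative D) (at x)"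
  shows "D b = (\<chi> i. partial_deriv i f x) \<bullet> b"
proof -
  have lin: "linear D" using assms by (rule has_derivative_linear)
  have "D b = D (\<Sum>i\<in>UNIV. b $ i *s axis i 1)" by (simp add: basis_expansion)
  also have "\<dots> = (\<Sum>i\<in>UNIV. b $ i * D (axis i 1))"
    using lin by (simp add: linear_sum linear_scale scalar_mult_eq_scaleR)
  also have "\<dots> = (\<chi> i. partial_deriv i f x) \<bullet> b"
    using frechet_derivative_at[OF assms] by (simp add: partial_deriv_def inner_vec_def mult.commute)
  finally show ?thesis .
qed

lemma horizontal_grad_nth_eq_derivative:
  assumes "(f has_derivative D) (at x)"
  shows "horizontal_grad X f x $ j = D (X j x)"
  unfolding has_derivative_eq_inner_partial_derivs[OF assms]
  by (simp add: horizontal_grad_def inner_vec_def mult.commute)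

lemma Ck_on_horizontal_grad:
  fixes X :: "'m::finite \<Rightarrow> real^'n \<Rightarrow> real^'n"
  assumes "open U" "Ck_on (Suc k) U g" "\<And>j. Ck_on k U (X j)"
  shows "Ck_on k U (horizontal_grad X g)"
proof -
  have eq: "(\<Sum>j\<in>UNIV. horizontal_grad X g x $ j *\<^sub>R axis j 1) = horizontal_grad X g x" for x
    by (simp add: basis_expansion flip: scalar_mult_eq_scaleR)
  have "Ck_on k U (\<lambda>x. \<Sum>j\<in>UNIV. horizontal_grad X g x $ j *\<^sub>R (axis j 1 :: real^'m))"
    using assms by (intro Ck_on_sum Ck_on_scaleR_const Ck_on_horizontal_grad_nth)
  then show ?thesis by (simp only: eq)
qed

text \<open>The quadratic form is \<open>y \<bullet> M y\<close> for the symmetric matrix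
  \<open>M = a a\<^sup>T / (a \<bullet> z) + 1 - z z\<^sup>T / |z|\<^sup>2\<close>. It is positive definite, and \<open>M z = a\<close>.\<close>

lemma quadratic_form_lower_bound:
  fixes a z :: "'a::euclidean_space"
  assumes az: "0 < a \<bullet> z"
  obtains c where "0 < c"
    "\<And>y. c * (norm y)\<^sup>2 \<le> (y \<bullet> a)\<^sup>2 / (a \<bullet> z) + y \<bullet> y - (y \<bullet> z)\<^sup>2 / (z \<bullet> z)"
proof -
  define N where "N y = (y \<bullet> a)\<^sup>2 / (a \<bullet> z) + y \<bullet> y - (y \<bullet> z)\<^sup>2 / (z \<bullet> z)" for y
  have z: "z \<noteq> 0" "0 < z \<bullet> z" using az by auto
  have N_eq: "N y = (y \<bullet> a)\<^sup>2 / (a \<bullet> z) + (norm (y - ((y \<bullet> z) / (z \<bullet> z)) *\<^sub>R z))\<^sup>2" for y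
    unfolding power2_norm_eq_inner N_def using z(2)
    by (simp add: inner_diff_left inner_diff_right inner_commute power2_eq_square field_simps)
  have N_pos: "0 < N y" if "y \<noteq> 0" for y
  proof -
    define t where "t = (y \<bullet> z) / (z \<bullet> z)"
    have "0 \<le> (y \<bullet> a)\<^sup>2 / (a \<bullet> z)" "0 \<le> (norm (y - t *\<^sub>R z))\<^sup>2" using az by auto
    moreover have "(y \<bullet> a)\<^sup>2 / (a \<bullet> z) \<noteq> 0 \<or> (norm (y - t *\<^sub>R z))\<^sup>2 \<noteq> 0"
    proof (rule ccontr)
      assume "\<not> ?thesis"
      then have *: "y \<bullet> a = 0" "y = t *\<^sub>R z" using az by auto
      then have "t * (a \<bullet> z) = 0" by (metis inner_commute inner_scaleR_left)
      then have "y = 0" using * az by simp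
      with that show False by simp
    qed
    ultimately show ?thesis unfolding N_eq t_def[symmetric] by linarith
  qed
  have "continuous_on (sphere 0 1) N" unfolding N_def[abs_def]
    using az z by (intro continuous_intros) auto
  moreover have "sphere (0::'a) 1 \<noteq> {}" by simp
  ultimately obtain y0 where y0: "y0 \<in> sphere 0 1" "\<And>y. y \<in> sphere 0 1 \<Longrightarrow> N y0 \<le> N y"
    using continuous_attains_inf[of "sphere 0 1" N] by auto
  show ?thesis
  proof (rule that[of "N y0"])
    have "y0 \<noteq> 0" using y0(1) by force
    then show "0 < N y0" by (rule N_pos)
    fix y
    have "N y0 * (norm y)\<^sup>2 \<le> N y"
    proof (cases "y = 0")
      case False
      let ?e = "y /\<^sub>R norm y"
      have "N y0 \<le> N ?e" using False by (intro y0(2)) simp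
      moreover have "N (t *\<^sub>R v) = t\<^sup>2 * N v" for t v
        by (simp add: N_def power_mult_distrib algebra_simps power2_eq_square)
      then have "N y = (norm y)\<^sup>2 * N ?e" using False by (metis divideR_right norm_eq_zero)
      ultimately show ?thesis
        using mult_left_mono[of "N y0" "N ?e" "(norm y)\<^sup>2"] by (simp add: mult.commute)
    qed (simp add: N_def)
    then show "N y0 * (norm y)\<^sup>2 \<le> (y \<bullet> a)\<^sup>2 / (a \<bullet> z) + y \<bullet> y - (y \<bullet> z)\<^sup>2 / (z \<bullet> z)"
      by (simp add: N_def)
  qed
qed

lemma has_derivative_composite_Lagrangian:
  fixes f :: "real^'n \<Rightarrow> real \<Rightarrow> real^'m \<Rightarrow> real"
  assumes "((\<lambda>(x, s, p). f x s p) has_derivative DF) (at (x0, g x0, H x0))"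
    and "(g has_derivative Dg) (at x0)" "(H has_derivative DH) (at x0)"
  shows "((\<lambda>x. f x (g x) (H x)) has_derivative (\<lambda>b. DF (b, Dg b, DH b))) (at x0)"
proof -
  have "((\<lambda>x. (x, g x, H x)) has_derivative (\<lambda>b. (b, Dg b, DH b))) (at x0)"
    by (intro has_derivative_Pair has_derivative_ident assms)
  from has_derivative_compose[OF this assms(1)] show ?thesis by simp
qed

text \<open>The vector \<open>\<Sum>\<^sub>j q\<^sub>j X\<^sub>j(x)\<close>, along which the Aronsson operator with \<open>q = D\<^sub>p f\<close> differentiates.\<close>

definition characteristic_direction ::
  "('m::finite \<Rightarrow> real^'n \<Rightarrow> real^'n) \<Rightarrow> real^'m \<Rightarrow> real^'n \<Rightarrow> real^'n" where
  "characteristic_direction X q x = (\<Sum>j\<in>UNIV. q $ j *\<^sub>R X j x)"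

text \<open>The strict sign of the Aronsson operator allows a quadratic correction of the test function
  that makes the first derivative of \<open>f(x, \<psi>, X\<psi>)\<close> vanish at the contact point, does not change the
  value and the horizontal gradient there, and makes the contact strict to second order.\<close>

lemma exists_corrected_test_function:
  fixes X :: "'m::finite \<Rightarrow> real^'n \<Rightarrow> real^'n" and f :: "real^'n \<Rightarrow> real \<Rightarrow> real^'m \<Rightarrow> real"
  defines "F \<equiv> \<lambda>(x, s, p). f x s p"
  assumes U: "open U" and x0: "x0 \<in> U" and X: "\<And>j. Ck_on 2 U (X j)" and \<phi>: "Ck_on 2 U \<phi>"
    and F: "F differentiable (at (x0, \<phi> x0, horizontal_grad X \<phi> x0))"
    and \<sigma>: "\<sigma> * \<sigma> = 1" and neg: "0 < \<sigma> * aronsson_op X f \<phi> x0"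
    and q0: "q0 = (\<chi> i. partial_deriv i (\<lambda>p. f x0 (\<phi> x0) p) (horizontal_grad X \<phi> x0))"
  obtains \<psi> c where "Ck_on 2 U \<psi>" "0 < c" "\<psi> x0 = \<phi> x0"
    "horizontal_grad X \<psi> x0 = horizontal_grad X \<phi> x0"
    "\<And>x. c * (norm (x - x0))\<^sup>2 \<le> \<sigma> * (\<psi> x - \<phi> x)"
    "((\<lambda>x. f x (\<psi> x) (horizontal_grad X \<psi> x)) has_derivative (\<lambda>_. 0)) (at x0)"
    "characteristic_direction X q0 x0 \<noteq> 0"
proof -
  let ?H = "horizontal_grad X \<phi>"
  define DF where "DF = frechet_derivative F (at (x0, \<phi> x0, ?H x0))"
  have DF: "(F has_derivative DF) (at (x0, \<phi> x0, ?H x0))"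
    unfolding DF_def using F by (simp add: frechet_derivative_works)
  have linDF: "linear DF" using DF by (rule has_derivative_linear)
  have X1: "Ck_on 1 U (X j)" for j using Ck_on_mono[OF X, of 1 j] by simp
  have \<phi>': "Ck_on (Suc 1) U \<phi>" using \<phi> by (simp add: numeral_2_eq_2)
  define DH where "DH = frechet_derivative ?H (at x0)"
  have DH: "(?H has_derivative DH) (at x0)"
    unfolding DH_def
    using Ck_on_has_derivative[OF Ck_on_horizontal_grad[where X = X, OF U \<phi>' X1] _ x0] by simp
  define D\<phi> where "D\<phi> x = frechet_derivative \<phi> (at x)" for x
  have D\<phi>: "(\<phi> has_derivative D\<phi> x) (at x)" if "x \<in> U" for x
    unfolding D\<phi>_def using \<phi> that by (intro Ck_on_has_derivative) auto
  define h where "h x = f x (\<phi> x) (?H x)" for x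
  have Dh: "(h has_derivative (\<lambda>b. DF (b, D\<phi> x0 b, DH b))) (at x0)"
    unfolding h_def[abs_def]
    by (rule has_derivative_composite_Lagrangian[OF _ D\<phi>[OF x0] DH]) (use DF in \<open>simp add: F_def\<close>)
  define g where "g = (\<chi> i. partial_deriv i h x0)"
  have g: "DF (b, D\<phi> x0 b, DH b) = g \<bullet> b" for b
    unfolding g_def by (rule has_derivative_eq_inner_partial_derivs[OF Dh])
  have Dp: "((\<lambda>p. f x0 (\<phi> x0) p) has_derivative (\<lambda>e. DF (0, 0, e))) (at (?H x0))"
  proof -
    have "((\<lambda>p. (x0, \<phi> x0, p)) has_derivative (\<lambda>e. (0, 0, e))) (at (?H x0))"
      by (intro has_derivative_Pair has_derivative_ident has_derivative_const)
    from has_derivative_compose[OF this DF] show ?thesis by (simp add: F_def)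
  qed
  have q0D: "DF (0, 0, e) = q0 \<bullet> e" for e
    unfolding q0 by (rule has_derivative_eq_inner_partial_derivs[OF Dp])
  define z where "z = characteristic_direction X q0 x0"
  have "aronsson_op X f \<phi> x0 = - (\<Sum>j\<in>UNIV. (g \<bullet> X j x0) * q0 $ j)"
    unfolding aronsson_op_def q0 g_def h_def[abs_def]
    by (simp add: horizontal_grad_def inner_vec_def mult.commute)
  also have "\<dots> = - (g \<bullet> z)"
    by (simp add: z_def characteristic_direction_def inner_sum_right mult.commute)
  finally have gz: "\<sigma> * (g \<bullet> z) < 0" using neg by simp
  define a where "a = (- \<sigma>) *\<^sub>R g"
  have az: "0 < a \<bullet> z" using gz by (simp add: a_def)
  have z: "z \<noteq> 0" using az by auto
  define N where "N y = (y \<bullet> a)\<^sup>2 / (a \<bullet> z) + y \<bullet> y - (y \<bullet> z)\<^sup>2 / (z \<bullet> z)" for y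
  obtain c where c: "0 < c" "\<And>y. c * (norm y)\<^sup>2 \<le> N y"
    using quadratic_form_lower_bound[OF az] unfolding N_def by metis
  \<comment> \<open>\<open>M\<close> is half the gradient of \<open>N\<close>, and \<open>M b \<bullet> z = b \<bullet> a\<close>.\<close>
  define M where "M y = ((y \<bullet> a) / (a \<bullet> z)) *\<^sub>R a + y - ((y \<bullet> z) / (z \<bullet> z)) *\<^sub>R z" for y
  define \<psi> where "\<psi> x = \<phi> x + (\<sigma> / 2) * N (x - x0)" for x
  have DN: "((\<lambda>x. N (x - x0)) has_derivative (\<lambda>b. 2 * (M (x - x0) \<bullet> b))) (at x)" for x
  proof -
    have "((\<lambda>x. ((x - x0) \<bullet> a)\<^sup>2 * inverse (a \<bullet> z) + (x - x0) \<bullet> (x - x0)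
        - ((x - x0) \<bullet> z)\<^sup>2 * inverse (z \<bullet> z)) has_derivative
      (\<lambda>b. 2 * ((x - x0) \<bullet> a) * (b \<bullet> a) * inverse (a \<bullet> z) + 2 * ((x - x0) \<bullet> b)
        - 2 * ((x - x0) \<bullet> z) * (b \<bullet> z) * inverse (z \<bullet> z))) (at x)"
      by (auto intro!: derivative_eq_intros simp: inner_commute fun_eq_iff algebra_simps)
    then show ?thesis
      by (simp add: N_def M_def divide_inverse inner_add_left inner_diff_left inner_commute
          algebra_simps)
  qed
  have M0: "M 0 = 0" by (simp add: M_def)
  have "Ck_on 2 U (\<lambda>x. inverse (a \<bullet> z) * (((x - x0) \<bullet> a) * ((x - x0) \<bullet> a))
      + (x - x0) \<bullet> (x - x0) - inverse (z \<bullet> z) * (((x - x0) \<bullet> z) * ((x - x0) \<bullet> z)))"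
    by (intro Ck_on_minus Ck_on_add Ck_on_cmult Ck_on_mult Ck_on_inner_left Ck_on_ident Ck_on_const
        Ck_on_inner_self U)
  then have "Ck_on 2 U (\<lambda>x. N (x - x0))"
    by (simp add: N_def power2_eq_square divide_inverse mult.commute)
  then have \<psi>2: "Ck_on 2 U \<psi>"
    unfolding \<psi>_def[abs_def] by (intro Ck_on_add Ck_on_cmult U \<phi>)
  have D\<psi>: "(\<psi> has_derivative (\<lambda>b. D\<phi> x b + \<sigma> * (M (x - x0) \<bullet> b))) (at x)" if "x \<in> U" for x
  proof -
    have "(\<psi> has_derivative (\<lambda>b. D\<phi> x b + (\<sigma> / 2) * (2 * (M (x - x0) \<bullet> b)))) (at x)"
      unfolding \<psi>_def[abs_def]
      by (intro has_derivative_add has_derivative_mult_right DN D\<phi> that)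
    then show ?thesis by simp
  qed
  have X\<psi>: "horizontal_grad X \<psi> x = ?H x + (\<chi> j. \<sigma> * (M (x - x0) \<bullet> X j x))" if "x \<in> U" for x
    using horizontal_grad_nth_eq_derivative[OF D\<psi>[OF that], of X]
      horizontal_grad_nth_eq_derivative[OF D\<phi>[OF that], of X] by (simp add: vec_eq_iff)
  have blM: "bounded_linear M"
    unfolding linear_conv_bounded_linear[symmetric]
    by (intro linearI) (simp_all add: M_def inner_add_left add_divide_distrib algebra_simps)
  define DE where "DE b = (\<chi> j. \<sigma> * (M b \<bullet> X j x0))" for b
  have DE: "((\<lambda>x. \<chi> j. \<sigma> * (M (x - x0) \<bullet> X j x)) has_derivative DE) (at x0)"
  proof -
    have "((\<lambda>x. \<sigma> * (M (x - x0) \<bullet> X j x)) has_derivative (\<lambda>b. \<sigma> * (M b \<bullet> X j x0))) (at x0)" for j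
    proof -
      have "((\<lambda>x. M (x - x0)) has_derivative M) (at x0)"
        by (rule bounded_linear.has_derivative[OF blM, of "\<lambda>x. x - x0" "\<lambda>b. b"])
           (auto intro!: derivative_eq_intros)
      moreover have "(X j has_derivative frechet_derivative (X j) (at x0)) (at x0)"
        using X x0 by (intro Ck_on_has_derivative) auto
      ultimately have "((\<lambda>x. M (x - x0) \<bullet> X j x) has_derivative
          (\<lambda>b. M (x0 - x0) \<bullet> frechet_derivative (X j) (at x0) b + M b \<bullet> X j x0)) (at x0)"
        by (rule has_derivative_inner)
      then show ?thesis by (intro has_derivative_mult_right) (simp add: M0)
    qed
    then show ?thesis
      unfolding DE_def[abs_def]
      by (subst has_derivative_componentwise_within) (auto simp: Basis_vec_def inner_axis)
  qed
  have X\<psi>0: "horizontal_grad X \<psi> x0 = ?H x0" using X\<psi>[OF x0] by (simp add: M0 vec_eq_iff)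
  have \<psi>0: "\<psi> x0 = \<phi> x0" by (simp add: \<psi>_def N_def)
  have DX\<psi>: "(horizontal_grad X \<psi> has_derivative (\<lambda>b. DH b + DE b)) (at x0)"
    by (rule has_derivative_transform_within_open[OF has_derivative_add[OF DH DE] U x0]) (simp add: X\<psi>)
  have "((\<lambda>x. f x (\<psi> x) (horizontal_grad X \<psi> x)) has_derivative
      (\<lambda>b. DF (b, D\<phi> x0 b + \<sigma> * (M (x0 - x0) \<bullet> b), DH b + DE b))) (at x0)"
    by (rule has_derivative_composite_Lagrangian[OF _ D\<psi>[OF x0] DX\<psi>])
       (use DF in \<open>simp add: F_def X\<psi>0 \<psi>0\<close>)
  moreover have "DF (b, D\<phi> x0 b + \<sigma> * (M (x0 - x0) \<bullet> b), DH b + DE b) = 0" for b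
  proof -
    have "DF (b, D\<phi> x0 b + \<sigma> * (M (x0 - x0) \<bullet> b), DH b + DE b) =
        DF ((b, D\<phi> x0 b, DH b) + (0, 0, DE b))" by (simp add: M0)
    also have "\<dots> = g \<bullet> b + q0 \<bullet> DE b" using linDF by (simp only: linear_add g q0D)
    also have "q0 \<bullet> DE b = \<sigma> * (M b \<bullet> z)"
      by (simp add: DE_def inner_vec_def[of q0] z_def characteristic_direction_def inner_sum_right
          sum_distrib_left mult_ac)
    also have "M b \<bullet> z = b \<bullet> a" using az z by (simp add: M_def inner_diff_left inner_add_left)
    also have "\<sigma> * (b \<bullet> a) = - (\<sigma> * \<sigma>) * (g \<bullet> b)" by (simp add: a_def inner_commute)
    finally show ?thesis by (simp add: \<sigma>)
  qed
  ultimately have D0: "((\<lambda>x. f x (\<psi> x) (horizontal_grad X \<psi> x)) has_derivative (\<lambda>_. 0)) (at x0)"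
    by simp
  have "c / 2 * (norm (x - x0))\<^sup>2 \<le> \<sigma> * (\<psi> x - \<phi> x)" for x
  proof -
    have "\<sigma> * (\<psi> x - \<phi> x) = (\<sigma> * \<sigma>) / 2 * N (x - x0)" by (simp add: \<psi>_def)
    then show ?thesis using c(2)[of "x - x0"] by (simp add: \<sigma>)
  qed
  then show ?thesis using that[of \<psi> "c / 2"] \<psi>2 c(1) \<psi>0 X\<psi>0 D0 z by (simp add: z_def)
qed

section \<open>Comparison with classical competitors\<close>

lemma borel_measurable_lebesgue_on_AE:
  fixes g g' :: "'a::euclidean_space \<Rightarrow> 'b::euclidean_space"
  assumes V: "V \<in> sets lebesgue" and g: "g \<in> borel_measurable (lebesgue_on V)"
    and ae: "AE x in lebesgue_on V. g x = g' x"
  shows "g' \<in> borel_measurable (lebesgue_on V)"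
proof -
  have "(\<lambda>x. if x \<in> V then g x else 0) \<in> borel_measurable lebesgue"
    using g V by (simp add: borel_measurable_if)
  moreover have "AE x in lebesgue. x \<in> V \<longrightarrow> g x = g' x"
    using ae V by (simp add: AE_restrict_space_iff)
  then have "AE x in lebesgue. (if x \<in> V then g x else 0) = (if x \<in> V then g' x else 0)"
    by eventually_elim auto
  ultimately have "(\<lambda>x. if x \<in> V then g' x else 0) \<in> borel_measurable lebesgue"
    by (rule borel_measurable_AE)
  then show ?thesis using V by (simp add: borel_measurable_if)
qed

lemma continuous_on_compact_imp_Linf:
  fixes g :: "'a::euclidean_space \<Rightarrow> 'b::euclidean_space"
  assumes "continuous_on K g" "compact K" "V \<subseteq> K" "open V"
  shows "g \<in> Linf V"
proof -
  have "bounded (g ` K)" using assms by (intro compact_imp_bounded compact_continuous_image)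
  then obtain B where B: "\<And>x. x \<in> K \<Longrightarrow> norm (g x) \<le> B" by (auto simp: bounded_iff)
  have m: "g \<in> borel_measurable (lebesgue_on V)"
    using assms by (intro continuous_imp_measurable_on_sets_lebesgue) (auto intro: continuous_on_subset)
  have "Linf_norm V g \<le> ennreal B"
    unfolding Linf_norm_def using m B assms(3) by (intro esssup_I AE_I2) (auto intro!: ennreal_leI)
  also have "\<dots> < \<infinity>" by simp
  finally show ?thesis using m by (simp add: Linf_def)
qed

text \<open>The functional uses arbitrarily chosen weak gradients on \<open>V\<close>. Uniqueness identifies them almost
  everywhere with the classical gradient of \<open>v\<close> and with the weak gradient \<open>w\<close> of \<open>u\<close> on \<open>U\<close>.
  Measurability of the composite integrand is essential, since \<open>esssup\<close> of a non-measurable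
  function is infinite.\<close>

lemma absolute_minimizer_AE_le:
  fixes X :: "'m::finite \<Rightarrow> real^'n \<Rightarrow> real^'n" and f :: "real^'n \<Rightarrow> real \<Rightarrow> real^'m \<Rightarrow> real"
  assumes U: "open U" and X: "\<And>j. Ck_on 1 U (X j)"
    and fc: "continuous_on (U \<times> UNIV \<times> UNIV) (\<lambda>(x, s, p). f x s p)"
    and min: "absolute_minimizer U X f u" and w: "is_weak_horizontal_grad X U u w"
    and V: "open V" "closure V \<subseteq> U" "compact (closure V)"
    and v: "Ck_on 1 U v" and bdry: "\<And>x. x \<in> closure V \<Longrightarrow> x \<notin> V \<Longrightarrow> v x = u x"
    and le: "\<And>x. x \<in> V \<Longrightarrow> \<bar>f x (v x) (horizontal_grad X v x)\<bar> \<le> M" and M: "0 \<le> M"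
  shows "AE x in lebesgue_on V. f x (u x) (w x) \<le> M"
proof -
  have VU: "V \<subseteq> U" using V(2) closure_subset by blast
  have XV: "Ck_on 1 V (X j)" for j using Ck_on_subset[OF X VU] .
  have vV: "Ck_on 1 V v" using Ck_on_subset[OF v VU] .
  have hc: "continuous_on U (horizontal_grad X v)"
    using X by (intro continuous_on_horizontal_grad U v Ck_on_continuous)
  have vc: "continuous_on U v" using Ck_on_continuous[OF v] .
  have wv: "is_weak_horizontal_grad X V v (horizontal_grad X v)"
    by (rule is_weak_horizontal_grad_classical[OF V(1) vV XV])
  have "v \<in> Linf V" "horizontal_grad X v \<in> Linf V"
    using V hc vc by (auto intro!: continuous_on_compact_imp_Linf[OF _ V(3) closure_subset V(1)]
        intro: continuous_on_subset)
  then have vW: "v \<in> W1inf_cont X V"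
    using wv vc VU by (auto simp: W1inf_cont_def W1inf_def intro: continuous_on_subset)
  have "continuous_on (closure V) (\<lambda>x. if x \<in> V then v x else u x)"
    using continuous_on_subset[OF vc V(2)] by (rule continuous_on_cong[THEN iffD1, rotated 2]) (auto simp: bdry)
  then have "supremal_functional X f u V \<le> supremal_functional X f v V"
    using min V vW unfolding absolute_minimizer_def by blast
  also have "\<dots> \<le> ennreal M"
  proof -
    have "is_weak_horizontal_grad X V v (weak_horizontal_grad X V v)"
      unfolding weak_horizontal_grad_def using wv by (rule someI[of "is_weak_horizontal_grad X V v"])
    from is_weak_horizontal_grad_unique[OF V(1) wv this]
    have ae: "AE x in lebesgue_on V. horizontal_grad X v x = weak_horizontal_grad X V v x" .
    have "continuous_on V (\<lambda>x. (\<lambda>(x, s, p). f x s p) (x, v x, horizontal_grad X v x))"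
      using vc hc VU
      by (intro continuous_on_compose2[OF fc] continuous_intros) (auto intro: continuous_on_subset)
    then have "(\<lambda>x. f x (v x) (horizontal_grad X v x)) \<in> borel_measurable (lebesgue_on V)"
      using V(1) by (intro continuous_imp_measurable_on_sets_lebesgue) auto
    then have m: "(\<lambda>x. f x (v x) (weak_horizontal_grad X V v x)) \<in> borel_measurable (lebesgue_on V)"
      by (rule borel_measurable_lebesgue_on_AE[rotated]) (use V(1) ae in \<open>auto elim!: eventually_mono\<close>)
    have "AE x in lebesgue_on V. ennreal (norm (f x (v x) (weak_horizontal_grad X V v x))) \<le> ennreal M"
      using ae AE_space
    proof eventually_elim
      case (elim x)
      then show ?case using le[of x] unfolding elim(1)[symmetric] by (auto intro!: ennreal_leI)
    qed
    then show ?thesis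
      unfolding supremal_functional_def Linf_norm_def using m by (intro esssup_I) auto
  qed
  finally have fin: "supremal_functional X f u V \<le> ennreal M" .
  have wV: "is_weak_horizontal_grad X V u w"
    by (rule is_weak_horizontal_grad_restrict[OF w V(1) VU U])
  then have "is_weak_horizontal_grad X V u (weak_horizontal_grad X V u)"
    unfolding weak_horizontal_grad_def
    by (rule someI[of "is_weak_horizontal_grad X V u"])
  from is_weak_horizontal_grad_unique[OF V(1) wV this]
  have ae: "AE x in lebesgue_on V. w x = weak_horizontal_grad X V u x" .
  have "AE x in lebesgue_on V. ennreal (norm (f x (u x) (weak_horizontal_grad X V u x)))
      \<le> supremal_functional X f u V"
    unfolding supremal_functional_def Linf_norm_def by (rule esssup_AE)
  with ae show ?thesis
  proof eventually_elim
    case (elim x)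
    then have "ennreal (norm (f x (u x) (w x))) \<le> ennreal M" using fin by (metis order_trans)
    then show ?case using M by (simp add: ennreal_le_iff)
  qed
qed

section \<open>Consequences of quasiconvexity\<close>

lemma quasiconvex_le_imp_derivative_nonpos:
  assumes h: "quasiconvex h" and D: "(h has_derivative D) (at p)" and le: "h p' \<le> h p"
  shows "D (p' - p) \<le> 0"
proof (rule ccontr)
  assume "\<not> ?thesis"
  then have pos: "0 < D (p' - p)" by simp
  have "((\<lambda>s. h (p + s *\<^sub>R (p' - p))) has_real_derivative D (p' - p)) (at 0)"
    using D by (intro has_real_derivative_along_line) simp
  from DERIV_pos_inc_right[OF this pos] obtain d where d: "0 < d"
    "\<And>t. 0 < t \<Longrightarrow> t < d \<Longrightarrow> h p < h (p + t *\<^sub>R (p' - p))" by auto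
  define t where "t = min (d / 2) (1 / 2)"
  have t: "0 < t" "t < d" "t < 1" using d(1) by (auto simp: t_def)
  have "h (t *\<^sub>R p' + (1 - t) *\<^sub>R p) \<le> max (h p') (h p)"
    using h t unfolding quasiconvex_def by blast
  moreover have "t *\<^sub>R p' + (1 - t) *\<^sub>R p = p + t *\<^sub>R (p' - p)" by (simp add: algebra_simps)
  ultimately show False using d(2)[OF t(1,2)] le by simp
qed

text \<open>The gradient \<open>D\<^sub>p f\<close> as a function of the triple \<open>(x, s, p)\<close>.\<close>

definition momentum_grad :: "(real^'n \<Rightarrow> real \<Rightarrow> real^'m \<Rightarrow> real) \<Rightarrow>
    (real^'n) \<times> real \<times> (real^'m) \<Rightarrow> real^'m" where
  "momentum_grad f P = (\<chi> j. frechet_derivative (\<lambda>(x, s, p). f x s p) (at P) (0, 0, axis j 1))"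

lemma momentum_grad_has_derivative:
  fixes f :: "real^'n \<Rightarrow> real \<Rightarrow> real^'m \<Rightarrow> real"
  assumes "Ck_on 1 (U \<times> UNIV \<times> UNIV) (\<lambda>(x, s, p). f x s p)" "x \<in> U"
  shows "((\<lambda>p. f x s p) has_derivative (\<lambda>e. momentum_grad f (x, s, p) \<bullet> e)) (at p)"
proof -
  let ?D = "frechet_derivative (\<lambda>(x, s, p). f x s p) (at (x, s, p))"
  have D: "((\<lambda>(x, s, p). f x s p) has_derivative ?D) (at (x, s, p))"
    using assms by (intro Ck_on_has_derivative[OF assms(1)]) auto
  have "((\<lambda>p. (x, s, p)) has_derivative (\<lambda>e. (0, 0, e))) (at p)"
    by (intro has_derivative_Pair has_derivative_ident has_derivative_const)
  from has_derivative_compose[OF this D]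
  have 1: "((\<lambda>p. f x s p) has_derivative (\<lambda>e. ?D (0, 0, e))) (at p)" by simp
  have "?D (0, 0, e) = momentum_grad f (x, s, p) \<bullet> e" for e
    unfolding has_derivative_eq_inner_partial_derivs[OF 1, of e] momentum_grad_def
    unfolding partial_deriv_def frechet_derivative_at[OF 1, symmetric] ..
  with 1 show ?thesis by simp
qed

lemma continuous_on_momentum_grad:
  fixes f :: "real^'n \<Rightarrow> real \<Rightarrow> real^'m \<Rightarrow> real"
  assumes "Ck_on 1 S (\<lambda>(x, s, p). f x s p)"
  shows "continuous_on S (momentum_grad f)"
  unfolding momentum_grad_def[abs_def]
  using Ck_on_Suc_continuous_derivative[of 0 S] assms by (intro continuous_on_vec_lambda) simp

text \<open>Moving the momentum from \<open>p\<close> by \<open>\<kappa> q\<close> raises \<open>f\<close> by at least \<open>\<kappa> \<mu>\<close>, hence to at least \<open>f x s p'\<close>.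
  The sublevel set at the moved point is convex, so it lies on one side of the hyperplane orthogonal
  to the gradient there.\<close>

lemma quasiconvex_drift_estimate:
  fixes f :: "real^'n \<Rightarrow> real \<Rightarrow> real^'m \<Rightarrow> real"
  assumes f: "Ck_on 1 (U \<times> UNIV \<times> UNIV) (\<lambda>(x, s, p). f x s p)" and x: "x \<in> U"
    and qc: "quasiconvex (\<lambda>p. f x s p)" and \<kappa>: "0 < \<kappa>"
    and lower: "\<And>t. t \<in> {0..\<kappa>} \<Longrightarrow> \<mu> \<le> momentum_grad f (x, s, p + t *\<^sub>R q) \<bullet> q"
    and upper: "momentum_grad f (x, s, p + \<kappa> *\<^sub>R q) \<bullet> q \<le> \<nu>"
    and le: "f x s p' \<le> f x s p + \<kappa> * \<mu>"
  shows "momentum_grad f (x, s, p + \<kappa> *\<^sub>R q) \<bullet> (p' - p) \<le> \<kappa> * \<nu>"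
proof -
  note D = momentum_grad_has_derivative[OF f x, of s]
  have "((\<lambda>t. f x s (p + t *\<^sub>R q)) has_real_derivative momentum_grad f (x, s, p + t *\<^sub>R q) \<bullet> q) (at t)" for t
    using has_real_derivative_along_line[OF D] .
  from MVT2[OF \<kappa> this] obtain t where t: "0 < t" "t < \<kappa>"
    "f x s (p + \<kappa> *\<^sub>R q) - f x s p = \<kappa> * (momentum_grad f (x, s, p + t *\<^sub>R q) \<bullet> q)"
    by auto
  have "\<kappa> * \<mu> \<le> \<kappa> * (momentum_grad f (x, s, p + t *\<^sub>R q) \<bullet> q)"
    using lower[of t] t \<kappa> by (intro mult_left_mono) auto
  then have "f x s p' \<le> f x s (p + \<kappa> *\<^sub>R q)" using le t(3) by linarith
  from quasiconvex_le_imp_derivative_nonpos[OF qc D this]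
  have "momentum_grad f (x, s, p + \<kappa> *\<^sub>R q) \<bullet> (p' - p)
      \<le> \<kappa> * (momentum_grad f (x, s, p + \<kappa> *\<^sub>R q) \<bullet> q)"
    by (simp add: inner_diff_right inner_add_right)
  also have "\<dots> \<le> \<kappa> * \<nu>" using upper \<kappa> by (intro mult_left_mono) auto
  finally show ?thesis .
qed

section \<open>Touching an absolute minimizer\<close>

lemma norm_triple_le:
  "norm ((x, s, p) - (x', s', p')) \<le> norm (x - x') + \<bar>s - s'\<bar> + norm (p - p')"
proof -
  have "norm ((x, s, p) - (x', s', p')) = norm (x - x', s - s', p - p')" by simp
  also have "\<dots> \<le> norm (x - x') + norm (s - s', p - p')" by (rule norm_Pair_le)
  also have "norm (s - s', p - p') \<le> norm (s - s') + norm (p - p')" by (rule norm_Pair_le)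
  finally show ?thesis by simp
qed

text \<open>Both viscosity inequalities at once: the sign \<open>\<sigma>\<close> is \<open>1\<close> for test functions above \<open>u\<close> and \<open>-1\<close>
  for test functions below.\<close>

lemma absolute_minimizer_touching:
  fixes X :: "'m::finite \<Rightarrow> real^'n \<Rightarrow> real^'n" and f :: "real^'n \<Rightarrow> real \<Rightarrow> real^'m \<Rightarrow> real"
  assumes U: "open U" and X: "\<And>j. Ck_on 2 U (X j)"
    and f: "Ck_on 2 (U \<times> UNIV \<times> UNIV) (\<lambda>(x, s, p). f x s p)"
    and f0: "\<And>x s p. x \<in> U \<Longrightarrow> 0 \<le> f x s p"
    and qc: "\<And>x s. x \<in> U \<Longrightarrow> quasiconvex (\<lambda>p. f x s p)"
    and min: "absolute_minimizer U X f u"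
    and x0: "x0 \<in> U" and \<phi>: "Ck_on 2 U \<phi>" and \<phi>0: "\<phi> x0 = u x0"
    and \<sigma>: "\<sigma> * \<sigma> = 1" and touch: "\<forall>\<^sub>F x in nhds x0. 0 \<le> \<sigma> * (\<phi> x - u x)"
  shows "\<sigma> * aronsson_op X f \<phi> x0 \<le> 0"
proof (rule ccontr)
  assume "\<not> ?thesis"
  then have neg: "0 < \<sigma> * aronsson_op X f \<phi> x0" by simp
  define F where "F = (\<lambda>(x, s, p). f x s p)"
  define \<Omega> where "\<Omega> = U \<times> (UNIV :: real set) \<times> (UNIV :: (real^'m) set)"
  have \<Omega>o: "open \<Omega>" unfolding \<Omega>_def using U by (intro open_Times) auto
  have X1: "Ck_on 1 U (X j)" for j using Ck_on_mono[OF X, of 1 j] by simp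
  have F1: "Ck_on 1 \<Omega> F" using Ck_on_mono[OF f, of 1] by (simp add: F_def \<Omega>_def)
  note f1 = F1[unfolded F_def \<Omega>_def]
  define s0 where "s0 = \<phi> x0"
  define p0 where "p0 = horizontal_grad X \<phi> x0"
  define P0 where "P0 = (x0, s0, p0)"
  have P0: "P0 \<in> \<Omega>" using x0 by (simp add: P0_def \<Omega>_def)
  define q0 where "q0 = momentum_grad f P0"
  have q0_eq: "q0 = (\<chi> i. partial_deriv i (\<lambda>p. f x0 (\<phi> x0) p) (horizontal_grad X \<phi> x0))"
  proof -
    have "partial_deriv i (\<lambda>p. f x0 (\<phi> x0) p) (horizontal_grad X \<phi> x0) = q0 $ i" for i
      unfolding partial_deriv_def
        frechet_derivative_at[OF momentum_grad_has_derivative[OF f1 x0], symmetric]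
      by (simp add: q0_def P0_def s0_def p0_def inner_axis)
    then show ?thesis by (simp add: vec_eq_iff)
  qed
  have Fdiff: "(\<lambda>(x, s, p). f x s p) differentiable (at (x0, \<phi> x0, horizontal_grad X \<phi> x0))"
    using Ck_on_has_derivative[OF F1 _ P0]
    unfolding F_def P0_def s0_def p0_def differentiable_def by auto
  obtain \<psi> c where \<psi>: "Ck_on 2 U \<psi>" and c: "0 < c" and \<psi>0: "\<psi> x0 = \<phi> x0"
    and X\<psi>0: "horizontal_grad X \<psi> x0 = p0"
    and \<psi>\<phi>: "\<And>x. c * (norm (x - x0))\<^sup>2 \<le> \<sigma> * (\<psi> x - \<phi> x)"
    and Dh: "((\<lambda>x. f x (\<psi> x) (horizontal_grad X \<psi> x)) has_derivative (\<lambda>_. 0)) (at x0)"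
    and z: "characteristic_direction X q0 x0 \<noteq> 0"
    by (rule exists_corrected_test_function[where X = X, OF U x0 X \<phi> Fdiff \<sigma> neg q0_eq, folded p0_def],
        rule that) (assumption | blast)+
  define z where "z = characteristic_direction X q0 x0"
  have z0: "0 < norm z" "0 < z \<bullet> z" using z by (auto simp: z_def)
  have q00: "q0 \<noteq> 0" using z by (auto simp: characteristic_direction_def)
  then have nq0: "0 < norm q0" "0 < q0 \<bullet> q0" by auto
  have \<psi>1: "Ck_on 1 U \<psi>" using Ck_on_mono[OF \<psi>, of 1] by simp
  define H where "H = horizontal_grad X \<psi>"
  have Hc: "continuous_on U H"
    unfolding H_def using X1 by (intro continuous_on_horizontal_grad U \<psi>1 Ck_on_continuous)
  have \<psi>c: "continuous_on U \<psi>" using Ck_on_continuous[OF \<psi>1] .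
  define h0 where "h0 = f x0 s0 p0"
  have h00: "0 \<le> h0" using f0[OF x0] by (simp add: h0_def)

  obtain wU where wU: "wU \<in> Linf U" "is_weak_horizontal_grad X U u wU"
    and uc: "continuous_on U u"
    using min by (auto simp: absolute_minimizer_def W1inf_cont_def W1inf_def)
  obtain BU where BU: "AE x in lebesgue_on U. norm (wU x) \<le> BU"
  proof -
    have fin: "Linf_norm U wU < \<infinity>" using wU(1) by (simp add: Linf_def)
    have "AE x in lebesgue_on U. ennreal (norm (wU x)) \<le> Linf_norm U wU"
      unfolding Linf_norm_def by (rule esssup_AE)
    then have "AE x in lebesgue_on U. norm (wU x) \<le> enn2real (Linf_norm U wU)"
      by eventually_elim (use fin in \<open>metis enn2real_mono enn2real_ennreal infinity_ennreal_def norm_ge_zero\<close>)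
    then show ?thesis by (rule that)
  qed

  \<comment> \<open>\<open>T1\<close> is the derivative of \<open>f\<close> in the momentum direction \<open>q0\<close>; \<open>T2\<close> is the inner product of
    \<open>z\<close> with the characteristic direction. Both stay close to their values at \<open>P0\<close>.\<close>
  define T1 where "T1 P = momentum_grad f P \<bullet> q0" for P
  define T2 where "T2 P = (\<Sum>j\<in>UNIV. momentum_grad f P $ j * (X j (fst P) \<bullet> z))" for P :: "(real^'n) \<times> real \<times> (real^'m)"
  have Qc: "continuous_on \<Omega> (momentum_grad f)"
    by (rule continuous_on_momentum_grad) (use F1 in \<open>simp add: F_def\<close>)
  have T1c: "continuous_on \<Omega> T1" unfolding T1_def[abs_def] using Qc by (intro continuous_intros)
  have T2c: "continuous_on \<Omega> T2" unfolding T2_def[abs_def] using Qc Ck_on_continuous[OF X]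
    by (intro continuous_intros continuous_on_compose2[of U "X j" \<Omega> fst for j]) (auto simp: \<Omega>_def)
  have T1P0: "T1 P0 = q0 \<bullet> q0" by (simp add: T1_def q0_def)
  have T2P0: "T2 P0 = z \<bullet> z"
  proof -
    have "T2 P0 = (\<Sum>j\<in>UNIV. q0 $ j * (X j x0 \<bullet> z))" by (simp add: T2_def q0_def P0_def)
    also have "\<dots> = characteristic_direction X q0 x0 \<bullet> z"
      by (simp add: characteristic_direction_def inner_sum_left)
    finally show ?thesis by (simp only: z_def)
  qed
  have cont: "(T \<longlongrightarrow> T P0) (nhds P0)" if "continuous_on \<Omega> T" for T :: "_ \<Rightarrow> real"
    using that \<Omega>o P0 by (simp add: continuous_on_eq_continuous_at continuous_at tendsto_at_iff_tendsto_nhds)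
  have "\<forall>\<^sub>F P in nhds P0. P \<in> \<Omega> \<and> q0 \<bullet> q0 / 2 < T1 P \<and> T1 P < 3 / 2 * (q0 \<bullet> q0) \<and> z \<bullet> z / 2 < T2 P"
    using cont[OF T1c] cont[OF T2c] nq0 z0 \<Omega>o P0 unfolding T1P0 T2P0
    by (intro eventually_conj eventually_nhds_in_open order_tendstoD) auto
  then obtain \<rho>' where \<rho>': "0 < \<rho>'" "\<And>P. dist P P0 < \<rho>' \<Longrightarrow> P \<in> \<Omega> \<and> q0 \<bullet> q0 / 2 < T1 P \<and>
      T1 P < 3 / 2 * (q0 \<bullet> q0) \<and> z \<bullet> z / 2 < T2 P"
    unfolding eventually_nhds_metric by metis
  define \<rho> where "\<rho> = \<rho>' / 2"
  have \<rho>0: "0 < \<rho>" using \<rho>'(1) by (simp add: \<rho>_def)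
  have \<rho>: "P \<in> \<Omega>" "q0 \<bullet> q0 / 2 \<le> T1 P" "T1 P \<le> 3 / 2 * (q0 \<bullet> q0)" "z \<bullet> z / 2 \<le> T2 P"
    if "P \<in> cball P0 \<rho>" for P
    using \<rho>'(2)[of P] that \<rho>'(1) by (auto simp: \<rho>_def dist_commute)
  obtain L where L: "0 \<le> L" "\<And>S x y. convex S \<Longrightarrow> S \<subseteq> cball P0 \<rho> \<Longrightarrow> x \<in> S \<Longrightarrow> y \<in> S \<Longrightarrow>
      \<bar>F x - F y\<bar> \<le> L * norm (x - y)"
    by (rule C1_Lipschitz_on_convex_subsets[OF F1 compact_cball, of P0 \<rho>]) (use \<rho>(1) in auto)

  \<comment> \<open>This choice makes the linear correction below at most \<open>c r\<^sup>2 / 4\<close> on the ball of radius \<open>r\<close>.\<close>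
  define \<eta> where "\<eta> = c * norm z / 56"
  have \<eta>: "0 < \<eta>" using c z0 by (simp add: \<eta>_def)

  have "\<forall>\<^sub>F x in nhds x0. norm (f x (\<psi> x) (H x) - h0) \<le> \<eta> / 2 * norm (x - x0)"
  proof -
    obtain d where "0 < d" "\<And>y. norm (y - x0) < d \<Longrightarrow>
        norm (f y (\<psi> y) (H y) - f x0 (\<psi> x0) (H x0) - 0) \<le> \<eta> / 2 * norm (y - x0)"
      using Dh \<eta> unfolding has_derivative_at_alt H_def by (metis half_gt_zero)
    then show ?thesis
      unfolding eventually_nhds_metric by (auto simp: dist_norm h0_def s0_def \<psi>0 H_def X\<psi>0)
  qed
  moreover have "\<forall>\<^sub>F x in nhds x0. \<bar>\<psi> x - s0\<bar> < \<rho> / 8"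
  proof -
    have "(\<psi> \<longlongrightarrow> \<psi> x0) (nhds x0)"
      using \<psi>c U x0 by (simp add: continuous_on_eq_continuous_at continuous_at tendsto_at_iff_tendsto_nhds)
    from tendstoD[OF this, of "\<rho> / 8"] show ?thesis using \<rho>0 by (simp add: \<psi>0 s0_def dist_real_def)
  qed
  moreover have "\<forall>\<^sub>F x in nhds x0. norm (H x - p0) < \<rho> / 8"
  proof -
    have "(H \<longlongrightarrow> H x0) (nhds x0)"
      using Hc U x0 by (simp add: continuous_on_eq_continuous_at continuous_at tendsto_at_iff_tendsto_nhds)
    from tendstoD[OF this, of "\<rho> / 8"] show ?thesis using \<rho>0 by (simp add: H_def X\<psi>0 dist_norm)
  qed
  moreover have "\<forall>\<^sub>F x in nhds x0. x \<in> U" using U x0 by (rule eventually_nhds_in_open)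
  moreover note touch
  ultimately have "\<forall>\<^sub>F x in nhds x0. norm (f x (\<psi> x) (H x) - h0) \<le> \<eta> / 2 * norm (x - x0) \<and>
      \<bar>\<psi> x - s0\<bar> < \<rho> / 8 \<and> norm (H x - p0) < \<rho> / 8 \<and> x \<in> U \<and> 0 \<le> \<sigma> * (\<phi> x - u x)"
    by eventually_elim auto
  then obtain R' where R': "0 < R'" "\<And>x. dist x x0 < R' \<Longrightarrow>
      norm (f x (\<psi> x) (H x) - h0) \<le> \<eta> / 2 * norm (x - x0) \<and>
      \<bar>\<psi> x - s0\<bar> < \<rho> / 8 \<and> norm (H x - p0) < \<rho> / 8 \<and> x \<in> U \<and> 0 \<le> \<sigma> * (\<phi> x - u x)"
    unfolding eventually_nhds_metric by metis
  define R where "R = R' / 2"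
  have R0: "0 < R" using R'(1) by (simp add: R_def)
  have R: "\<bar>f x (\<psi> x) (H x) - h0\<bar> \<le> \<eta> / 2 * norm (x - x0)" "\<bar>\<psi> x - s0\<bar> \<le> \<rho> / 8"
    "norm (H x - p0) \<le> \<rho> / 8" "x \<in> U" "0 \<le> \<sigma> * (\<phi> x - u x)" if "x \<in> cball x0 R" for x
    using R'(2)[of x] that R'(1) by (auto simp: R_def dist_commute)

  have lim: "((\<lambda>r. c * r\<^sup>2) \<longlongrightarrow> c * 0\<^sup>2) (at_right (0::real))"
    "((\<lambda>r. L * c * r) \<longlongrightarrow> L * c * 0) (at_right (0::real))"
    "((\<lambda>r. 4 * \<eta> * r / norm q0) \<longlongrightarrow> 4 * \<eta> * 0 / norm q0) (at_right (0::real))"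
    "((\<lambda>r. r) \<longlongrightarrow> 0) (at_right (0::real))"
    by (intro tendsto_intros; use nq0 in simp)+
  have "\<forall>\<^sub>F r in at_right (0::real). 0 < r \<and> c * r\<^sup>2 < \<rho> / 8 \<and> L * c * r < \<eta> / 2 \<and>
      4 * \<eta> * r / norm q0 < \<rho> / 8 \<and> r < R \<and> r < \<rho> / 8"
    using \<rho>0 \<eta> R0
    by (intro eventually_conj order_tendstoD(2)[OF lim(1)] order_tendstoD(2)[OF lim(2)]
        order_tendstoD(2)[OF lim(3)] order_tendstoD(2)[OF lim(4)] eventually_at_right_less) auto
  then obtain r where r: "0 < r" "c * r\<^sup>2 < \<rho> / 8" "L * c * r < \<eta> / 2"
      "4 * \<eta> * r / norm q0 < \<rho> / 8" "r < R" "r < \<rho> / 8"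
    using eventually_happens[of _ "at_right (0::real)"] by auto

  define d where "d x = \<sigma> * (u x - \<psi> x)" for x
  have dc: "continuous_on U d" unfolding d_def[abs_def] using uc \<psi>c by (intro continuous_intros)
  have d_le: "d x \<le> - c * (norm (x - x0))\<^sup>2" if "x \<in> cball x0 R" for x
    using R(5)[OF that] \<psi>\<phi>[of x] by (simp add: d_def algebra_simps)
  have d0: "d x0 = 0" by (simp add: d_def \<psi>0 \<phi>0)
  have RU: "cball x0 R \<subseteq> U" using R(4) by auto
  \<comment> \<open>By \<open>d_le\<close> this set lies in the ball of radius \<open>r < R\<close>, so its closure stays inside the
    ball of radius \<open>R\<close>.\<close>
  define V where "V = {x \<in> ball x0 R. - c * r\<^sup>2 < d x}"
  have Vo: "open V"
  proof -
    have "continuous_on (ball x0 R) d" using dc RU by (rule continuous_on_subset[OF _ order_trans[OF ball_subset_cball]])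
    then have "openin (top_of_set (ball x0 R)) (ball x0 R \<inter> d -` {- c * r\<^sup>2<..})"
      by (intro continuous_openin_preimage_gen open_greaterThan)
    moreover have "V = ball x0 R \<inter> d -` {- c * r\<^sup>2<..}" by (auto simp: V_def)
    ultimately show ?thesis by (simp add: openin_open_eq)
  qed
  have V_r: "V \<subseteq> cball x0 r"
  proof
    fix x assume x: "x \<in> V"
    then have "c * (norm (x - x0))\<^sup>2 < c * r\<^sup>2" using d_le[of x] by (auto simp: V_def)
    then have "(norm (x - x0))\<^sup>2 \<le> r\<^sup>2" using c by simp
    then have "norm (x - x0) \<le> r" by (rule power2_le_imp_le) (use r(1) in simp)
    then show "x \<in> cball x0 r" by (simp add: dist_norm norm_minus_commute)
  qed
  have rR: "cball x0 r \<subseteq> ball x0 R" using r(5) by (simp add: cball_subset_ball_iff)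
  have clV: "closure V \<subseteq> cball x0 r" using V_r by (intro closure_minimal) auto
  have clU: "closure V \<subseteq> U" using clV rR RU ball_subset_cball by blast
  have VU: "V \<subseteq> U" using clU closure_subset by blast
  have cptV: "compact (closure V)"
    by (simp add: compact_eq_bounded_closed bounded_subset[OF bounded_cball clV])
  have super_closed: "closed {x \<in> cball x0 r. k \<le> d x}" for k
  proof -
    have "cball x0 r \<subseteq> U" using rR RU ball_subset_cball by blast
    then have "closed (cball x0 r \<inter> d -` {k..})"
      by (intro continuous_closed_preimage continuous_on_subset[OF dc]) auto
    moreover have "cball x0 r \<inter> d -` {k..} = {x \<in> cball x0 r. k \<le> d x}" by auto
    ultimately show ?thesis by simp
  qed
  have x0V: "x0 \<in> V" using R0 d0 c r(1) by (simp add: V_def)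

  have X\<psi>c: "horizontal_grad X (\<lambda>x. \<psi> x - k) x = H x" if "x \<in> U" for x k
  proof -
    have D: "(\<psi> has_derivative frechet_derivative \<psi> (at x)) (at x)"
      by (rule Ck_on_has_derivative[OF \<psi>1 _ that]) simp
    then have D': "((\<lambda>x. \<psi> x - k) has_derivative frechet_derivative \<psi> (at x)) (at x)"
      by (auto intro!: derivative_eq_intros)
    show ?thesis
      by (simp add: vec_eq_iff H_def horizontal_grad_nth_eq_derivative[OF D]
          horizontal_grad_nth_eq_derivative[OF D'])
  qed

  have near: "(x, s, H x + e) \<in> cball P0 \<rho>"
    if "x \<in> cball x0 r" "\<bar>s - \<psi> x\<bar> \<le> c * r\<^sup>2" "norm e \<le> \<rho> / 8" for x s e
  proof -
    have xR: "x \<in> cball x0 R" using that(1) rR by auto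
    have "norm ((x, s, H x + e) - P0) \<le> norm (x - x0) + \<bar>s - s0\<bar> + norm (H x + e - p0)"
      unfolding P0_def by (rule norm_triple_le)
    moreover have "norm (x - x0) \<le> \<rho> / 8" using that(1) r(6) by (simp add: dist_norm norm_minus_commute)
    moreover have "\<bar>s - s0\<bar> \<le> \<rho> / 8 + \<rho> / 8" using that(2) R(2)[OF xR] r(2) by linarith
    moreover have "norm (H x + e - p0) \<le> norm (H x - p0) + norm e"
      by (metis add_diff_eq diff_add_eq norm_triangle_ineq)
    ultimately have "norm ((x, s, H x + e) - P0) \<le> \<rho>" using R(3)[OF xR] that(3) \<rho>0 by linarith
    then show ?thesis by (simp add: dist_norm norm_minus_commute)
  qed
  \<comment> \<open>Since \<open>f(x, \<psi>, X\<psi>)\<close> is stationary at \<open>x0\<close>, half of the error \<open>\<eta> r\<close> covers the variation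
    of \<open>x\<close>; the other half covers the change of the second argument by at most \<open>c r\<^sup>2\<close>.\<close>
  have val: "\<bar>f x s (H x) - h0\<bar> \<le> \<eta> * r"
    if "x \<in> cball x0 r" "\<bar>s - \<psi> x\<bar> \<le> c * r\<^sup>2" for x s
  proof -
    have xR: "x \<in> cball x0 R" using that(1) rR by auto
    have "\<bar>F (x, s, H x) - F (x, \<psi> x, H x)\<bar> \<le> L * norm ((x, s, H x) - (x, \<psi> x, H x))"
      by (rule L(2)[OF convex_cball order_refl])
         (use near[of x s 0] near[of x "\<psi> x" 0] that c \<rho>0 in auto)
    also have "norm ((x, s, H x) - (x, \<psi> x, H x)) \<le> c * r\<^sup>2"
      using norm_triple_le[of x s "H x" x "\<psi> x" "H x"] that(2) by simp
    then have "L * norm ((x, s, H x) - (x, \<psi> x, H x)) \<le> L * (c * r\<^sup>2)"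
      using L(1) by (rule mult_left_mono)
    also have "\<dots> = (L * c * r) * r" by (simp add: power2_eq_square)
    also have "\<dots> \<le> \<eta> / 2 * r" using r(1,3) by (intro mult_right_mono) auto
    finally have "\<bar>f x s (H x) - f x (\<psi> x) (H x)\<bar> \<le> \<eta> / 2 * r" by (simp add: F_def)
    moreover have "\<bar>f x (\<psi> x) (H x) - h0\<bar> \<le> \<eta> / 2 * r"
    proof -
      have "\<eta> / 2 * norm (x - x0) \<le> \<eta> / 2 * r"
        using that(1) \<eta> by (intro mult_left_mono) (auto simp: dist_norm norm_minus_commute)
      then show ?thesis using R(1)[OF xR] by linarith
    qed
    moreover have "\<eta> / 2 * r + \<eta> / 2 * r = \<eta> * r" by simp
    ultimately show ?thesis by linarith
  qed

  have abs\<sigma>: "\<bar>\<sigma>\<bar> = 1" using \<sigma> by (metis abs_1 abs_mult abs_mult_self_eq mult_1 real_sqrt_abs2 real_sqrt_one)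
  have u\<psi>: "\<bar>u x - \<psi> x\<bar> = \<bar>d x\<bar>" for x using abs\<sigma> by (simp add: d_def abs_mult)
  have u\<psi>V: "\<bar>u x - \<psi> x\<bar> \<le> c * r\<^sup>2" if "x \<in> V" for x
  proof -
    have "d x \<le> - c * (norm (x - x0))\<^sup>2" using that by (intro d_le) (auto simp: V_def)
    also have "\<dots> \<le> 0" using c by simp
    finally show ?thesis using that unfolding u\<psi> by (auto simp: V_def)
  qed

  have u_le: "AE x in lebesgue_on V. f x (u x) (wU x) \<le> h0 + \<eta> * r"
  proof (rule absolute_minimizer_AE_le[where X = X, OF U X1 _ min wU(2) Vo clU cptV,
        where v = "\<lambda>x. \<psi> x - \<sigma> * (c * r\<^sup>2)"])
    show "continuous_on (U \<times> UNIV \<times> UNIV) (\<lambda>(x, s, p). f x s p)"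
      using Ck_on_continuous[OF f] .
    show "Ck_on 1 U (\<lambda>x. \<psi> x - \<sigma> * (c * r\<^sup>2))" by (intro Ck_on_minus Ck_on_const U \<psi>1)
    show "0 \<le> h0 + \<eta> * r" using h00 \<eta> r(1) by simp
    show "\<bar>f x (\<psi> x - \<sigma> * (c * r\<^sup>2)) (horizontal_grad X (\<lambda>x. \<psi> x - \<sigma> * (c * r\<^sup>2)) x)\<bar> \<le> h0 + \<eta> * r"
      if "x \<in> V" for x
    proof -
      have "x \<in> U" "x \<in> cball x0 r" using that VU V_r by auto
      moreover have "\<bar>f x (\<psi> x - \<sigma> * (c * r\<^sup>2)) (H x) - h0\<bar> \<le> \<eta> * r"
        using \<open>x \<in> cball x0 r\<close> c abs\<sigma> by (intro val) (auto simp: abs_mult)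
      ultimately show ?thesis using f0[of x "\<psi> x - \<sigma> * (c * r\<^sup>2)" "H x"] by (simp add: X\<psi>c)
    qed
    show "\<psi> x - \<sigma> * (c * r\<^sup>2) = u x" if "x \<in> closure V" "x \<notin> V" for x
    proof -
      have "x \<in> ball x0 R" using that(1) clV rR by auto
      then have "d x \<le> - c * r\<^sup>2" using that(2) by (auto simp: V_def)
      moreover have "- c * r\<^sup>2 \<le> d x"
      proof -
        have "closed {x \<in> cball x0 r. - c * r\<^sup>2 \<le> d x}" by (rule super_closed)
        moreover have "V \<subseteq> {x \<in> cball x0 r. - c * r\<^sup>2 \<le> d x}" using V_r by (auto simp: V_def)
        ultimately show ?thesis using that(1) closure_minimal by blast
      qed
      ultimately have "\<sigma> * d x = \<sigma> * (- c * r\<^sup>2)" by simp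
      moreover have "\<sigma> * d x = u x - \<psi> x" using \<sigma> by (simp add: d_def mult.assoc[symmetric])
      ultimately show ?thesis by simp
    qed
  qed

  \<comment> \<open>The shift by \<open>\<kappa> q0\<close> raises \<open>f\<close> by at least \<open>2 \<eta> r\<close>, the gap between the bounds for
    \<open>f(x, u, Xu)\<close> and \<open>f(x, u, X\<psi>)\<close>.\<close>
  define \<kappa> where "\<kappa> = 4 * \<eta> * r / (q0 \<bullet> q0)"
  have \<kappa>: "0 < \<kappa>" using \<eta> r(1) nq0 by (simp add: \<kappa>_def)
  have \<kappa>q: "norm (t *\<^sub>R q0) \<le> \<rho> / 8" if "t \<in> {0..\<kappa>}" for t
  proof -
    have "norm (t *\<^sub>R q0) \<le> \<kappa> * norm q0" using that by (simp add: mult_right_mono)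
    also have "\<dots> = 4 * \<eta> * r / norm q0"
      using nq0 by (simp add: \<kappa>_def power2_norm_eq_inner[symmetric] power2_eq_square)
    finally show ?thesis using r(4) by simp
  qed
  \<comment> \<open>The slope of the linear correction: it contributes at least \<open>7 \<eta> r\<close> along \<open>Q\<close>, which beats the
    drift \<open>6 \<eta> r\<close>.\<close>
  define \<tau> where "\<tau> = 14 * \<eta> * r / (z \<bullet> z)"
  have \<tau>: "0 < \<tau>" using \<eta> r(1) z0 by (simp add: \<tau>_def)
  define Q where "Q x = momentum_grad f (x, u x, H x + \<kappa> *\<^sub>R q0)" for x
  define G where "G x = H x + (\<chi> j. \<tau> * (X j x \<bullet> z))" for x
  have drift: "Q x \<bullet> (p' - G x) \<le> - (\<eta> * r)"
    if x: "x \<in> V" and p': "f x (u x) p' \<le> h0 + \<eta> * r" for x p'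
  proof -
    have xr: "x \<in> cball x0 r" and xU: "x \<in> U" using x V_r VU by auto
    have nb: "(x, u x, H x + t *\<^sub>R q0) \<in> cball P0 \<rho>" if "t \<in> {0..\<kappa>}" for t
      by (rule near[OF xr u\<psi>V[OF x] \<kappa>q[OF that]])
    have "Q x \<bullet> (p' - H x) \<le> \<kappa> * (3 / 2 * (q0 \<bullet> q0))"
      unfolding Q_def
    proof (rule quasiconvex_drift_estimate[OF f1 xU qc[OF xU] \<kappa>, where \<mu> = "q0 \<bullet> q0 / 2"])
      show "q0 \<bullet> q0 / 2 \<le> momentum_grad f (x, u x, H x + t *\<^sub>R q0) \<bullet> q0" if "t \<in> {0..\<kappa>}" for t
        using \<rho>(2)[OF nb[OF that]] by (simp add: T1_def)
      show "momentum_grad f (x, u x, H x + \<kappa> *\<^sub>R q0) \<bullet> q0 \<le> 3 / 2 * (q0 \<bullet> q0)"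
        using \<rho>(3)[OF nb[of \<kappa>]] \<kappa> by (simp add: T1_def)
      have "\<kappa> * (q0 \<bullet> q0 / 2) = 2 * (\<eta> * r)" using nq0 by (simp add: \<kappa>_def)
      then show "f x (u x) p' \<le> f x (u x) (H x) + \<kappa> * (q0 \<bullet> q0 / 2)"
        using p' val[OF xr u\<psi>V[OF x]] by linarith
    qed
    also have "\<dots> = 6 * (\<eta> * r)" using nq0 by (simp add: \<kappa>_def)
    finally have 1: "Q x \<bullet> (p' - H x) \<le> 6 * (\<eta> * r)" .
    have "T2 (x, u x, H x + \<kappa> *\<^sub>R q0) = (\<Sum>j\<in>UNIV. Q x $ j * (X j x \<bullet> z))"
      by (simp add: T2_def Q_def)
    then have "Q x \<bullet> (\<chi> j. \<tau> * (X j x \<bullet> z)) = \<tau> * T2 (x, u x, H x + \<kappa> *\<^sub>R q0)"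
      by (simp add: inner_vec_def[of "Q x"] sum_distrib_left mult_ac)
    also have "\<tau> * (z \<bullet> z / 2) \<le> \<dots>"
      using \<rho>(4)[OF nb[of \<kappa>]] \<kappa> \<tau> by (intro mult_left_mono) auto
    also have "\<tau> * (z \<bullet> z / 2) = 7 * (\<eta> * r)" using z0 by (simp add: \<tau>_def)
    finally have "7 * (\<eta> * r) \<le> Q x \<bullet> (\<chi> j. \<tau> * (X j x \<bullet> z))" .
    with 1 show ?thesis by (simp add: G_def inner_diff_right inner_add_right)
  qed

  define \<psi>' where "\<psi>' x = \<psi> x + \<tau> * ((x - x0) \<bullet> z)" for x
  have \<psi>'1: "Ck_on 1 U \<psi>'" unfolding \<psi>'_def[abs_def]
    by (intro Ck_on_add Ck_on_cmult Ck_on_inner_left Ck_on_minus Ck_on_ident Ck_on_const U \<psi>1)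
  have X\<psi>': "horizontal_grad X \<psi>' x = G x" if "x \<in> U" for x
  proof -
    have D: "(\<psi> has_derivative frechet_derivative \<psi> (at x)) (at x)"
      by (rule Ck_on_has_derivative[OF \<psi>1 _ that]) simp
    then have D': "(\<psi>' has_derivative (\<lambda>b. frechet_derivative \<psi> (at x) b + \<tau> * (b \<bullet> z))) (at x)"
      unfolding \<psi>'_def[abs_def] by (auto intro!: derivative_eq_intros)
    show ?thesis
      by (simp add: vec_eq_iff G_def H_def horizontal_grad_nth_eq_derivative[OF D]
          horizontal_grad_nth_eq_derivative[OF D'])
  qed
  have Gc: "continuous_on U G" unfolding G_def[abs_def] using Hc Ck_on_continuous[OF X]
    by (intro continuous_intros)
  obtain BG where BG: "\<And>x. x \<in> closure V \<Longrightarrow> norm (G x) \<le> BG"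
    using compact_imp_bounded[OF compact_continuous_image[OF continuous_on_subset[OF Gc clU] cptV]]
    by (auto simp: bounded_iff)
  define v where "v x = \<sigma> * (u x - \<psi>' x)" for x
  define w where "w x = \<sigma> *\<^sub>R (wU x - horizontal_grad X \<psi>' x)" for x
  define K where "K = {x \<in> cball x0 r. - (3 / 4) * (c * r\<^sup>2) \<le> d x}"
  have vd: "v x = d x - \<sigma> * (\<tau> * ((x - x0) \<bullet> z))" for x
    by (simp add: v_def d_def \<psi>'_def algebra_simps)
  have shift: "\<bar>\<sigma> * (\<tau> * ((x - x0) \<bullet> z))\<bar> \<le> c * r\<^sup>2 / 4" if "x \<in> cball x0 r" for x
  proof -
    have "\<bar>(x - x0) \<bullet> z\<bar> \<le> norm (x - x0) * norm z" by (rule Cauchy_Schwarz_ineq2)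
    also have "\<dots> \<le> r * norm z"
      using that by (intro mult_right_mono) (auto simp: dist_norm norm_minus_commute)
    finally have "\<tau> * \<bar>(x - x0) \<bullet> z\<bar> \<le> \<tau> * (r * norm z)" using \<tau> by (intro mult_left_mono) auto
    also have "\<dots> = c * r\<^sup>2 / 4"
      using z0 by (simp add: \<tau>_def \<eta>_def power2_norm_eq_inner[symmetric] power2_eq_square)
    finally show ?thesis using abs\<sigma> \<tau> by (simp add: abs_mult)
  qed
  have aeU: "AE x in lebesgue. x \<in> U \<longrightarrow> norm (wU x) \<le> BU"
    using BU U by (simp add: AE_restrict_space_iff)
  show False
  proof (rule strict_weak_inequality_imp_no_interior_max[where X = X and V = V and v = v and w = w and
        Q = "\<lambda>x. \<sigma> *\<^sub>R Q x" and \<theta> = "\<eta> * r" and K = K and ?x0.0 = x0 and \<beta> = "- (c * r\<^sup>2 / 2)" and P = "BU + BG"])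
    show "open V" by (rule Vo)
    show XV: "Ck_on 1 V (X j)" for j using Ck_on_subset[OF X1 VU] .
    show "continuous_on V v" unfolding v_def[abs_def]
      using continuous_on_subset[OF uc VU] continuous_on_subset[OF Ck_on_continuous[OF \<psi>'1] VU]
      by (intro continuous_intros)
    show "is_weak_horizontal_grad X V v w" unfolding v_def[abs_def] w_def[abs_def]
      by (intro is_weak_horizontal_grad_scale is_weak_horizontal_grad_diff Vo XV
          is_weak_horizontal_grad_restrict[OF wU(2) Vo VU U]
          is_weak_horizontal_grad_classical Ck_on_subset[OF \<psi>'1 VU])
    show "AE y in lebesgue_on V. norm (w y) \<le> BU + BG"
    proof -
      have "AE y in lebesgue. y \<in> V \<longrightarrow> norm (w y) \<le> BU + BG"
        using aeU
      proof eventually_elim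
        case (elim y)
        show ?case
        proof
          assume y: "y \<in> V"
          then have "norm (wU y) \<le> BU" "norm (G y) \<le> BG" "horizontal_grad X \<psi>' y = G y"
            using elim VU BG closure_subset X\<psi>' by blast+
          then show "norm (w y) \<le> BU + BG"
            using norm_triangle_ineq4[of "wU y" "G y"] abs\<sigma> by (simp add: w_def)
        qed
      qed
      then show ?thesis using Vo by (simp add: AE_restrict_space_iff)
    qed
    show "continuous_on V (\<lambda>x. \<sigma> *\<^sub>R Q x)"
    proof -
      have "continuous_on V (\<lambda>x. (x, u x, H x + \<kappa> *\<^sub>R q0))"
        using continuous_on_subset[OF uc VU] continuous_on_subset[OF Hc VU] by (intro continuous_intros)
      then have "continuous_on V Q" unfolding Q_def[abs_def]
        by (rule continuous_on_compose2[OF Qc]) (use VU in \<open>auto simp: \<Omega>_def\<close>)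
      then show ?thesis by (intro continuous_intros)
    qed
    show "0 < \<eta> * r" using \<eta> r(1) by simp
    show "AE y in lebesgue_on V. (\<sigma> *\<^sub>R Q y) \<bullet> w y \<le> - (\<eta> * r)"
      using u_le AE_space
    proof eventually_elim
      case (elim y)
      then have "y \<in> V" by simp
      have "(\<sigma> *\<^sub>R Q y) \<bullet> w y = (\<sigma> * \<sigma>) * (Q y \<bullet> (wU y - G y))"
        using \<open>y \<in> V\<close> VU X\<psi>'[of y] by (auto simp: w_def)
      then show ?case using drift[OF \<open>y \<in> V\<close> elim(1)] by (simp add: \<sigma>)
    qed
    show "compact K"
    proof -
      have "closed K" unfolding K_def by (rule super_closed)
      moreover have "K \<subseteq> cball x0 r" by (auto simp: K_def)
      ultimately show ?thesis by (simp add: compact_eq_bounded_closed bounded_subset[OF bounded_cball])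
    qed
    have cr: "0 < c * r\<^sup>2" using c r(1) by simp
    show "K \<subseteq> V"
    proof
      fix x assume x: "x \<in> K"
      then have "- (c * r\<^sup>2) < - (3 / 4) * (c * r\<^sup>2)" "x \<in> ball x0 R" using cr rR by (auto simp: K_def)
      with x show "x \<in> V" by (auto simp: V_def K_def)
    qed
    show "x0 \<in> V" by (rule x0V)
    show "- (c * r\<^sup>2 / 2) < v x0" using cr by (simp add: vd d0)
    show "y \<in> K" if "y \<in> V" "- (c * r\<^sup>2 / 2) < v y" for y
    proof -
      have "y \<in> cball x0 r" using that(1) V_r by auto
      then show ?thesis using shift[of y] that(2) unfolding vd K_def by auto
    qed
  qed
qed

theorem theorem3p1:
  fixes U :: "(real^'n) set"
    and X :: "'m::finite \<Rightarrow> real^'n \<Rightarrow> real^'n"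
    and f :: "real^'n \<Rightarrow> real \<Rightarrow> real^'m \<Rightarrow> real"
    and u :: "real^'n \<Rightarrow> real"
  assumes "open U" and "connected U"
    and "CARD('m) \<le> CARD('n)"
    and "\<forall>i. Ck_on 2 U (X i)"
    and "cc_continuous_distance U X"
    and "Ck_on 2 (U \<times> UNIV \<times> UNIV) (\<lambda>(x, s, p). f x s p)"
    and "\<forall>x\<in>U. \<forall>s p. f x s p \<ge> 0"
    and "\<forall>x\<in>U. \<forall>s. quasiconvex (\<lambda>p. f x s p)"
    and "absolute_minimizer U X f u"
  shows "viscosity_solution U X f u"
proof -
  have touching: "\<sigma> * aronsson_op X f \<phi> x0 \<le> 0"
    if "x0 \<in> U" "Ck_on 2 U \<phi>" "\<phi> x0 - u x0 = 0" "\<sigma> * \<sigma> = 1"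
      "\<forall>\<^sub>F x in nhds x0. 0 \<le> \<sigma> * (\<phi> x - u x)" for \<sigma> x0 \<phi>
    using assms that by (intro absolute_minimizer_touching[where U = U and u = u]) auto
  have "continuous_on U u"
    using assms(9) by (auto simp: absolute_minimizer_def W1inf_cont_def)
  moreover have "aronsson_op X f \<phi> x0 \<le> 0"
    if "x0 \<in> U" "Ck_on 2 U \<phi>" "\<phi> x0 - u x0 = 0" "\<forall>\<^sub>F x in nhds x0. 0 \<le> \<phi> x - u x" for x0 \<phi>
    using touching[of x0 \<phi> 1] that by simp
  moreover have "0 \<le> aronsson_op X f \<phi> x0"
    if "x0 \<in> U" "Ck_on 2 U \<phi>" "\<phi> x0 - u x0 = 0" "\<forall>\<^sub>F x in nhds x0. \<phi> x - u x \<le> 0" for x0 \<phi>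
    using touching[of x0 \<phi> "- 1"] that by simp
  ultimately show ?thesis
    unfolding viscosity_solution_def viscosity_subsolution_def viscosity_supersolution_def by blast
qed

end
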